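(* Let $\triangle$ be a simplicial complex on the finite vertex set $V=[n]$. The cohomology groups of the sheaf of units of its simplicial binoid on the punctured spectrum are given by \[ \mathrm H^j\left(\operatorname{Spec}^\bullet M_\triangle,\mathcal O^*_{M_\triangle}\right)\cong\bigoplus_{i\in V}\widetilde{\mathrm H}^{j-1}\left(\operatorname{lk}_\triangle(i),\mathbb Z\right) \] for $j\geq0$.
   Context: A simplicial complex $\triangle$ on $V=[n]$ is a collection of subsets (faces) of $V$ closed under taking subsets; all singletons are assumed to be faces. $\operatorname{lk}_\triangle(i)=\{G\in\triangle\mid\{i\}\cup G\in\triangle,\ i\notin G\}$ is the link of the vertex $i$. $\widetilde{\mathrm H}^{k}$ is reduced simplicial cohomology, including degree $-1$ (so $\widetilde{\mathrm H}^{-1}(\{\varnothing\},\mathbb Z)=\mathbb Z$). A (commutative) binoid is a commutative monoid $(M,+,0)$ with an absorbing element $\infty$. The simplicial binoid $M_\triangle$ is the binoid with generators $x_1,\dots,x_n$ and relations $x_{i_1}+\dots+x_{i_k}=\infty$ for every $\{i_1,\dots,i_k\}\subseteq[n]$ that is not a face of $\triangle$. A prime ideal of a binoid $M$ is a subset $\mathfrak p\ni\infty$ with $\mathfrak p+M\subseteq\mathfrak p$ and $M\smallsetminus\mathfrak p$ a submonoid; $\operatorname{Spec}M$ is the set of prime ideals with basis of open sets $D(f)=\{\mathfrak p\mid f\notin\mathfrak p\}$, and $\operatorname{Spec}^\bullet M$ is $\operatorname{Spec}M$ minus its unique maximal element $M_+$ (the ideal of non-units). The structure sheaf $\mathcal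 O_M$ is the sheaf of binoids on $\operatorname{Spec}M$ with $\mathcal O_M(D(f))=M_f$ (localization), and $\mathcal O^*_M$ is its sheaf of units, a sheaf of abelian groups. $\mathrm H^j$ is sheaf cohomology. *)

theory Defs
  imports
    "HOL-Analysis.Abstract_Topology"
    "HOL-Algebra.Product_Groups"
    "HOL-Library.Multiset"
begin

section \<open>Simplicial complexes and reduced simplicial cohomology\<close>

definition simplicial_complex :: "'v set \<Rightarrow> 'v set set \<Rightarrow> bool" where
  "simplicial_complex V \<Delta> \<longleftrightarrow>
     \<Delta> \<subseteq> Pow V \<and> (\<forall>F\<in>\<Delta>. \<forall>G. G \<subseteq> F \<longrightarrow> G \<in> \<Delta>) \<and> (\<forall>v\<in>V. {v} \<in> \<Delta>)"

definition link :: "'v set set \<Rightarrow> 'v \<Rightarrow> 'v set set" where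
  "link \<Delta> i = {G \<in> \<Delta>. {i} \<union> G \<in> \<Delta> \<and> i \<notin> G}"

text \<open>Degrees are integers because the empty face spans degree \<open>-1\<close>.\<close>

definition faces_of_dim :: "'v set set \<Rightarrow> int \<Rightarrow> 'v set set" where
  "faces_of_dim \<Delta> k = {F \<in> \<Delta>. finite F \<and> int (card F) = k + 1}"

definition simplicial_cochains :: "'v set set \<Rightarrow> int \<Rightarrow> ('v set \<Rightarrow> int) monoid" where
  "simplicial_cochains \<Delta> k = product_group (faces_of_dim \<Delta> k) (\<lambda>_. integer_group)"

text \<open>For \<open>F = {v\<^sub>0 < \<dots> < v\<^sub>m}\<close> the exponent of \<open>-1\<close> belonging to \<open>v\<^sub>i\<close> is \<open>i\<close>.\<close>

definition coboundary ::
    "('v::linorder) set set \<Rightarrow> int \<Rightarrow> ('v set \<Rightarrow> int) \<Rightarrow> ('v set \<Rightarrow> int)" where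
  "coboundary \<Delta> k c =
     (\<lambda>F\<in>faces_of_dim \<Delta> (k + 1). \<Sum>v\<in>F. (-1) ^ card {w \<in> F. w < v} * c (F - {v}))"

definition reduced_cohomology ::
    "('v::linorder) set set \<Rightarrow> int \<Rightarrow> ('v set \<Rightarrow> int) set monoid" where
  "reduced_cohomology \<Delta> k =
     (simplicial_cochains \<Delta> k)
       \<lparr>carrier := kernel (simplicial_cochains \<Delta> k) (simplicial_cochains \<Delta> (k + 1))
                    (coboundary \<Delta> k)\<rparr>
     Mod (coboundary \<Delta> (k - 1) ` carrier (simplicial_cochains \<Delta> (k - 1)))"


section \<open>Binoids\<close>

text \<open>
  A binoid is written multiplicatively, as are all monoids of HOL-Algebra: the sum of the additive
  notation is \<open>\<otimes>\<close>, its neutral element is \<open>\<one>\<close> and the absorbing element is \<open>infty\<close>.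
\<close>

record 'a binoid = "'a monoid" +
  infty :: 'a

definition is_binoid :: "'a binoid \<Rightarrow> bool" where
  "is_binoid M \<longleftrightarrow> comm_monoid M \<and> infty M \<in> carrier M \<and>
     (\<forall>a\<in>carrier M. a \<otimes>\<^bsub>M\<^esub> infty M = infty M)"

text \<open>The free binoid on \<open>X\<close>: the free commutative monoid on \<open>X\<close> (finite multisets) together with
  \<open>None\<close> as absorbing element.\<close>

definition free_binoid :: "'x set \<Rightarrow> 'x multiset option binoid" where
  "free_binoid X =
     \<lparr>carrier = insert None (Some ` {m. set_mset m \<subseteq> X}),
      monoid.mult = (\<lambda>a b. case (a, b) of (Some m, Some m') \<Rightarrow> Some (m + m') | _ \<Rightarrow> None),
      one = Some {#},
      infty = None\<rparr>"

inductive_set binoid_congruence :: "'a binoid \<Rightarrow> ('a \<times> 'a) set \<Rightarrow> ('a \<times> 'a) set"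
  for M :: "'a binoid" and R :: "('a \<times> 'a) set" where
  cong_gen: "(a, b) \<in> R \<Longrightarrow> a \<in> carrier M \<Longrightarrow> b \<in> carrier M \<Longrightarrow> (a, b) \<in> binoid_congruence M R"
| cong_refl: "a \<in> carrier M \<Longrightarrow> (a, a) \<in> binoid_congruence M R"
| cong_sym: "(a, b) \<in> binoid_congruence M R \<Longrightarrow> (b, a) \<in> binoid_congruence M R"
| cong_trans: "(a, b) \<in> binoid_congruence M R \<Longrightarrow> (b, c) \<in> binoid_congruence M R \<Longrightarrow>
    (a, c) \<in> binoid_congruence M R"
| cong_mult: "(a, b) \<in> binoid_congruence M R \<Longrightarrow> c \<in> carrier M \<Longrightarrow>
    (a \<otimes>\<^bsub>M\<^esub> c, b \<otimes>\<^bsub>M\<^esub> c) \<in> binoid_congruence M R"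

definition quotient_binoid :: "'a binoid \<Rightarrow> ('a \<times> 'a) set \<Rightarrow> 'a set binoid" where
  "quotient_binoid M E =
     \<lparr>carrier = carrier M // E,
      monoid.mult = (\<lambda>A B. \<Union>a\<in>A. \<Union>b\<in>B. E `` {a \<otimes>\<^bsub>M\<^esub> b}),
      one = E `` {\<one>\<^bsub>M\<^esub>},
      infty = E `` {infty M}\<rparr>"

definition simplicial_relations :: "'v set \<Rightarrow> 'v set set \<Rightarrow> ('v multiset option \<times> 'v multiset option) set" where
  "simplicial_relations V \<Delta> =
     {(Some (mset_set F), None) | F. F \<subseteq> V \<and> F \<notin> \<Delta>}"

definition simplicial_binoid :: "'v set \<Rightarrow> 'v set set \<Rightarrow> 'v multiset option set binoid" where
  "simplicial_binoid V \<Delta> =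
     quotient_binoid (free_binoid V)
       (binoid_congruence (free_binoid V) (simplicial_relations V \<Delta>))"

lemma is_binoid_simplicial_binoid: "is_binoid (simplicial_binoid V \<Delta>)"
proof -
  define F where "F = free_binoid V"
  define E where "E = binoid_congruence F (simplicial_relations V \<Delta>)"
  have cmF: "comm_monoid F"
    unfolding F_def free_binoid_def
    by (rule comm_monoidI) (auto split: option.splits simp: ac_simps)
  interpret comm_monoid F by fact
  have infF: "infty F \<in> carrier F" "\<And>a. a \<otimes>\<^bsub>F\<^esub> infty F = infty F"
    by (auto simp: F_def free_binoid_def split: option.splits)
  have EF: "x \<in> carrier F \<and> y \<in> carrier F" if "(x, y) \<in> E" for x y
    using that unfolding E_def by induction auto
  have equivE: "equiv (carrier F) E"
    unfolding E_def[symmetric]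
    by (intro equivI refl_onI symI transI)
      (use EF in \<open>auto simp: E_def intro: binoid_congruence.intros\<close>)
  have mult2: "(a \<otimes>\<^bsub>F\<^esub> b, a' \<otimes>\<^bsub>F\<^esub> b') \<in> E" if "(a, a') \<in> E" "(b, b') \<in> E" for a a' b b'
  proof -
    have "(a \<otimes>\<^bsub>F\<^esub> b, a' \<otimes>\<^bsub>F\<^esub> b) \<in> E" "(b \<otimes>\<^bsub>F\<^esub> a', b' \<otimes>\<^bsub>F\<^esub> a') \<in> E"
      using that EF unfolding E_def by (auto intro: binoid_congruence.cong_mult)
    then show ?thesis
      using EF[OF that(1)] EF[OF that(2)] by (auto simp: m_comm E_def intro: binoid_congruence.cong_trans)
  qed
  have Q: "simplicial_binoid V \<Delta> = quotient_binoid F E"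
    by (simp add: simplicial_binoid_def F_def E_def)
  have mult_cls: "E `` {a} \<otimes>\<^bsub>quotient_binoid F E\<^esub> E `` {b} = E `` {a \<otimes>\<^bsub>F\<^esub> b}"
    if "a \<in> carrier F" "b \<in> carrier F" for a b
  proof -
    have "E `` {a' \<otimes>\<^bsub>F\<^esub> b'} = E `` {a \<otimes>\<^bsub>F\<^esub> b}" if "a' \<in> E `` {a}" "b' \<in> E `` {b}" for a' b'
      using that mult2 equiv_class_eq[OF equivE] by (metis Image_singleton_iff)
    moreover have "a \<in> E `` {a}" "b \<in> E `` {b}"
      using that equiv_class_self[OF equivE] by auto
    ultimately have *: "a \<in> E `` {a}" "b \<in> E `` {b}"
      "\<And>a' b'. a' \<in> E `` {a} \<Longrightarrow> b' \<in> E `` {b} \<Longrightarrow> E `` {a' \<otimes>\<^bsub>F\<^esub> b'} = E `` {a \<otimes>\<^bsub>F\<^esub> b}"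
      by blast+
    have "(\<Union>a'\<in>E `` {a}. \<Union>b'\<in>E `` {b}. E `` {a' \<otimes>\<^bsub>F\<^esub> b'}) = (\<Union>a'\<in>E `` {a}. \<Union>b'\<in>E `` {b}. E `` {a \<otimes>\<^bsub>F\<^esub> b})"
      by (rule SUP_cong[OF refl], rule SUP_cong[OF refl], rule *(3))
    also have "\<dots> = E `` {a \<otimes>\<^bsub>F\<^esub> b}"
      using *(1,2) by (metis UN_constant empty_iff)
    finally show ?thesis by (simp add: quotient_binoid_def)
  qed
  have carr: "x \<in> carrier (quotient_binoid F E) \<longleftrightarrow> (\<exists>a\<in>carrier F. x = E `` {a})" for x
    by (auto simp: quotient_binoid_def quotient_def)
  have one: "\<one>\<^bsub>quotient_binoid F E\<^esub> = E `` {\<one>\<^bsub>F\<^esub>}" and infQ: "infty (quotient_binoid F E) = E `` {infty F}"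
    by (auto simp: quotient_binoid_def)
  have "comm_monoid (quotient_binoid F E)"
  proof (rule comm_monoidI)
    show "x \<otimes>\<^bsub>quotient_binoid F E\<^esub> y = y \<otimes>\<^bsub>quotient_binoid F E\<^esub> x"
      if "x \<in> carrier (quotient_binoid F E)" "y \<in> carrier (quotient_binoid F E)" for x y
      using that m_comm by (force simp: carr mult_cls)
  qed (auto simp: carr one mult_cls m_assoc)
  then show ?thesis
    unfolding is_binoid_def Q using infF by (auto simp: carr infQ mult_cls)
qed


section \<open>The spectrum of a binoid and its structure sheaf\<close>

definition prime_binoid_ideal :: "'a binoid \<Rightarrow> 'a set \<Rightarrow> bool" where
  "prime_binoid_ideal M p \<longleftrightarrow>
     p \<subseteq> carrier M \<and> infty M \<in> p \<and>
     (\<forall>a\<in>p. \<forall>b\<in>carrier M. a \<otimes>\<^bsub>M\<^esub> b \<in> p) \<and>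
     submonoid (carrier M - p) M"

definition spec :: "'a binoid \<Rightarrow> 'a set set" where
  "spec M = {p. prime_binoid_ideal M p}"

definition basic_open :: "'a binoid \<Rightarrow> 'a \<Rightarrow> 'a set set" where
  "basic_open M f = {p \<in> spec M. f \<notin> p}"

definition spec_topology :: "'a binoid \<Rightarrow> 'a set topology" where
  "spec_topology M = topology_generated_by (basic_open M ` carrier M)"

definition nonunits :: "'a binoid \<Rightarrow> 'a set" where
  "nonunits M = carrier M - Units M"

definition punctured_spec_topology :: "'a binoid \<Rightarrow> 'a set topology" where
  "punctured_spec_topology M = subtopology (spec_topology M) (spec M - {nonunits M})"

text \<open>Localization at a submonoid \<open>S\<close>; \<open>binoid_frac M S a s\<close> is the fraction \<open>a / s\<close>.\<close>

definition binoid_frac :: "'a binoid \<Rightarrow> 'a set \<Rightarrow> 'a \<Rightarrow> 'a \<Rightarrow> ('a \<times> 'a) set" where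
  "binoid_frac M S a s =
     {(b, t). b \<in> carrier M \<and> t \<in> S \<and>
        (\<exists>u\<in>S. u \<otimes>\<^bsub>M\<^esub> (a \<otimes>\<^bsub>M\<^esub> t) = u \<otimes>\<^bsub>M\<^esub> (b \<otimes>\<^bsub>M\<^esub> s))}"

definition localization :: "'a binoid \<Rightarrow> 'a set \<Rightarrow> ('a \<times> 'a) set binoid" where
  "localization M S =
     \<lparr>carrier = {binoid_frac M S a s | a s. a \<in> carrier M \<and> s \<in> S},
      monoid.mult = (\<lambda>A B. \<Union>(a, s)\<in>A. \<Union>(b, t)\<in>B. binoid_frac M S (a \<otimes>\<^bsub>M\<^esub> b) (s \<otimes>\<^bsub>M\<^esub> t)),
      one = binoid_frac M S \<one>\<^bsub>M\<^esub> \<one>\<^bsub>M\<^esub>,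
      infty = binoid_frac M S (infty M) \<one>\<^bsub>M\<^esub>\<rparr>"

definition powers_of :: "'a binoid \<Rightarrow> 'a \<Rightarrow> 'a set" where
  "powers_of M f = range (\<lambda>k::nat. f [^]\<^bsub>M\<^esub> k)"

definition stalk_at :: "'a binoid \<Rightarrow> 'a set \<Rightarrow> ('a \<times> 'a) set binoid" where
  "stalk_at M p = localization M (carrier M - p)"

text \<open>
  As for schemes, a section over \<open>U\<close> is a family of elements of the localizations at the points
  of \<open>U\<close> that is locally given by a single fraction. That this is the sheaf with value \<open>M\<^sub>f\<close>
  on \<open>D(f)\<close> is the fact \<open>structure_sheaf_basic_open\<close> below.
\<close>

definition structure_sections :: "'a binoid \<Rightarrow> 'a set set \<Rightarrow> ('a set \<Rightarrow> ('a \<times> 'a) set) set" where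
  "structure_sections M U =
     {s \<in> \<Pi>\<^sub>E p\<in>U. carrier (stalk_at M p).
        \<forall>p\<in>U. \<exists>W a f. openin (spec_topology M) W \<and> p \<in> W \<and> W \<subseteq> U \<and>
           a \<in> carrier M \<and> f \<in> carrier M \<and>
           (\<forall>q\<in>W. f \<notin> q \<and> s q = binoid_frac M (carrier M - q) a f)}"

definition structure_sheaf :: "'a binoid \<Rightarrow> 'a set set \<Rightarrow> ('a set \<Rightarrow> ('a \<times> 'a) set) binoid" where
  "structure_sheaf M U =
     \<lparr>carrier = structure_sections M U,
      monoid.mult = (\<lambda>s t. \<lambda>p\<in>U. s p \<otimes>\<^bsub>stalk_at M p\<^esub> t p),
      one = (\<lambda>p\<in>U. \<one>\<^bsub>stalk_at M p\<^esub>),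
      infty = (\<lambda>p\<in>U. infty (stalk_at M p))\<rparr>"

lemma binoid_frac_eq_iff:
  assumes M: "comm_monoid M" and S: "submonoid S M"
    and a: "a \<in> carrier M" and b: "b \<in> carrier M" and s: "s \<in> S" and t: "t \<in> S"
  shows "binoid_frac M S a s = binoid_frac M S b t \<longleftrightarrow>
    (\<exists>u\<in>S. u \<otimes>\<^bsub>M\<^esub> (a \<otimes>\<^bsub>M\<^esub> t) = u \<otimes>\<^bsub>M\<^esub> (b \<otimes>\<^bsub>M\<^esub> s))"
proof -
  interpret comm_monoid M by fact
  interpret S: submonoid S M by fact
  have SM: "x \<in> carrier M" if "x \<in> S" for x using that S.subset by auto
  have sub: "binoid_frac M S a s \<subseteq> binoid_frac M S b t"
    if ab: "a \<in> carrier M" "b \<in> carrier M" "s \<in> S" "t \<in> S"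
      and u: "u \<in> S" "u \<otimes>\<^bsub>M\<^esub> (a \<otimes>\<^bsub>M\<^esub> t) = u \<otimes>\<^bsub>M\<^esub> (b \<otimes>\<^bsub>M\<^esub> s)" for a b s t u
  proof
    fix z assume "z \<in> binoid_frac M S a s"
    then obtain c r v where z: "z = (c, r)" "c \<in> carrier M" "r \<in> S" "v \<in> S"
      and v: "v \<otimes>\<^bsub>M\<^esub> (a \<otimes>\<^bsub>M\<^esub> r) = v \<otimes>\<^bsub>M\<^esub> (c \<otimes>\<^bsub>M\<^esub> s)"
      by (auto simp: binoid_frac_def)
    note c = ab u(1) z(2-4) SM[OF ab(3)] SM[OF ab(4)] SM[OF u(1)] SM[OF z(3)] SM[OF z(4)]
    let ?w = "u \<otimes>\<^bsub>M\<^esub> (v \<otimes>\<^bsub>M\<^esub> s)"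
    have "?w \<otimes>\<^bsub>M\<^esub> (b \<otimes>\<^bsub>M\<^esub> r) = (v \<otimes>\<^bsub>M\<^esub> r) \<otimes>\<^bsub>M\<^esub> (u \<otimes>\<^bsub>M\<^esub> (b \<otimes>\<^bsub>M\<^esub> s))"
      using c by (simp add: m_ac)
    also have "\<dots> = (v \<otimes>\<^bsub>M\<^esub> r) \<otimes>\<^bsub>M\<^esub> (u \<otimes>\<^bsub>M\<^esub> (a \<otimes>\<^bsub>M\<^esub> t))"
      by (simp only: u(2))
    also have "\<dots> = (u \<otimes>\<^bsub>M\<^esub> t) \<otimes>\<^bsub>M\<^esub> (v \<otimes>\<^bsub>M\<^esub> (a \<otimes>\<^bsub>M\<^esub> r))"
      using c by (simp add: m_ac)
    also have "\<dots> = (u \<otimes>\<^bsub>M\<^esub> t) \<otimes>\<^bsub>M\<^esub> (v \<otimes>\<^bsub>M\<^esub> (c \<otimes>\<^bsub>M\<^esub> s))"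
      by (simp only: v)
    also have "\<dots> = ?w \<otimes>\<^bsub>M\<^esub> (c \<otimes>\<^bsub>M\<^esub> t)"
      using c by (simp add: m_ac)
    finally show "z \<in> binoid_frac M S b t"
      using c z(1) by (auto simp: binoid_frac_def intro!: bexI[of _ ?w])
  qed
  show ?thesis
  proof
    assume "binoid_frac M S a s = binoid_frac M S b t"
    moreover have "(b, t) \<in> binoid_frac M S b t"
      using b t by (auto simp: binoid_frac_def)
    ultimately have "(b, t) \<in> binoid_frac M S a s" by (simp only:)
    then show "\<exists>u\<in>S. u \<otimes>\<^bsub>M\<^esub> (a \<otimes>\<^bsub>M\<^esub> t) = u \<otimes>\<^bsub>M\<^esub> (b \<otimes>\<^bsub>M\<^esub> s)"
      by (simp add: binoid_frac_def)
  next
    assume "\<exists>u\<in>S. u \<otimes>\<^bsub>M\<^esub> (a \<otimes>\<^bsub>M\<^esub> t) = u \<otimes>\<^bsub>M\<^esub> (b \<otimes>\<^bsub>M\<^esub> s)"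
    then obtain u where u: "u \<in> S" "u \<otimes>\<^bsub>M\<^esub> (a \<otimes>\<^bsub>M\<^esub> t) = u \<otimes>\<^bsub>M\<^esub> (b \<otimes>\<^bsub>M\<^esub> s)" by auto
    show "binoid_frac M S a s = binoid_frac M S b t"
      using sub[OF a b s t u] sub[OF b a t s u(1) u(2)[symmetric]] by blast
  qed
qed

lemma binoid_frac_mult:
  assumes M: "comm_monoid M" and S: "submonoid S M"
    and a: "a \<in> carrier M" and b: "b \<in> carrier M" and s: "s \<in> S" and t: "t \<in> S"
  shows "binoid_frac M S a s \<otimes>\<^bsub>localization M S\<^esub> binoid_frac M S b t =
    binoid_frac M S (a \<otimes>\<^bsub>M\<^esub> b) (s \<otimes>\<^bsub>M\<^esub> t)"
proof -
  interpret comm_monoid M by fact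
  interpret S: submonoid S M by fact
  have SM: "x \<in> carrier M" if "x \<in> S" for x using that S.subset by auto
  have eq: "binoid_frac M S (c \<otimes>\<^bsub>M\<^esub> d) (q \<otimes>\<^bsub>M\<^esub> r) = binoid_frac M S (a \<otimes>\<^bsub>M\<^esub> b) (s \<otimes>\<^bsub>M\<^esub> t)"
    if cd: "(c, q) \<in> binoid_frac M S a s" "(d, r) \<in> binoid_frac M S b t" for c d q r
  proof -
    obtain u v where
      h: "c \<in> carrier M" "d \<in> carrier M" "q \<in> S" "r \<in> S" "u \<in> S" "v \<in> S"
      and u: "u \<otimes>\<^bsub>M\<^esub> (a \<otimes>\<^bsub>M\<^esub> q) = u \<otimes>\<^bsub>M\<^esub> (c \<otimes>\<^bsub>M\<^esub> s)"
      and v: "v \<otimes>\<^bsub>M\<^esub> (b \<otimes>\<^bsub>M\<^esub> r) = v \<otimes>\<^bsub>M\<^esub> (d \<otimes>\<^bsub>M\<^esub> t)"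
      using cd by (auto simp: binoid_frac_def)
    note c = a b s t h SM[OF s] SM[OF t] SM[OF h(3)] SM[OF h(4)] SM[OF h(5)] SM[OF h(6)]
    have "(u \<otimes>\<^bsub>M\<^esub> v) \<otimes>\<^bsub>M\<^esub> ((c \<otimes>\<^bsub>M\<^esub> d) \<otimes>\<^bsub>M\<^esub> (s \<otimes>\<^bsub>M\<^esub> t)) =
        (u \<otimes>\<^bsub>M\<^esub> (c \<otimes>\<^bsub>M\<^esub> s)) \<otimes>\<^bsub>M\<^esub> (v \<otimes>\<^bsub>M\<^esub> (d \<otimes>\<^bsub>M\<^esub> t))"
      using c by (simp add: m_ac)
    also have "\<dots> = (u \<otimes>\<^bsub>M\<^esub> (a \<otimes>\<^bsub>M\<^esub> q)) \<otimes>\<^bsub>M\<^esub> (v \<otimes>\<^bsub>M\<^esub> (b \<otimes>\<^bsub>M\<^esub> r))"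
      by (simp only: u v)
    also have "\<dots> = (u \<otimes>\<^bsub>M\<^esub> v) \<otimes>\<^bsub>M\<^esub> ((a \<otimes>\<^bsub>M\<^esub> b) \<otimes>\<^bsub>M\<^esub> (q \<otimes>\<^bsub>M\<^esub> r))"
      using c by (simp add: m_ac)
    finally show ?thesis
      using c by (subst binoid_frac_eq_iff[OF M S]) (auto intro!: bexI[of _ "u \<otimes>\<^bsub>M\<^esub> v"])
  qed
  have "(a, s) \<in> binoid_frac M S a s" "(b, t) \<in> binoid_frac M S b t"
    using a b s t by (auto simp: binoid_frac_def)
  then have ne: "binoid_frac M S a s \<noteq> {}" "binoid_frac M S b t \<noteq> {}" by blast+
  have "(\<Union>(c, q)\<in>binoid_frac M S a s. \<Union>(d, r)\<in>binoid_frac M S b t.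
          binoid_frac M S (c \<otimes>\<^bsub>M\<^esub> d) (q \<otimes>\<^bsub>M\<^esub> r)) =
        (\<Union>x\<in>binoid_frac M S a s. \<Union>y\<in>binoid_frac M S b t.
          binoid_frac M S (a \<otimes>\<^bsub>M\<^esub> b) (s \<otimes>\<^bsub>M\<^esub> t))"
  proof (rule SUP_cong[OF refl])
    fix x assume x: "x \<in> binoid_frac M S a s"
    obtain c q where xc: "x = (c, q)" by (cases x)
    show "(case x of (c, q) \<Rightarrow> \<Union>(d, r)\<in>binoid_frac M S b t.
            binoid_frac M S (c \<otimes>\<^bsub>M\<^esub> d) (q \<otimes>\<^bsub>M\<^esub> r)) =
          (\<Union>y\<in>binoid_frac M S b t. binoid_frac M S (a \<otimes>\<^bsub>M\<^esub> b) (s \<otimes>\<^bsub>M\<^esub> t))"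
      unfolding xc prod.case
    proof (rule SUP_cong[OF refl])
      fix y assume y: "y \<in> binoid_frac M S b t"
      obtain d r where yd: "y = (d, r)" by (cases y)
      show "(case y of (d, r) \<Rightarrow> binoid_frac M S (c \<otimes>\<^bsub>M\<^esub> d) (q \<otimes>\<^bsub>M\<^esub> r)) =
          binoid_frac M S (a \<otimes>\<^bsub>M\<^esub> b) (s \<otimes>\<^bsub>M\<^esub> t)"
        unfolding yd prod.case by (rule eq[OF x[unfolded xc] y[unfolded yd]])
    qed
  qed
  also have "\<dots> = binoid_frac M S (a \<otimes>\<^bsub>M\<^esub> b) (s \<otimes>\<^bsub>M\<^esub> t)"
    using ne by (simp only: UN_constant if_False)
  finally show ?thesis by (simp add: localization_def)
qed

lemma submonoid_powers_of:
  assumes "comm_monoid M" and "f \<in> carrier M"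
  shows "submonoid (powers_of M f) M"
proof -
  interpret comm_monoid M by fact
  show ?thesis
  proof
    show "powers_of M f \<subseteq> carrier M"
      using assms(2) by (auto simp: powers_of_def)
    show "x \<otimes>\<^bsub>M\<^esub> y \<in> powers_of M f" if "x \<in> powers_of M f" "y \<in> powers_of M f" for x y
      using that assms(2) by (auto simp: powers_of_def nat_pow_mult)
    show "\<one>\<^bsub>M\<^esub> \<in> powers_of M f"
      unfolding powers_of_def by (rule range_eqI[of _ _ 0]) simp
  qed
qed

lemma openin_basic_open:
  "f \<in> carrier M \<Longrightarrow> openin (spec_topology M) (basic_open M f)"
  unfolding spec_topology_def by (rule topology_generated_by_Basis) simp

lemma structure_sheaf_basic_open:
  fixes M :: "'a binoid"
  assumes M: "is_binoid M" and f: "f \<in> carrier M"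
  shows "\<exists>\<theta> \<in> iso (localization M (powers_of M f)) (structure_sheaf M (basic_open M f)).
    (\<forall>a\<in>carrier M. \<forall>s\<in>powers_of M f.
       \<theta> (binoid_frac M (powers_of M f) a s) =
       (\<lambda>p\<in>basic_open M f. binoid_frac M (carrier M - p) a s))"
proof -
  interpret comm_monoid M using M by (simp add: is_binoid_def)
  have cm: "comm_monoid M" by (rule comm_monoid_axioms)
  define S where "S = powers_of M f"
  define U where "U = basic_open M f"
  have S: "submonoid S M" unfolding S_def by (rule submonoid_powers_of[OF cm f])
  interpret S: submonoid S M by fact
  have SM: "x \<in> carrier M" if "x \<in> S" for x using that S.subset by auto
  have inf: "infty M \<in> carrier M" "\<And>a. a \<in> carrier M \<Longrightarrow> a \<otimes>\<^bsub>M\<^esub> infty M = infty M"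
    "\<And>a. a \<in> carrier M \<Longrightarrow> infty M \<otimes>\<^bsub>M\<^esub> a = infty M"
    using M m_comm[of "infty M"] by (auto simp: is_binoid_def)
  have pr: "submonoid (carrier M - p) M" if "p \<in> U" for p
    using that by (auto simp: U_def basic_open_def spec_def prime_binoid_ideal_def)
  have Sp: "S \<subseteq> carrier M - p" if p: "p \<in> U" for p
  proof -
    interpret p: submonoid "carrier M - p" M by (rule pr[OF p])
    have fp: "f \<in> carrier M - p" using p f by (auto simp: U_def basic_open_def)
    have "f [^]\<^bsub>M\<^esub> k \<in> carrier M - p" for k :: nat
      by (induction k) (use p.m_closed[OF _ fp] p.one_closed in auto)
    then show ?thesis by (auto simp: S_def powers_of_def)
  qed
  define \<theta> where "\<theta> A = (\<lambda>p\<in>U. \<Union>(a, s)\<in>A. binoid_frac M (carrier M - p) a s)" for A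
  have \<theta>: "\<theta> (binoid_frac M S a s) = (\<lambda>p\<in>U. binoid_frac M (carrier M - p) a s)"
    if a: "a \<in> carrier M" and s: "s \<in> S" for a s
  proof -
    have "binoid_frac M (carrier M - p) b t = binoid_frac M (carrier M - p) a s"
      if p: "p \<in> U" and bt: "(b, t) \<in> binoid_frac M S a s" for p b t
    proof -
      obtain u where u: "b \<in> carrier M" "t \<in> S" "u \<in> S"
        "u \<otimes>\<^bsub>M\<^esub> (a \<otimes>\<^bsub>M\<^esub> t) = u \<otimes>\<^bsub>M\<^esub> (b \<otimes>\<^bsub>M\<^esub> s)"
        using bt by (auto simp: binoid_frac_def)
      have "s \<in> carrier M - p" "t \<in> carrier M - p" "u \<in> carrier M - p"
        using Sp[OF p] s u by auto
      then show ?thesis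
        using binoid_frac_eq_iff[OF cm pr[OF p] u(1) a] u(4)[symmetric] by blast
    qed
    moreover have "(a, s) \<in> binoid_frac M S a s"
      using a s by (auto simp: binoid_frac_def)
    ultimately show ?thesis
      unfolding \<theta>_def by (intro restrict_ext) blast
  qed
  define p0 where "p0 = {h \<in> carrier M. \<not> (\<exists>c\<in>carrier M. h \<otimes>\<^bsub>M\<^esub> c \<in> S)}"
  have p0: "p0 \<in> U" if "infty M \<notin> S"
  proof -
    have "submonoid (carrier M - p0) M"
    proof
      show "x \<otimes>\<^bsub>M\<^esub> y \<in> carrier M - p0" if "x \<in> carrier M - p0" "y \<in> carrier M - p0" for x y
      proof -
        from that obtain c d where c: "x \<in> carrier M" "y \<in> carrier M" "c \<in> carrier M" "d \<in> carrier M"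
          "x \<otimes>\<^bsub>M\<^esub> c \<in> S" "y \<otimes>\<^bsub>M\<^esub> d \<in> S"
          by (auto simp: p0_def)
        have "(x \<otimes>\<^bsub>M\<^esub> y) \<otimes>\<^bsub>M\<^esub> (c \<otimes>\<^bsub>M\<^esub> d) = (x \<otimes>\<^bsub>M\<^esub> c) \<otimes>\<^bsub>M\<^esub> (y \<otimes>\<^bsub>M\<^esub> d)"
          using c by (simp add: m_ac)
        then have "(x \<otimes>\<^bsub>M\<^esub> y) \<otimes>\<^bsub>M\<^esub> (c \<otimes>\<^bsub>M\<^esub> d) \<in> S"
          using c S.m_closed by metis
        then show ?thesis using c by (auto simp: p0_def)
      qed
    qed (auto simp: p0_def intro!: bexI[of _ "\<one>\<^bsub>M\<^esub>"])
    moreover have "a \<otimes>\<^bsub>M\<^esub> b \<in> p0" if "a \<in> p0" "b \<in> carrier M" for a b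
      using that by (auto simp: p0_def m_assoc)
    moreover have "infty M \<in> p0" using \<open>infty M \<notin> S\<close> inf by (auto simp: p0_def)
    moreover have "f \<notin> p0"
    proof -
      have "f \<otimes>\<^bsub>M\<^esub> \<one>\<^bsub>M\<^esub> = f [^]\<^bsub>M\<^esub> (1::nat)" using f by simp
      then have "f \<otimes>\<^bsub>M\<^esub> \<one>\<^bsub>M\<^esub> \<in> S" unfolding S_def powers_of_def by blast
      then show ?thesis using f by (auto simp: p0_def)
    qed
    ultimately show ?thesis
      by (auto simp: U_def basic_open_def spec_def prime_binoid_ideal_def p0_def)
  qed
  have U_empty: "U = {}" if "infty M \<in> S"
  proof (rule equals0I)
    fix p assume p: "p \<in> U"
    then have "infty M \<in> p" by (simp add: U_def basic_open_def spec_def prime_binoid_ideal_def)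
    then show False using Sp[OF p] that by blast
  qed
  have U_min: "U \<subseteq> W" if W: "openin (spec_topology M) W" "p0 \<in> W" for W
  proof -
    have "generate_topology_on (basic_open M ` carrier M) W"
      using W(1) unfolding spec_topology_def by (rule openin_topology_generated_by)
    then have "p0 \<in> W \<longrightarrow> U \<subseteq> W"
    proof induction
      case (Basis W)
      then obtain h where h: "h \<in> carrier M" "W = basic_open M h" by auto
      show ?case
      proof (intro impI subsetI)
        fix p assume pW: "p0 \<in> W" and p: "p \<in> U"
        then obtain c where c: "c \<in> carrier M" "h \<otimes>\<^bsub>M\<^esub> c \<in> S"
          using h by (auto simp: basic_open_def p0_def)
        then show "p \<in> W"
          using Sp[OF p] p h by (auto simp: basic_open_def U_def spec_def prime_binoid_ideal_def)
      qed
    qed auto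
    then show ?thesis using W(2) by blast
  qed
  have U_open: "openin (spec_topology M) U"
    unfolding U_def by (rule openin_basic_open[OF f])
  have in_sec: "\<theta> (binoid_frac M S a s) \<in> structure_sections M U"
    if a: "a \<in> carrier M" and s: "s \<in> S" for a s
  proof -
    have "binoid_frac M (carrier M - p) a s \<in> carrier (stalk_at M p)" if "p \<in> U" for p
      using a s Sp[OF that] unfolding stalk_at_def localization_def by simp blast
    moreover have "\<exists>W a' f. openin (spec_topology M) W \<and> p \<in> W \<and> W \<subseteq> U \<and>
        a' \<in> carrier M \<and> f \<in> carrier M \<and>
        (\<forall>q\<in>W. f \<notin> q \<and> (\<lambda>p\<in>U. binoid_frac M (carrier M - p) a s) q =
           binoid_frac M (carrier M - q) a' f)" if "p \<in> U" for p
      by (rule exI[of _ U], rule exI[of _ a], rule exI[of _ s])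
        (use U_open that a s SM Sp in auto)
    ultimately show ?thesis
      unfolding structure_sections_def \<theta>[OF a s] by simp
  qed
  have inj: "binoid_frac M S a s = binoid_frac M S b t"
    if a: "a \<in> carrier M" "b \<in> carrier M" "s \<in> S" "t \<in> S"
      and eq: "\<theta> (binoid_frac M S a s) = \<theta> (binoid_frac M S b t)" for a b s t
  proof (cases "infty M \<in> S")
    case True
    then show ?thesis
      using a SM inf by (subst binoid_frac_eq_iff[OF cm S]) (auto intro!: bexI[of _ "infty M"])
  next
    case False
    have st: "s \<in> carrier M - p0" "t \<in> carrier M - p0"
      using Sp[OF p0[OF False]] a by auto
    have "binoid_frac M (carrier M - p0) a s = binoid_frac M (carrier M - p0) b t"
      using fun_cong[OF eq, of p0] a p0[OF False] by (simp add: \<theta>)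
    then obtain u where u: "u \<in> carrier M" "u \<notin> p0"
      "u \<otimes>\<^bsub>M\<^esub> (a \<otimes>\<^bsub>M\<^esub> t) = u \<otimes>\<^bsub>M\<^esub> (b \<otimes>\<^bsub>M\<^esub> s)"
      using binoid_frac_eq_iff[OF cm pr[OF p0[OF False]] a(1,2) st] by auto
    then obtain c where c: "c \<in> carrier M" "u \<otimes>\<^bsub>M\<^esub> c \<in> S" by (auto simp: p0_def)
    have "(u \<otimes>\<^bsub>M\<^esub> c) \<otimes>\<^bsub>M\<^esub> (a \<otimes>\<^bsub>M\<^esub> t) = c \<otimes>\<^bsub>M\<^esub> (u \<otimes>\<^bsub>M\<^esub> (a \<otimes>\<^bsub>M\<^esub> t))"
      using a u(1) c(1) SM by (simp add: m_ac)
    also have "\<dots> = (u \<otimes>\<^bsub>M\<^esub> c) \<otimes>\<^bsub>M\<^esub> (b \<otimes>\<^bsub>M\<^esub> s)"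
      unfolding u(3) using a u(1) c(1) SM by (simp add: m_ac)
    finally show ?thesis
      using a c by (subst binoid_frac_eq_iff[OF cm S]) auto
  qed
  have surj: "\<exists>a\<in>carrier M. \<exists>t\<in>S. s = \<theta> (binoid_frac M S a t)"
    if s: "s \<in> structure_sections M U" for s
  proof (cases "infty M \<in> S")
    case True
    have "s = \<theta> (binoid_frac M S \<one>\<^bsub>M\<^esub> \<one>\<^bsub>M\<^esub>)"
    proof -
      have "s \<in> (\<Pi>\<^sub>E p\<in>U. carrier (stalk_at M p))" using s by (simp add: structure_sections_def)
      then show ?thesis by (auto simp: U_empty[OF True] \<theta>_def restrict_def)
    qed
    then show ?thesis by (intro bexI[OF _ one_closed] bexI[OF _ S.one_closed])
  next
    case False
    obtain W a g where W: "openin (spec_topology M) W" "p0 \<in> W" "W \<subseteq> U"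
      and ag: "a \<in> carrier M" "g \<in> carrier M"
      and sW: "\<And>q. q \<in> W \<Longrightarrow> g \<notin> q \<and> s q = binoid_frac M (carrier M - q) a g"
    proof -
      have "\<forall>p\<in>U. \<exists>W a f. openin (spec_topology M) W \<and> p \<in> W \<and> W \<subseteq> U \<and>
          a \<in> carrier M \<and> f \<in> carrier M \<and>
          (\<forall>q\<in>W. f \<notin> q \<and> s q = binoid_frac M (carrier M - q) a f)"
        using s unfolding structure_sections_def mem_Collect_eq by (rule conjunct2)
      then show ?thesis using that p0[OF False] by meson
    qed
    have WU: "W = U" using U_min[OF W(1,2)] W(3) by blast
    obtain c where c: "c \<in> carrier M" "g \<otimes>\<^bsub>M\<^esub> c \<in> S"
      using sW[OF W(2)] ag by (auto simp: p0_def)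
    have "s q = binoid_frac M (carrier M - q) (a \<otimes>\<^bsub>M\<^esub> c) (g \<otimes>\<^bsub>M\<^esub> c)" if q: "q \<in> U" for q
    proof -
      interpret q: submonoid "carrier M - q" M by (rule pr[OF q])
      have "binoid_frac M (carrier M - q) a g = binoid_frac M (carrier M - q) (a \<otimes>\<^bsub>M\<^esub> c) (g \<otimes>\<^bsub>M\<^esub> c)"
      proof (subst binoid_frac_eq_iff[OF cm pr[OF q]])
        show "\<exists>u\<in>carrier M - q. u \<otimes>\<^bsub>M\<^esub> (a \<otimes>\<^bsub>M\<^esub> (g \<otimes>\<^bsub>M\<^esub> c)) = u \<otimes>\<^bsub>M\<^esub> (a \<otimes>\<^bsub>M\<^esub> c \<otimes>\<^bsub>M\<^esub> g)"
          by (rule bexI[OF _ q.one_closed]) (use ag c in \<open>simp add: m_ac\<close>)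
        show "g \<in> carrier M - q" using ag sW[of q] q WU by blast
        show "g \<otimes>\<^bsub>M\<^esub> c \<in> carrier M - q" using Sp[OF q] c by blast
      qed (use ag c in auto)
      then show ?thesis using sW[of q] q WU by simp
    qed
    moreover have "s \<in> extensional U" using s by (auto simp: structure_sections_def PiE_def)
    ultimately have "s = \<theta> (binoid_frac M S (a \<otimes>\<^bsub>M\<^esub> c) (g \<otimes>\<^bsub>M\<^esub> c))"
      using ag c by (subst \<theta>) (auto simp: extensional_def restrict_def fun_eq_iff)
    then show ?thesis using ag c by (intro bexI[of _ "a \<otimes>\<^bsub>M\<^esub> c"] bexI[of _ "g \<otimes>\<^bsub>M\<^esub> c"]) auto
  qed
  have carr: "carrier (localization M S) = {binoid_frac M S a s | a s. a \<in> carrier M \<and> s \<in> S}"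
    by (simp add: localization_def)
  have "\<theta> \<in> iso (localization M S) (structure_sheaf M U)"
  proof (rule isoI)
    show "\<theta> \<in> hom (localization M S) (structure_sheaf M U)"
    proof (rule homI)
      show "\<theta> x \<in> carrier (structure_sheaf M U)" if "x \<in> carrier (localization M S)" for x
        using that in_sec by (auto simp: carr structure_sheaf_def)
      fix x y assume "x \<in> carrier (localization M S)" "y \<in> carrier (localization M S)"
      then obtain a s b t where x: "x = binoid_frac M S a s" "a \<in> carrier M" "s \<in> S"
        and y: "y = binoid_frac M S b t" "b \<in> carrier M" "t \<in> S"
        by (auto simp: carr)
      have "\<theta> (x \<otimes>\<^bsub>localization M S\<^esub> y) = \<theta> (binoid_frac M S (a \<otimes>\<^bsub>M\<^esub> b) (s \<otimes>\<^bsub>M\<^esub> t))"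
        using x y by (simp add: binoid_frac_mult[OF cm S])
      also have "\<dots> = (\<lambda>p\<in>U. binoid_frac M (carrier M - p) (a \<otimes>\<^bsub>M\<^esub> b) (s \<otimes>\<^bsub>M\<^esub> t))"
        using x y by (intro \<theta>) auto
      also have "\<dots> = (\<lambda>p\<in>U. \<theta> x p \<otimes>\<^bsub>stalk_at M p\<^esub> \<theta> y p)"
      proof (rule restrict_ext)
        fix p assume p: "p \<in> U"
        have "s \<in> carrier M - p" "t \<in> carrier M - p" using Sp[OF p] x y by auto
        then show "binoid_frac M (carrier M - p) (a \<otimes>\<^bsub>M\<^esub> b) (s \<otimes>\<^bsub>M\<^esub> t) =
            \<theta> x p \<otimes>\<^bsub>stalk_at M p\<^esub> \<theta> y p"
          using x y p by (simp add: \<theta> stalk_at_def binoid_frac_mult[OF cm pr[OF p]])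
      qed
      finally show "\<theta> (x \<otimes>\<^bsub>localization M S\<^esub> y) = \<theta> x \<otimes>\<^bsub>structure_sheaf M U\<^esub> \<theta> y"
        by (simp add: structure_sheaf_def)
    qed
    show "bij_betw \<theta> (carrier (localization M S)) (carrier (structure_sheaf M U))"
      unfolding bij_betw_def
    proof
      show "inj_on \<theta> (carrier (localization M S))"
        unfolding carr by (rule inj_onI) (elim CollectE exE conjE, metis inj)
      show "\<theta> ` carrier (localization M S) = carrier (structure_sheaf M U)"
        unfolding carr using in_sec surj by (fastforce simp: structure_sheaf_def)
    qed
  qed
  then show ?thesis
    using \<theta> unfolding S_def U_def by blast
qed


section \<open>Sheaves of abelian groups and their cohomology\<close>

text \<open>
  \<open>sections F U\<close> is the group of sections over \<open>U\<close>, and \<open>restr F U W\<close> is the restriction from \<open>U\<close>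
  to \<open>W\<close>. Both are meaningful only for open sets \<open>W \<subseteq> U\<close> of the space under consideration; in
  particular a sheaf is restricted to an open subspace by changing the topology only.
\<close>

record ('p, 'b) group_presheaf =
  sections :: "'p set \<Rightarrow> 'b monoid"
  restr :: "'p set \<Rightarrow> 'p set \<Rightarrow> 'b \<Rightarrow> 'b"

definition presheaf :: "'p topology \<Rightarrow> ('p, 'b) group_presheaf \<Rightarrow> bool" where
  "presheaf X F \<longleftrightarrow>
     (\<forall>U. openin X U \<longrightarrow> comm_group (sections F U)) \<and>
     (\<forall>U W. openin X U \<and> openin X W \<and> W \<subseteq> U \<longrightarrow>
        restr F U W \<in> hom (sections F U) (sections F W)) \<and>
     (\<forall>U. openin X U \<longrightarrow> (\<forall>s\<in>carrier (sections F U). restr F U U s = s)) \<and>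
     (\<forall>U V W. openin X U \<and> openin X V \<and> openin X W \<and> W \<subseteq> V \<and> V \<subseteq> U \<longrightarrow>
        (\<forall>s\<in>carrier (sections F U). restr F V W (restr F U V s) = restr F U W s))"

definition sheaf :: "'p topology \<Rightarrow> ('p, 'b) group_presheaf \<Rightarrow> bool" where
  "sheaf X F \<longleftrightarrow>
     presheaf X F \<and>
     (\<forall>\<U> s. (\<forall>U\<in>\<U>. openin X U \<and> s U \<in> carrier (sections F U)) \<and>
        (\<forall>U\<in>\<U>. \<forall>W\<in>\<U>. restr F U (U \<inter> W) (s U) = restr F W (U \<inter> W) (s W)) \<longrightarrow>
        (\<exists>!t. t \<in> carrier (sections F (\<Union>\<U>)) \<and> (\<forall>U\<in>\<U>. restr F (\<Union>\<U>) U t = s U)))"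

definition sheaf_morphism ::
    "'p topology \<Rightarrow> ('p, 'a) group_presheaf \<Rightarrow> ('p, 'b) group_presheaf \<Rightarrow>
     ('p set \<Rightarrow> 'a \<Rightarrow> 'b) \<Rightarrow> bool" where
  "sheaf_morphism X F G \<phi> \<longleftrightarrow>
     (\<forall>U. openin X U \<longrightarrow> \<phi> U \<in> hom (sections F U) (sections G U)) \<and>
     (\<forall>U W. openin X U \<and> openin X W \<and> W \<subseteq> U \<longrightarrow>
        (\<forall>s\<in>carrier (sections F U). restr G U W (\<phi> U s) = \<phi> W (restr F U W s)))"

definition sheaf_mono ::
    "'p topology \<Rightarrow> ('p, 'a) group_presheaf \<Rightarrow> ('p, 'b) group_presheaf \<Rightarrow>
     ('p set \<Rightarrow> 'a \<Rightarrow> 'b) \<Rightarrow> bool" where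
  "sheaf_mono X F G \<phi> \<longleftrightarrow>
     sheaf_morphism X F G \<phi> \<and> (\<forall>U. openin X U \<longrightarrow> inj_on (\<phi> U) (carrier (sections F U)))"

text \<open>Exactness of \<open>F \<rightarrow> G \<rightarrow> H\<close> at \<open>G\<close>: a section of \<open>G\<close> is killed by \<open>\<psi>\<close> iff it lies locally in the
  image of \<open>\<phi>\<close>.\<close>

definition sheaf_exact ::
    "'p topology \<Rightarrow> ('p, 'a) group_presheaf \<Rightarrow> ('p set \<Rightarrow> 'a \<Rightarrow> 'b) \<Rightarrow> ('p, 'b) group_presheaf \<Rightarrow>
     ('p set \<Rightarrow> 'b \<Rightarrow> 'c) \<Rightarrow> ('p, 'c) group_presheaf \<Rightarrow> bool" where
  "sheaf_exact X F \<phi> G \<psi> H \<longleftrightarrow>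
     sheaf_morphism X F G \<phi> \<and> sheaf_morphism X G H \<psi> \<and>
     (\<forall>U. openin X U \<longrightarrow> (\<forall>s\<in>carrier (sections G U).
        \<psi> U s = \<one>\<^bsub>sections H U\<^esub> \<longleftrightarrow>
        (\<forall>x\<in>U. \<exists>W. openin X W \<and> x \<in> W \<and> W \<subseteq> U \<and>
           restr G U W s \<in> \<phi> W ` carrier (sections F W))))"

text \<open>
  Injective objects of the category of sheaves of abelian groups on \<open>X\<close> whose sections live in the
  type \<open>'b\<close>. If \<open>'b\<close> is large enough to accommodate the generators of the category of all
  sheaves of abelian groups (the extensions by zero of the constant sheaf \<open>\<int>\<close> on open sets) then
  extending along inclusions of their subsheaves suffices for injectivity, so that the restriction
  to \<open>'b\<close> is immaterial. On a finite space this is the case for every infinite \<open>'b\<close>.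
\<close>

definition injective_sheaf :: "'p topology \<Rightarrow> ('p, 'b) group_presheaf \<Rightarrow> bool" where
  "injective_sheaf X I \<longleftrightarrow>
     sheaf X I \<and>
     (\<forall>(A :: ('p, 'b) group_presheaf) (B :: ('p, 'b) group_presheaf) \<iota> \<alpha>.
        sheaf X A \<and> sheaf X B \<and> sheaf_mono X A B \<iota> \<and> sheaf_morphism X A I \<alpha> \<longrightarrow>
        (\<exists>\<beta>. sheaf_morphism X B I \<beta> \<and>
           (\<forall>U. openin X U \<longrightarrow> (\<forall>s\<in>carrier (sections A U). \<beta> U (\<iota> U s) = \<alpha> U s))))"

text \<open>The data of \<open>0 \<rightarrow> F \<rightarrow> I\<^sup>0 \<rightarrow> I\<^sup>1 \<rightarrow> \<dots>\<close>.\<close>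

record ('p, 'a, 'b) sheaf_resolution =
  augm :: "'p set \<Rightarrow> 'a \<Rightarrow> 'b"
  term_of :: "nat \<Rightarrow> ('p, 'b) group_presheaf"
  differential :: "nat \<Rightarrow> 'p set \<Rightarrow> 'b \<Rightarrow> 'b"

definition injective_resolution ::
    "'p topology \<Rightarrow> ('p, 'a) group_presheaf \<Rightarrow> ('p, 'a, 'b) sheaf_resolution \<Rightarrow> bool" where
  "injective_resolution X F R \<longleftrightarrow>
     (\<forall>k. injective_sheaf X (term_of R k)) \<and>
     sheaf_mono X F (term_of R 0) (augm R) \<and>
     sheaf_exact X F (augm R) (term_of R 0) (differential R 0) (term_of R 1) \<and>
     (\<forall>k. sheaf_exact X (term_of R k) (differential R k) (term_of R (k + 1))
            (differential R (k + 1)) (term_of R (k + 2)))"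

text \<open>
  Sheaf cohomology is the right derived functor of global sections: for an injective resolution
  \<open>R\<close> of \<open>F\<close>, the group \<open>H\<^sup>j(X, F)\<close> is \<open>derived_global_sections X R j\<close>, the cohomology in degree
  \<open>j\<close> of the complex of global sections of \<open>R\<close>. It does not depend on the choice of \<open>R\<close> up to
  isomorphism, so a statement about \<open>H\<^sup>j(X, F)\<close> is a statement about all injective resolutions of \<open>F\<close>.
  On a finite space a sheaf with countable groups of sections has an injective resolution in every
  infinite type \<open>'b\<close>, built from skyscraper sheaves of countable divisible groups.
\<close>

definition global_coboundaries :: "'p topology \<Rightarrow> ('p, 'a, 'b) sheaf_resolution \<Rightarrow> nat \<Rightarrow> 'b set" where
  "global_coboundaries X R j =
     (case j of
        0 \<Rightarrow> {\<one>\<^bsub>sections (term_of R 0) (topspace X)\<^esub>}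
      | Suc i \<Rightarrow> differential R i (topspace X) ` carrier (sections (term_of R i) (topspace X)))"

definition derived_global_sections ::
    "'p topology \<Rightarrow> ('p, 'a, 'b) sheaf_resolution \<Rightarrow> nat \<Rightarrow> 'b set monoid" where
  "derived_global_sections X R j =
     (let \<Gamma> = (\<lambda>k. sections (term_of R k) (topspace X)) in
        (\<Gamma> j)\<lparr>carrier := kernel (\<Gamma> j) (\<Gamma> (j + 1)) (differential R j (topspace X))\<rparr>
        Mod global_coboundaries X R j)"

definition unit_sheaf :: "'a binoid \<Rightarrow> ('a set, 'a set \<Rightarrow> ('a \<times> 'a) set) group_presheaf" where
  "unit_sheaf M =
     \<lparr>sections = (\<lambda>U. units_of (structure_sheaf M U)),
      restr = (\<lambda>U W s. restrict s W)\<rparr>"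

end

(* The points of the punctured spectrum are the nonempty faces of the complex, the smallest open
   neighbourhood of a face s consists of the faces containing s, and the units over it form the
   lattice Z^s, restriction being extension by zero. The open sets of the vertices form a cover whose
   nonempty intersections are these smallest neighbourhoods, so the Cech complex of this cover is
   exact as a functor of the sheaf; it is acyclic on injective sheaves because these are retracts of
   Godement sheaves. The double complex of Cech cochains of an injective resolution therefore
   identifies the derived functors with Cech cohomology. Finally the Cech complex of the sheaf s |-> Z^s
   splits over the vertices i, and the i-th summand, spanned by the faces containing i, is the
   augmented cochain complex of the link of i shifted by one. *)

theory Submission
  imports Defs "HOL-Algebra.Weak_Morphisms"
begin

section \<open>Quotient groups and double complexes\<close>

text \<open>The theorem concerns every injective resolution with sections in a given type
  \<open>'b\<close>, so no convenient resolution may be chosen. Two consequences shape the proof.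
  Quotients are compared through a group mapping onto both of them with matching preimages of the
  denominators; in this way the staircase of the double complex works without chosen preimages or
  connecting maps. And \<open>injective_sheaf\<close> tests only against sheaves with sections in
  \<open>'b\<close>, so the Godement sheaf has to be coded inside \<open>'b\<close>. Such codes
  exist because \<open>'b\<close> is infinite, and this is forced by the resolution itself: over a
  nonempty space the integers embed into sections of its first term. The unit sheaf enters through
  its sections over the smallest neighbourhoods, seen as the kernel of the first differential on
  Cech cochains. That the Cech complex is exact in the sheaf has a simple cause: a smallest
  neighbourhood has no proper open subset containing its centre, so local surjectivity there is
  surjectivity.\<close>

lemma Mod_iso_by_span:
  assumes W: "group W" and G: "comm_group G" and N: "subgroup N G" and H: "group H"
    and f: "f \<in> hom W G" "f ` carrier W = carrier G"
    and h: "h \<in> hom W H" "h ` carrier W = carrier H"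
    and eq: "\<And>w. w \<in> carrier W \<Longrightarrow> f w \<in> N \<longleftrightarrow> h w = \<one>\<^bsub>H\<^esub>"
  shows "G Mod N \<cong> H"
proof -
  interpret G: comm_group G by fact
  interpret N: normal N G by (rule G.subgroup_imp_normal[OF N])
  interpret Q: group "G Mod N" by (rule N.factorgroup_is_group)
  interpret h: group_hom W H h
    using W H h by (simp add: group_hom_def group_hom_axioms_def)
  \<comment> \<open>Both quotients are \<open>W\<close> modulo a kernel: \<open>g\<close> and
    \<open>h\<close> are onto and have the same kernel by \<open>eq\<close>, so the first
    isomorphism theorem is applied to each.\<close>
  define g where "g w = N #>\<^bsub>G\<^esub> f w" for w
  have "(\<lambda>a. N #>\<^bsub>G\<^esub> a) \<in> hom G (G Mod N)" by (rule N.r_coset_hom_Mod)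
  then have g: "g \<in> hom W (G Mod N)"
    using f(1) by (auto simp: g_def hom_def Pi_iff)
  interpret g: group_hom W "G Mod N" g
    using W g Q.group_axioms by (simp add: group_hom_def group_hom_axioms_def)
  have "g ` carrier W = (\<lambda>a. N #>\<^bsub>G\<^esub> a) ` (f ` carrier W)"
    by (auto simp: g_def)
  also have "\<dots> = carrier (G Mod N)"
    unfolding f(2) by (auto simp: FactGroup_def RCOSETS_def)
  finally have gs: "g ` carrier W = carrier (G Mod N)" .
  have "kernel W (G Mod N) g = kernel W H h"
  proof -
    have "g w = N \<longleftrightarrow> f w \<in> N" if "w \<in> carrier W" for w
    proof -
      have "f w \<in> carrier G" using f that by (auto simp: hom_def)
      then show ?thesis
        unfolding g_def using G.coset_join1[OF _ _ N] G.coset_join2[OF _ N] by blast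
    qed
    then show ?thesis using eq by (auto simp: kernel_def)
  qed
  then show ?thesis
    using g.FactGroup_iso[OF gs] h.FactGroup_iso[OF h(2)] h.homh W
    by (metis group.iso_sym iso_trans normal.factorgroup_is_group g.normal_kernel)
qed

text \<open>Follow \<open>h\<close> by the projection to \<open>H Mod K\<close>. In the staircase
  there is no map between the two quotients in either direction, only this common source.\<close>

lemma subgroup_Mod_iso_by_span:
  assumes W: "group W"
    and G: "comm_group G" and N: "subgroup N G"
    and H: "comm_group H" and K: "subgroup K H"
    and f: "f \<in> hom W G" "f ` carrier W = carrier G"
    and h: "h \<in> hom W H" "h ` carrier W = carrier H"
    and eq: "\<And>w. w \<in> carrier W \<Longrightarrow> f w \<in> N \<longleftrightarrow> h w \<in> K"
  shows "G Mod N \<cong> H Mod K"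
proof -
  interpret H: comm_group H by fact
  interpret K: normal K H by (rule H.subgroup_imp_normal[OF K])
  interpret Q: group "H Mod K" by (rule K.factorgroup_is_group)
  show ?thesis
  proof (rule Mod_iso_by_span[OF W G N Q.group_axioms f])
    have "(\<lambda>a. K #>\<^bsub>H\<^esub> a) \<in> hom H (H Mod K)" by (rule K.r_coset_hom_Mod)
    then show "(\<lambda>w. K #>\<^bsub>H\<^esub> h w) \<in> hom W (H Mod K)"
      using h(1) by (auto simp: hom_def Pi_iff)
    have "(\<lambda>w. K #>\<^bsub>H\<^esub> h w) ` carrier W = (\<lambda>a. K #>\<^bsub>H\<^esub> a) ` (h ` carrier W)" by auto
    also have "\<dots> = carrier (H Mod K)"
      unfolding h(2) by (auto simp: FactGroup_def RCOSETS_def)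
    finally show "(\<lambda>w. K #>\<^bsub>H\<^esub> h w) ` carrier W = carrier (H Mod K)" .
    fix w assume "w \<in> carrier W"
    then have "h w \<in> carrier H" using h by (auto simp: hom_def)
    then show "f w \<in> N \<longleftrightarrow> K #>\<^bsub>H\<^esub> h w = \<one>\<^bsub>H Mod K\<^esub>"
      using eq[OF \<open>w \<in> carrier W\<close>] H.coset_join1[OF _ _ K] H.coset_join2[OF _ K] by auto
  qed
qed

lemma comm_group_subgroup:
  assumes "comm_group G" "subgroup H G"
  shows "comm_group (G\<lparr>carrier := H\<rparr>)"
proof -
  interpret comm_group G by fact
  interpret H: group "G\<lparr>carrier := H\<rparr>"
    using assms(2) subgroup.subgroup_is_group group_axioms by blast
  show ?thesis
    by (rule H.group_comm_groupI) (use m_comm subgroup.subset[OF assms(2)] in auto)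
qed

lemma subgroup_of_subgroup:
  assumes "group G" "subgroup H G" "subgroup K G" "K \<subseteq> H"
  shows "subgroup K (G\<lparr>carrier := H\<rparr>)"
  using group.subgroup_incl[OF assms(1,3,2,4)] .

lemma subgroup_kernel_hom:
  "group G \<Longrightarrow> group H \<Longrightarrow> h \<in> hom G H \<Longrightarrow> subgroup (kernel G H h) G"
  by (simp add: group_hom.subgroup_kernel group_hom_axioms_def group_hom_def)

lemma subgroup_hom_image:
  assumes "group G" "group H" "h \<in> hom G H" "subgroup K G"
  shows "subgroup (h ` K) H"
  using assms by (simp add: group_hom.subgroup_img_is_subgroup group_hom_axioms_def group_hom_def)

section \<open>The staircase in a double complex that is exact in positive degrees\<close>

locale exact_double_complex =
  fixes A :: "nat \<Rightarrow> nat \<Rightarrow> 'c monoid" and d \<delta> :: "nat \<Rightarrow> nat \<Rightarrow> 'c \<Rightarrow> 'c"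
  assumes A: "comm_group (A p q)"
    and d_hom: "d p q \<in> hom (A p q) (A p (Suc q))"
    and \<delta>_hom: "\<delta> p q \<in> hom (A p q) (A (Suc p) q)"
    and d_\<delta>: "x \<in> carrier (A p q) \<Longrightarrow> d (Suc p) q (\<delta> p q x) = \<delta> p (Suc q) (d p q x)"
    and d_exact: "kernel (A p (Suc q)) (A p (Suc (Suc q))) (d p (Suc q)) = d p q ` carrier (A p q)"
    and \<delta>_exact: "kernel (A (Suc p) q) (A (Suc (Suc p)) q) (\<delta> (Suc p) q) = \<delta> p q ` carrier (A p q)"
begin

definition d_cycles :: "nat \<Rightarrow> nat \<Rightarrow> 'c set" where
  "d_cycles p q = kernel (A p q) (A p (Suc q)) (d p q)"

definition \<delta>_cycles :: "nat \<Rightarrow> nat \<Rightarrow> 'c set" where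
  "\<delta>_cycles p q = kernel (A p q) (A (Suc p) q) (\<delta> p q)"

text \<open>On the edges \<open>p = 0\<close> and \<open>q = 0\<close> these are the cocycles of the
  two complexes to be compared, namely of the kernels of \<open>\<delta>\<close> and of
  \<open>d\<close>; in between they are the intermediate stations of the staircase.\<close>

definition bicycles :: "nat \<Rightarrow> nat \<Rightarrow> 'c monoid" where
  "bicycles p q = (A p q)\<lparr>carrier := d_cycles p q \<inter> \<delta>_cycles p q\<rparr>"

lemma grp: "group (A p q)"
  using A comm_group.axioms(2) by blast

lemma one_closed: "\<one>\<^bsub>A p q\<^esub> \<in> carrier (A p q)"
  using grp group.is_monoid monoid.one_closed by blast

lemma subgroup_d_cycles: "subgroup (d_cycles p q) (A p q)"
  unfolding d_cycles_def by (rule subgroup_kernel_hom[OF grp grp d_hom])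

lemma subgroup_\<delta>_cycles: "subgroup (\<delta>_cycles p q) (A p q)"
  unfolding \<delta>_cycles_def by (rule subgroup_kernel_hom[OF grp grp \<delta>_hom])

lemma d_closed: "x \<in> carrier (A p q) \<Longrightarrow> d p q x \<in> carrier (A p (Suc q))"
  using d_hom by (auto simp: hom_def)

lemma \<delta>_closed: "x \<in> carrier (A p q) \<Longrightarrow> \<delta> p q x \<in> carrier (A (Suc p) q)"
  using \<delta>_hom by (auto simp: hom_def)

lemma d_one: "d p q \<one>\<^bsub>A p q\<^esub> = \<one>\<^bsub>A p (Suc q)\<^esub>"
  using hom_one[OF d_hom grp grp] .

lemma \<delta>_one: "\<delta> p q \<one>\<^bsub>A p q\<^esub> = \<one>\<^bsub>A (Suc p) q\<^esub>"
  using hom_one[OF \<delta>_hom grp grp] .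

lemma d_d: "x \<in> carrier (A p q) \<Longrightarrow> d p (Suc q) (d p q x) = \<one>\<^bsub>A p (Suc (Suc q))\<^esub>"
  using d_exact[of p q] by (auto simp: kernel_def)

lemma \<delta>_\<delta>: "x \<in> carrier (A p q) \<Longrightarrow> \<delta> (Suc p) q (\<delta> p q x) = \<one>\<^bsub>A (Suc (Suc p)) q\<^esub>"
  using \<delta>_exact[of p q] by (auto simp: kernel_def)

lemma subgroup_bicycles: "subgroup (d_cycles p q \<inter> \<delta>_cycles p q) (A p q)"
  using group.subgroups_Inter_pair[OF grp subgroup_d_cycles subgroup_\<delta>_cycles] .

lemma comm_group_bicycles: "comm_group (bicycles p q)"
  unfolding bicycles_def by (rule comm_group_subgroup[OF A subgroup_bicycles])

lemma d_image_bicycles: "subgroup (d p q ` \<delta>_cycles p q) (bicycles p (Suc q))"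
  unfolding bicycles_def
proof (rule subgroup_of_subgroup[OF grp subgroup_bicycles])
  show "subgroup (d p q ` \<delta>_cycles p q) (A p (Suc q))"
    by (rule subgroup_hom_image[OF grp grp d_hom subgroup_\<delta>_cycles])
  show "d p q ` \<delta>_cycles p q \<subseteq> d_cycles p (Suc q) \<inter> \<delta>_cycles p (Suc q)"
    by (auto simp: d_cycles_def \<delta>_cycles_def kernel_def d_d d_closed d_\<delta>[symmetric] d_one)
qed

lemma \<delta>_image_bicycles: "subgroup (\<delta> p q ` d_cycles p q) (bicycles (Suc p) q)"
  unfolding bicycles_def
proof (rule subgroup_of_subgroup[OF grp subgroup_bicycles])
  show "subgroup (\<delta> p q ` d_cycles p q) (A (Suc p) q)"
    by (rule subgroup_hom_image[OF grp grp \<delta>_hom subgroup_d_cycles])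
  show "\<delta> p q ` d_cycles p q \<subseteq> d_cycles (Suc p) q \<inter> \<delta>_cycles (Suc p) q"
    by (auto simp: d_cycles_def \<delta>_cycles_def kernel_def \<delta>_\<delta> \<delta>_closed d_\<delta> \<delta>_one)
qed

text \<open>Exactness writes both groups of cycles as images of \<open>A p q\<close>, so by
  commutation both sides are the image of the diagonal map. This makes the target of one staircase
  step the source of the next.\<close>

lemma boundaries_eq: "d (Suc p) q ` \<delta>_cycles (Suc p) q = \<delta> p (Suc q) ` d_cycles p (Suc q)"
proof -
  have 1: "\<delta>_cycles (Suc p) q = \<delta> p q ` carrier (A p q)"
    by (simp add: \<delta>_cycles_def \<delta>_exact)
  have 2: "d_cycles p (Suc q) = d p q ` carrier (A p q)"
    by (simp add: d_cycles_def d_exact)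
  show ?thesis unfolding 1 2 image_image by (rule image_cong) (auto simp: d_\<delta>)
qed

text \<open>The span consists of the \<open>w\<close> killed by \<open>\<delta>\<close> after
  \<open>d\<close>; exactness makes \<open>d\<close> and \<open>\<delta>\<close> map it onto the two
  groups of bicycles. Either image is a boundary exactly when \<open>w\<close> is a product of a
  \<open>d\<close>-cycle and a \<open>\<delta>\<close>-cycle.\<close>

lemma staircase_step:
  "bicycles p (Suc q) Mod d p q ` \<delta>_cycles p q \<cong> bicycles (Suc p) q Mod \<delta> p q ` d_cycles p q"
proof -
  define Z where "Z = {w \<in> carrier (A p q). d p q w \<in> \<delta>_cycles p (Suc q)}"
  have Z: "Z = kernel (A p q) (A (Suc p) (Suc q)) (\<lambda>w. \<delta> p (Suc q) (d p q w))"
    by (auto simp: Z_def \<delta>_cycles_def kernel_def d_closed)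
  have "subgroup Z (A p q)"
    unfolding Z by (rule subgroup_kernel_hom[OF grp grp]) (use d_hom \<delta>_hom in \<open>auto simp: hom_def Pi_iff\<close>)
  then have W: "group ((A p q)\<lparr>carrier := Z\<rparr>)"
    using subgroup.subgroup_is_group grp by blast
  have dw: "d p q w \<in> d_cycles p (Suc q) \<inter> \<delta>_cycles p (Suc q)" if "w \<in> Z" for w
    using that by (auto simp: Z_def d_cycles_def kernel_def d_closed d_d)
  have \<delta>w: "\<delta> p q w \<in> d_cycles (Suc p) q \<inter> \<delta>_cycles (Suc p) q" if "w \<in> Z" for w
    using that by (auto simp: Z_def d_cycles_def \<delta>_cycles_def kernel_def \<delta>_closed \<delta>_\<delta> d_\<delta>)
  have inter: "d p q w \<in> d p q ` \<delta>_cycles p q \<longleftrightarrow> \<delta> p q w \<in> \<delta> p q ` d_cycles p q"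
    if w: "w \<in> Z" for w
  proof -
    interpret A: group "A p q" by (rule grp)
    have wA: "w \<in> carrier (A p q)" using w by (simp add: Z_def)
    have diff: "h (w \<otimes>\<^bsub>A p q\<^esub> inv\<^bsub>A p q\<^esub> u) = \<one>\<^bsub>H\<^esub> \<longleftrightarrow> h w = h u"
      if "h \<in> hom (A p q) H" "group H" "u \<in> carrier (A p q)" for h :: "'c \<Rightarrow> 'c" and u H
    proof -
      interpret h: group_hom "A p q" H h
        using that A.group_axioms by (simp add: group_hom_def group_hom_axioms_def)
      show ?thesis using wA that(3) by (simp add: h.H.inv_solve_right')
    qed
    have mem: "w \<otimes>\<^bsub>A p q\<^esub> inv\<^bsub>A p q\<^esub> u \<in> carrier (A p q)" if "u \<in> carrier (A p q)" for u
      using wA that by simp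
    have self: "h (w \<otimes>\<^bsub>A p q\<^esub> inv\<^bsub>A p q\<^esub> u) = h w" if "h \<in> hom (A p q) H" "group H"
        "u \<in> carrier (A p q)" "h u = \<one>\<^bsub>H\<^esub>" for h :: "'c \<Rightarrow> 'c" and u H
    proof -
      interpret h: group_hom "A p q" H h
        using that A.group_axioms by (simp add: group_hom_def group_hom_axioms_def)
      show ?thesis using wA that(3,4) by simp
    qed
    show ?thesis
    proof
      assume "d p q w \<in> d p q ` \<delta>_cycles p q"
      then obtain u where u: "u \<in> carrier (A p q)" "\<delta> p q u = \<one>\<^bsub>A (Suc p) q\<^esub>" "d p q w = d p q u"
        by (auto simp: \<delta>_cycles_def kernel_def)
      have "\<delta> p q w = \<delta> p q (w \<otimes>\<^bsub>A p q\<^esub> inv\<^bsub>A p q\<^esub> u)"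
        using self[OF \<delta>_hom grp u(1,2)] by simp
      moreover have "w \<otimes>\<^bsub>A p q\<^esub> inv\<^bsub>A p q\<^esub> u \<in> d_cycles p q"
        using diff[OF d_hom grp u(1)] u mem by (auto simp: d_cycles_def kernel_def)
      ultimately show "\<delta> p q w \<in> \<delta> p q ` d_cycles p q" by blast
    next
      assume "\<delta> p q w \<in> \<delta> p q ` d_cycles p q"
      then obtain u where u: "u \<in> carrier (A p q)" "d p q u = \<one>\<^bsub>A p (Suc q)\<^esub>" "\<delta> p q w = \<delta> p q u"
        by (auto simp: d_cycles_def kernel_def)
      have "d p q w = d p q (w \<otimes>\<^bsub>A p q\<^esub> inv\<^bsub>A p q\<^esub> u)"
        using self[OF d_hom grp u(1,2)] by simp
      moreover have "w \<otimes>\<^bsub>A p q\<^esub> inv\<^bsub>A p q\<^esub> u \<in> \<delta>_cycles p q"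
        using diff[OF \<delta>_hom grp u(1)] u mem by (auto simp: \<delta>_cycles_def kernel_def)
      ultimately show "d p q w \<in> d p q ` \<delta>_cycles p q" by blast
    qed
  qed
  have d_onto: "d p q ` Z = d_cycles p (Suc q) \<inter> \<delta>_cycles p (Suc q)"
  proof -
    have "x \<in> d p q ` Z" if x: "x \<in> d_cycles p (Suc q)" "x \<in> \<delta>_cycles p (Suc q)" for x
    proof -
      obtain w where "w \<in> carrier (A p q)" "x = d p q w"
        using x(1) d_exact[of p q] by (auto simp: d_cycles_def)
      then show ?thesis using x by (auto simp: Z_def)
    qed
    then show ?thesis using dw by auto
  qed
  have \<delta>_onto: "\<delta> p q ` Z = d_cycles (Suc p) q \<inter> \<delta>_cycles (Suc p) q"
  proof -
    have "x \<in> \<delta> p q ` Z" if x: "x \<in> d_cycles (Suc p) q" "x \<in> \<delta>_cycles (Suc p) q" for x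
    proof -
      obtain w where "w \<in> carrier (A p q)" "x = \<delta> p q w"
        using x(2) \<delta>_exact[of p q] by (auto simp: \<delta>_cycles_def)
      then show ?thesis using x
        by (auto simp: Z_def d_cycles_def \<delta>_cycles_def kernel_def d_\<delta> d_closed)
    qed
    then show ?thesis using \<delta>w by auto
  qed
  show ?thesis
  proof (rule subgroup_Mod_iso_by_span[OF W comm_group_bicycles d_image_bicycles
        comm_group_bicycles \<delta>_image_bicycles])
    show "d p q \<in> hom ((A p q)\<lparr>carrier := Z\<rparr>) (bicycles p (Suc q))"
      using dw d_hom by (auto simp: hom_def bicycles_def Z_def)
    show "\<delta> p q \<in> hom ((A p q)\<lparr>carrier := Z\<rparr>) (bicycles (Suc p) q)"
      using \<delta>w \<delta>_hom by (auto simp: hom_def bicycles_def Z_def)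
  qed (use d_onto \<delta>_onto inter in \<open>auto simp: bicycles_def\<close>)
qed

text \<open>All stations have total degree \<open>j + 1\<close>; a first step and \<open>j\<close>
  further ones lead from the edge \<open>p = 0\<close> to the edge \<open>q = 0\<close>.\<close>

theorem staircase:
  "bicycles 0 (Suc j) Mod d 0 j ` \<delta>_cycles 0 j \<cong> bicycles (Suc j) 0 Mod \<delta> j 0 ` d_cycles j 0"
proof -
  have "k \<le> j \<Longrightarrow> bicycles 0 (Suc j) Mod d 0 j ` \<delta>_cycles 0 j \<cong>
    bicycles (Suc k) (j - k) Mod \<delta> k (j - k) ` d_cycles k (j - k)" for k
  proof (induction k)
    case 0
    show ?case using staircase_step[of 0 j] by simp
  next
    case (Suc k)
    then have j: "j - k = Suc (j - Suc k)" by simp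
    have "bicycles (Suc k) (j - k) Mod \<delta> k (j - k) ` d_cycles k (j - k) \<cong>
      bicycles (Suc (Suc k)) (j - Suc k) Mod \<delta> (Suc k) (j - Suc k) ` d_cycles (Suc k) (j - Suc k)"
      using staircase_step[of "Suc k" "j - Suc k"] by (simp add: j boundaries_eq)
    then show ?case using Suc iso_trans by fastforce
  qed
  from this[of j] show ?thesis by simp
qed

end

section \<open>Cech cochains on the space of nonempty faces\<close>

lemma hom_finprod:
  assumes "comm_group G" "comm_group H" "h \<in> hom G H" "f \<in> A \<rightarrow> carrier G"
  shows "h (finprod G f A) = finprod H (\<lambda>a. h (f a)) A"
proof -
  interpret G: comm_group G by fact
  interpret H: comm_group H by fact
  interpret h: group_hom G H h
    using assms by (simp add: group_hom_def group_hom_axioms_def G.group_axioms H.group_axioms)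
  show ?thesis
    using assms(4)
    by (induction A rule: infinite_finite_induct) (auto simp: Pi_iff)
qed

text \<open>Adjoining \<open>a\<close> to \<open>S\<close> adds one row and one column to the double
  product, and these cancel entry by entry. It is the reason why a differential squares to zero, in
  multiplicative notation.\<close>

lemma (in comm_group) finprod_alternating:
  assumes "finite S"
    and "\<And>v w. v \<in> S \<Longrightarrow> w \<in> S \<Longrightarrow> v \<noteq> w \<Longrightarrow> g v w \<in> carrier G"
    and "\<And>v w. v \<in> S \<Longrightarrow> w \<in> S \<Longrightarrow> v \<noteq> w \<Longrightarrow> g v w \<otimes> g w v = \<one>"
  shows "(\<Otimes>v\<in>S. \<Otimes>w\<in>S - {v}. g v w) = \<one>"
  using assms
proof (induction S)
  case (insert a S)
  have ins: "insert a S - {v} = insert a (S - {v})" if "v \<in> S" for v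
    using that insert(2) by auto
  have a: "(\<lambda>v. g v a) \<in> S \<rightarrow> carrier G" "g a \<in> S \<rightarrow> carrier G"
    "v \<in> S \<Longrightarrow> g a v \<otimes> g v a = \<one>" for v
  proof -
    have "g v a \<in> carrier G \<and> g a v \<in> carrier G \<and> g a v \<otimes> g v a = \<one>" if "v \<in> S" for v
    proof -
      have "v \<noteq> a" using insert(2) that by auto
      then show ?thesis using insert.prems that by blast
    qed
    then show "(\<lambda>v. g v a) \<in> S \<rightarrow> carrier G" "g a \<in> S \<rightarrow> carrier G"
      "v \<in> S \<Longrightarrow> g a v \<otimes> g v a = \<one>" for v by blast+
  qed
  have "(\<Otimes>v\<in>S. \<Otimes>w\<in>insert a S - {v}. g v w) = (\<Otimes>v\<in>S. g v a \<otimes> (\<Otimes>w\<in>S - {v}. g v w))"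
  proof (rule finprod_cong')
    fix v assume v: "v \<in> S"
    then have "v \<noteq> a" using insert(2) by auto
    then show "(\<Otimes>w\<in>insert a S - {v}. g v w) = g v a \<otimes> (\<Otimes>w\<in>S - {v}. g v w)"
      unfolding ins[OF v] using insert v by (intro finprod_insert) auto
  qed (use insert in \<open>auto intro!: finprod_closed m_closed\<close>)
  also have "\<dots> = (\<Otimes>v\<in>S. g v a) \<otimes> (\<Otimes>v\<in>S. \<Otimes>w\<in>S - {v}. g v w)"
    using insert by (intro finprod_multf) (auto intro!: finprod_closed)
  also have "(\<Otimes>v\<in>S. \<Otimes>w\<in>S - {v}. g v w) = \<one>"
    using insert by auto
  finally have *: "(\<Otimes>v\<in>S. \<Otimes>w\<in>insert a S - {v}. g v w) = (\<Otimes>v\<in>S. g v a)"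
    using a(1) by simp
  have "(\<Otimes>v\<in>insert a S. \<Otimes>w\<in>insert a S - {v}. g v w) = (\<Otimes>w\<in>S. g a w) \<otimes> (\<Otimes>v\<in>S. g v a)"
    using insert by (subst finprod_insert) (auto intro!: finprod_closed simp: *)
  also have "\<dots> = (\<Otimes>v\<in>S. g a v \<otimes> g v a)"
    using finprod_multf[OF a(2,1)] by simp
  also have "\<dots> = \<one>" using a(3) by (rule finprod_one_eqI)
  finally show ?case .
qed auto

lemma (in group) int_pow_uminus_cancel:
  "x \<in> carrier G \<Longrightarrow> x [^] (k::int) \<otimes> x [^] (- k) = \<one>"
  using int_pow_mult[of x k "- k"] by simp

lemma comm_group_product_group:
  assumes "\<And>i. i \<in> S \<Longrightarrow> comm_group (G i)"
  shows "comm_group (product_group S G)"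
proof -
  interpret group "product_group S G"
    using assms by (intro product_group) (simp add: comm_group.axioms)
  show ?thesis
  proof (rule group_comm_groupI)
    fix x y assume "x \<in> carrier (product_group S G)" "y \<in> carrier (product_group S G)"
    then show "x \<otimes>\<^bsub>product_group S G\<^esub> y = y \<otimes>\<^bsub>product_group S G\<^esub> x"
      using assms by (auto simp: comm_group_def comm_monoid.m_comm PiE_iff intro!: restrict_ext)
  qed
qed

text \<open>An infinite type absorbs its own square, so a finite family of its elements can be coded
  one coordinate at a time. For empty \<open>S\<close> there is a single extensional function; this
  case covers the empty space, where \<open>'b\<close> may be finite.\<close>

lemma infinite_inj_on_extensional:
  assumes "finite S" and "S = {} \<or> infinite (UNIV :: 'b set)"
  shows "\<exists>e :: ('k \<Rightarrow> 'b) \<Rightarrow> 'b. inj_on e (extensional S)"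
  using assms
proof (induction S)
  case empty
  have "inj_on (\<lambda>_. undefined :: 'b) (extensional {} :: ('k \<Rightarrow> 'b) set)"
    by (auto simp: inj_on_def)
  then show ?case by blast
next
  case (insert a S)
  then have inf: "infinite (UNIV :: 'b set)" by auto
  obtain e :: "('k \<Rightarrow> 'b) \<Rightarrow> 'b" where e: "inj_on e (extensional S)" using insert by auto
  obtain p :: "'b \<times> 'b \<Rightarrow> 'b" where "bij_betw p (UNIV \<times> UNIV) UNIV"
    using card_of_ordIso[THEN iffD2, OF card_of_Times_same_infinite[OF inf]] by (elim exE) (rule that)
  then have p: "inj p" by (simp add: bij_betw_def)
  have "inj_on (\<lambda>f. p (f a, e (restrict f S))) (extensional (insert a S))"
  proof (rule inj_onI)
    fix f g :: "'k \<Rightarrow> 'b"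
    assume fg: "f \<in> extensional (insert a S)" "g \<in> extensional (insert a S)"
      and "p (f a, e (restrict f S)) = p (g a, e (restrict g S))"
    then have "f a = g a" "e (restrict f S) = e (restrict g S)"
      by (simp_all add: inj_eq[OF p])
    then have "f a = g a" "restrict f S = restrict g S"
      using inj_onD[OF e] by auto
    then have "f x = g x" if "x \<in> insert a S" for x
      using that by (metis insertE restrict_apply)
    then show "f = g" using fg by (intro extensionalityI)
  qed
  then show ?case by blast
qed

section \<open>Alternating signs\<close>

definition pos_sign :: "'v::linorder set \<Rightarrow> 'v \<Rightarrow> int" where
  "pos_sign \<tau> v = (-1) ^ card {w \<in> \<tau>. w < v}"

lemma pos_sign_sq [simp]: "pos_sign \<tau> v * pos_sign \<tau> v = 1"
  unfolding pos_sign_def by (metis mult_minus1 add.inverse_inverse power_mult_distrib power_one)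

text \<open>Deleting the smaller vertex lowers the position of the larger one by one, while deleting
  the larger leaves the smaller in place. This yields the vanishing squares of both differentials
  and the minus sign in \<open>cech_assemble\<close>.\<close>

lemma pos_sign_swap:
  assumes "finite \<tau>" "v \<in> \<tau>" "w \<in> \<tau>" "v \<noteq> w"
  shows "pos_sign (\<tau> - {v}) w * pos_sign \<tau> v = - (pos_sign (\<tau> - {w}) v * pos_sign \<tau> w)"
proof -
  have *: "pos_sign (\<tau> - {v}) w * pos_sign \<tau> v = - (pos_sign (\<tau> - {w}) v * pos_sign \<tau> w)"
    if "v < w" "v \<in> \<tau>" "w \<in> \<tau>" for v w
  proof -
    have "{u \<in> \<tau>. u < w} = insert v {u \<in> \<tau> - {v}. u < w}" using that by auto
    then have "card {u \<in> \<tau>. u < w} = Suc (card {u \<in> \<tau> - {v}. u < w})"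
      using assms(1) by simp
    moreover have "{u \<in> \<tau> - {w}. u < v} = {u \<in> \<tau>. u < v}" using that by auto
    ultimately show ?thesis unfolding pos_sign_def by simp
  qed
  show ?thesis
    using *[of v w] *[of w v] assms by (cases v w rule: linorder_cases) auto
qed

lemma pos_sign_Min: "\<forall>w\<in>\<tau>. v \<le> w \<Longrightarrow> pos_sign \<tau> v = 1"
proof -
  assume "\<forall>w\<in>\<tau>. v \<le> w"
  then have "{w \<in> \<tau>. w < v} = {}" by auto
  then show ?thesis unfolding pos_sign_def by (metis card.empty power_0)
qed

lemma pos_sign_insert_less:
  assumes "finite \<tau>" "m \<notin> \<tau>" "m < v"
  shows "pos_sign (insert m \<tau>) v = - pos_sign \<tau> v"
proof -
  have "{w \<in> insert m \<tau>. w < v} = insert m {w \<in> \<tau>. w < v}" using assms by auto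
  then show ?thesis using assms by (simp add: pos_sign_def)
qed

section \<open>Elementary facts on presheaves and sheaves\<close>

lemma presheafD:
  assumes "presheaf X F"
  shows presheaf_comm_group: "openin X U \<Longrightarrow> comm_group (sections F U)"
    and presheaf_hom: "openin X U \<Longrightarrow> openin X W \<Longrightarrow> W \<subseteq> U \<Longrightarrow>
      restr F U W \<in> hom (sections F U) (sections F W)"
    and presheaf_id: "openin X U \<Longrightarrow> s \<in> carrier (sections F U) \<Longrightarrow> restr F U U s = s"
    and presheaf_trans: "openin X U \<Longrightarrow> openin X V \<Longrightarrow> openin X W \<Longrightarrow> W \<subseteq> V \<Longrightarrow> V \<subseteq> U \<Longrightarrow>
      s \<in> carrier (sections F U) \<Longrightarrow> restr F V W (restr F U V s) = restr F U W s"
  using assms by (simp_all add: presheaf_def)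

lemma presheaf_closed:
  "presheaf X F \<Longrightarrow> openin X U \<Longrightarrow> openin X W \<Longrightarrow> W \<subseteq> U \<Longrightarrow> s \<in> carrier (sections F U) \<Longrightarrow>
    restr F U W s \<in> carrier (sections F W)"
  using presheaf_hom[of X F U W] by (auto simp: hom_def)

lemma sheaf_morphismD:
  assumes "sheaf_morphism X F G \<phi>"
  shows sheaf_morphism_hom: "openin X U \<Longrightarrow> \<phi> U \<in> hom (sections F U) (sections G U)"
    and sheaf_morphism_natural: "openin X U \<Longrightarrow> openin X W \<Longrightarrow> W \<subseteq> U \<Longrightarrow>
      s \<in> carrier (sections F U) \<Longrightarrow> restr G U W (\<phi> U s) = \<phi> W (restr F U W s)"
  using assms by (simp_all add: sheaf_morphism_def)

text \<open>The uniqueness half of gluing, applied to the family of restrictions of \<open>s\<close>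
  itself, which is compatible by transitivity of restriction.\<close>

lemma sheaf_separated:
  assumes F: "sheaf X F" and U: "\<And>U. U \<in> \<U> \<Longrightarrow> openin X U"
    and st: "s \<in> carrier (sections F (\<Union>\<U>))" "t \<in> carrier (sections F (\<Union>\<U>))"
    and eq: "\<And>U. U \<in> \<U> \<Longrightarrow> restr F (\<Union>\<U>) U s = restr F (\<Union>\<U>) U t"
  shows "s = t"
proof -
  have P: "presheaf X F" using F by (simp add: sheaf_def)
  have op: "openin X (\<Union>\<U>)" using U by blast
  have "\<exists>!r. r \<in> carrier (sections F (\<Union>\<U>)) \<and> (\<forall>U\<in>\<U>. restr F (\<Union>\<U>) U r = restr F (\<Union>\<U>) U s)"
    using F[unfolded sheaf_def, THEN conjunct2, rule_format, of \<U> "\<lambda>U. restr F (\<Union>\<U>) U s"]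
      presheaf_closed[OF P op U _ st(1)] presheaf_trans[OF P op _ _ _ _ st(1)] U
    by (simp add: Union_upper openin_Int)
  then show ?thesis using st eq by metis
qed

text \<open>The empty set is covered by the empty family, for which agreement of restrictions is
  vacuous.\<close>

lemma sheaf_empty: "sheaf X F \<Longrightarrow> s \<in> carrier (sections F {}) \<Longrightarrow> t \<in> carrier (sections F {}) \<Longrightarrow> s = t"
  using sheaf_separated[of X F "{}" s t] by simp

text \<open>The poset of nonempty faces with the topology of up-sets, carried along a naming
  \<open>pt\<close> of its points; the Cech argument thereby becomes independent of binoids.
  \<open>pt\<close> is injective on the empty face too, whose image lies outside the space: in the
  application it is the removed maximal ideal.\<close>

locale face_space =
  fixes \<Delta> :: "'v::linorder set set" and X :: "'p topology" and pt :: "'v set \<Rightarrow> 'p"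
  assumes finite_faces: "finite \<Delta>"
    and finite_face: "\<sigma> \<in> \<Delta> \<Longrightarrow> finite \<sigma>"
    and face_mono: "\<sigma> \<in> \<Delta> \<Longrightarrow> \<tau> \<subseteq> \<sigma> \<Longrightarrow> \<tau> \<in> \<Delta>"
    and inj_pt: "inj_on pt \<Delta>"
    and topspace_pt: "topspace X = pt ` (\<Delta> - {{}})"
    and openin_nbhd': "\<sigma> \<in> \<Delta> \<Longrightarrow> \<sigma> \<noteq> {} \<Longrightarrow> openin X (pt ` {\<tau> \<in> \<Delta>. \<sigma> \<subseteq> \<tau>})"
    and nbhd_min': "\<sigma> \<in> \<Delta> \<Longrightarrow> \<sigma> \<noteq> {} \<Longrightarrow> openin X W \<Longrightarrow> pt \<sigma> \<in> W \<Longrightarrow> pt ` {\<tau> \<in> \<Delta>. \<sigma> \<subseteq> \<tau>} \<subseteq> W"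
begin

definition nbhd :: "'v set \<Rightarrow> 'p set" where
  "nbhd \<sigma> = pt ` {\<tau> \<in> \<Delta>. \<sigma> \<subseteq> \<tau>}"

lemmas openin_nbhd = openin_nbhd'[folded nbhd_def]
lemmas nbhd_min = nbhd_min'[folded nbhd_def]

lemma pt_in_nbhd: "\<sigma> \<in> \<Delta> \<Longrightarrow> pt \<sigma> \<in> nbhd \<sigma>"
  by (auto simp: nbhd_def)

lemma pt_in_nbhd_iff: "\<tau> \<in> \<Delta> \<Longrightarrow> pt \<tau> \<in> nbhd \<sigma> \<longleftrightarrow> \<sigma> \<subseteq> \<tau>"
  unfolding nbhd_def using inj_onD[OF inj_pt] by blast

lemma nbhd_anti: "\<sigma> \<subseteq> \<tau> \<Longrightarrow> nbhd \<tau> \<subseteq> nbhd \<sigma>"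
  by (auto simp: nbhd_def)

text \<open>A point lies in both sets iff its face contains both index sets. So intersections of
  members of the vertex cover are again smallest neighbourhoods, or empty when the union is not a
  face (\<open>nbhd_nonface\<close>).\<close>

lemma nbhd_Int: "nbhd \<sigma> \<inter> nbhd \<tau> = nbhd (\<sigma> \<union> \<tau>)"
proof (intro equalityI subsetI)
  fix x assume x: "x \<in> nbhd \<sigma> \<inter> nbhd \<tau>"
  then obtain \<rho> where \<rho>: "\<rho> \<in> \<Delta>" "x = pt \<rho>" unfolding nbhd_def by blast
  with x have "\<sigma> \<union> \<tau> \<subseteq> \<rho>" using pt_in_nbhd_iff by auto
  then show "x \<in> nbhd (\<sigma> \<union> \<tau>)" using \<rho> pt_in_nbhd_iff by auto
next
  fix x assume "x \<in> nbhd (\<sigma> \<union> \<tau>)"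
  then show "x \<in> nbhd \<sigma> \<inter> nbhd \<tau>" using nbhd_anti[of _ "\<sigma> \<union> \<tau>"] by blast
qed

lemma nbhd_nonface: "\<sigma> \<notin> \<Delta> \<Longrightarrow> nbhd \<sigma> = {}"
  unfolding nbhd_def using face_mono by blast

section \<open>The Cech complex of the cover by the neighbourhoods of the vertices\<close>

abbreviation stalk :: "('p, 'b) group_presheaf \<Rightarrow> 'v set \<Rightarrow> 'b monoid" where
  "stalk F \<sigma> \<equiv> sections F (nbhd \<sigma>)"

text \<open>The index sets of Cech cochains of degree \<open>p\<close>. Sets of vertices that are
  not faces are left out: the intersection belonging to them is empty, and a sheaf has only the
  trivial section there.\<close>

definition cells :: "nat \<Rightarrow> 'v set set" where
  "cells p = {\<sigma> \<in> \<Delta>. card \<sigma> = Suc p}"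

lemma cellD: "\<sigma> \<in> cells p \<Longrightarrow> \<sigma> \<in> \<Delta> \<and> \<sigma> \<noteq> {} \<and> finite \<sigma>"
  by (auto simp: cells_def finite_face)

lemma cell_open: "\<sigma> \<in> cells p \<Longrightarrow> openin X (nbhd \<sigma>)"
  by (simp add: cellD openin_nbhd)

lemma cell_facet: "\<tau> \<in> cells (Suc p) \<Longrightarrow> v \<in> \<tau> \<Longrightarrow> \<tau> - {v} \<in> cells p"
  using face_mono[of \<tau> "\<tau> - {v}"] by (simp add: cells_def card_Diff_singleton)

definition cochains :: "('p, 'b) group_presheaf \<Rightarrow> nat \<Rightarrow> ('v set \<Rightarrow> 'b) monoid" where
  "cochains F p = product_group (cells p) (\<lambda>\<sigma>. stalk F \<sigma>)"

abbreviation facet_restr :: "('p, 'b) group_presheaf \<Rightarrow> 'v set \<Rightarrow> 'v \<Rightarrow> 'b \<Rightarrow> 'b" where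
  "facet_restr F \<tau> v \<equiv> restr F (nbhd (\<tau> - {v})) (nbhd \<tau>)"

text \<open>The alternating Cech differential on increasing tuples of vertices; in multiplicative
  notation the sign becomes an exponent.\<close>

definition cech :: "('p, 'b) group_presheaf \<Rightarrow> nat \<Rightarrow> ('v set \<Rightarrow> 'b) \<Rightarrow> 'v set \<Rightarrow> 'b" where
  "cech F p x = (\<lambda>\<tau>\<in>cells (Suc p). finprod (stalk F \<tau>)
     (\<lambda>v. facet_restr F \<tau> v (x (\<tau> - {v})) [^]\<^bsub>stalk F \<tau>\<^esub> pos_sign \<tau> v) \<tau>)"

context
  fixes F :: "('p, 'b) group_presheaf"
  assumes F: "presheaf X F"
begin

lemma cell_comm_group: "\<sigma> \<in> cells p \<Longrightarrow> comm_group (stalk F \<sigma>)"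
  by (rule presheaf_comm_group[OF F cell_open])

lemma cell_group: "\<sigma> \<in> cells p \<Longrightarrow> group (stalk F \<sigma>)"
  by (rule comm_group.axioms(2)[OF cell_comm_group])

lemma comm_group_cochains: "comm_group (cochains F p)"
  unfolding cochains_def by (rule comm_group_product_group) (rule cell_comm_group)

lemma facet_restr_hom:
  "\<tau> \<in> cells (Suc p) \<Longrightarrow> v \<in> \<tau> \<Longrightarrow>
    facet_restr F \<tau> v \<in> hom (stalk F (\<tau> - {v})) (stalk F \<tau>)"
  by (rule presheaf_hom[OF F cell_open[OF cell_facet] cell_open nbhd_anti]) auto

lemma facet_restr_closed:
  "\<tau> \<in> cells (Suc p) \<Longrightarrow> v \<in> \<tau> \<Longrightarrow> x \<in> carrier (cochains F p) \<Longrightarrow>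
    facet_restr F \<tau> v (x (\<tau> - {v})) \<in> carrier (stalk F \<tau>)"
  using facet_restr_hom[of \<tau> p v] cell_facet[of \<tau> p v]
  by (auto simp: cochains_def hom_def PiE_iff)

lemma cech_term_closed:
  assumes "\<tau> \<in> cells (Suc p)" "x \<in> carrier (cochains F p)" "v \<in> \<tau>"
  shows "facet_restr F \<tau> v (x (\<tau> - {v})) [^]\<^bsub>stalk F \<tau>\<^esub> pos_sign \<tau> v
    \<in> carrier (stalk F \<tau>)"
  using group.int_pow_closed[OF cell_group] facet_restr_closed assms by blast

lemma cech_hom: "cech F p \<in> hom (cochains F p) (cochains F (Suc p))"
proof (rule homI)
  fix x assume x: "x \<in> carrier (cochains F p)"
  have "finprod (stalk F \<tau>) (\<lambda>v. facet_restr F \<tau> v (x (\<tau> - {v}))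
      [^]\<^bsub>stalk F \<tau>\<^esub> pos_sign \<tau> v) \<tau> \<in> carrier (stalk F \<tau>)"
    if "\<tau> \<in> cells (Suc p)" for \<tau>
    by (rule comm_monoid.finprod_closed)
      (use cech_term_closed[OF that x] cell_comm_group[OF that] in \<open>auto simp: comm_group_def\<close>)
  then show "cech F p x \<in> carrier (cochains F (Suc p))"
    by (auto simp: cech_def cochains_def PiE_iff)
  fix y assume y: "y \<in> carrier (cochains F p)"
  have "cech F p (x \<otimes>\<^bsub>cochains F p\<^esub> y) \<tau> = (cech F p x \<otimes>\<^bsub>cochains F (Suc p)\<^esub> cech F p y) \<tau>" for \<tau>
  proof (cases "\<tau> \<in> cells (Suc p)")
    case \<tau>: True
    interpret G: comm_group "stalk F \<tau>" by (rule cell_comm_group[OF \<tau>])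
    let ?r = "\<lambda>x v. facet_restr F \<tau> v (x (\<tau> - {v}))"
    let ?t = "\<lambda>x v. ?r x v [^]\<^bsub>stalk F \<tau>\<^esub> pos_sign \<tau> v"
    have "?t (x \<otimes>\<^bsub>cochains F p\<^esub> y) v = ?t x v \<otimes>\<^bsub>stalk F \<tau>\<^esub> ?t y v" if v: "v \<in> \<tau>" for v
    proof -
      have f: "\<tau> - {v} \<in> cells p" using cell_facet[OF \<tau> v] .
      have xy: "x (\<tau> - {v}) \<in> carrier (stalk F (\<tau> - {v}))"
        "y (\<tau> - {v}) \<in> carrier (stalk F (\<tau> - {v}))"
        using x y f by (auto simp: cochains_def PiE_iff)
      have "?r (x \<otimes>\<^bsub>cochains F p\<^esub> y) v = ?r x v \<otimes>\<^bsub>stalk F \<tau>\<^esub> ?r y v"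
        using hom_mult[OF facet_restr_hom[OF \<tau> v] xy] f by (simp add: cochains_def)
      then show ?thesis
        using facet_restr_closed[OF \<tau> v] x y by (simp add: G.int_pow_distrib)
    qed
    then have "finprod (stalk F \<tau>) (?t (x \<otimes>\<^bsub>cochains F p\<^esub> y)) \<tau> =
        finprod (stalk F \<tau>) (\<lambda>v. ?t x v \<otimes>\<^bsub>stalk F \<tau>\<^esub> ?t y v) \<tau>"
      using cech_term_closed[OF \<tau>] x y by (intro G.finprod_cong') auto
    also have "\<dots> = finprod (stalk F \<tau>) (?t x) \<tau> \<otimes>\<^bsub>stalk F \<tau>\<^esub> finprod (stalk F \<tau>) (?t y) \<tau>"
      using cech_term_closed[OF \<tau>] x y by (intro G.finprod_multf) auto
    finally show ?thesis using \<tau> by (simp add: cech_def cochains_def)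
  qed (simp add: cech_def cochains_def)
  then show "cech F p (x \<otimes>\<^bsub>cochains F p\<^esub> y) = cech F p x \<otimes>\<^bsub>cochains F (Suc p)\<^esub> cech F p y" by blast
qed

text \<open>Homomorphisms pass through products and integer powers. This one rule serves restriction
  to a smaller set, evaluation at a point and maps of sheaves.\<close>

lemma hom_cech:
  assumes \<tau>: "\<tau> \<in> cells (Suc p)" and x: "x \<in> carrier (cochains F p)"
    and H: "comm_group H" and h: "h \<in> hom (stalk F \<tau>) H"
  shows "h (cech F p x \<tau>) =
    finprod H (\<lambda>v. h (facet_restr F \<tau> v (x (\<tau> - {v}))) [^]\<^bsub>H\<^esub> pos_sign \<tau> v) \<tau>"
proof -
  interpret G: comm_group "stalk F \<tau>" by (rule cell_comm_group[OF \<tau>])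
  interpret H: comm_group H by fact
  interpret h: group_hom "stalk F \<tau>" H h
    using h by (simp add: group_hom_def group_hom_axioms_def G.group_axioms H.group_axioms)
  have "h (cech F p x \<tau>) = finprod H (\<lambda>v. h (facet_restr F \<tau> v (x (\<tau> - {v}))
      [^]\<^bsub>stalk F \<tau>\<^esub> pos_sign \<tau> v)) \<tau>"
    using \<tau> cech_term_closed[OF \<tau> x] unfolding cech_def
    by (simp add: hom_finprod[OF G.comm_group_axioms H h])
  also have "\<dots> = finprod H (\<lambda>v. h (facet_restr F \<tau> v (x (\<tau> - {v}))) [^]\<^bsub>H\<^esub> pos_sign \<tau> v) \<tau>"
    using facet_restr_closed[OF \<tau> _ x]
    by (intro H.finprod_cong') (auto simp: h.hom_int_pow)
  finally show ?thesis .
qed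

lemma cech_cech:
  assumes x: "x \<in> carrier (cochains F p)"
  shows "cech F (Suc p) (cech F p x) = \<one>\<^bsub>cochains F (Suc (Suc p))\<^esub>"
proof
  fix \<rho>
  have cx: "cech F p x \<in> carrier (cochains F (Suc p))"
    using cech_hom x by (auto simp: hom_def)
  show "cech F (Suc p) (cech F p x) \<rho> = \<one>\<^bsub>cochains F (Suc (Suc p))\<^esub> \<rho>"
  proof (cases "\<rho> \<in> cells (Suc (Suc p))")
    case \<rho>: True
    let ?G = "stalk F \<rho>"
    interpret G: comm_group ?G by (rule cell_comm_group[OF \<rho>])
    have fin: "finite \<rho>" using cellD[OF \<rho>] by simp
    \<comment> \<open>\<open>r v w\<close> depends only on the unordered pair, as two deletions
      commute. The exponents in \<open>g v w\<close> and \<open>g w v\<close> are opposite by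
      \<open>pos_sign_swap\<close>, so \<open>finprod_alternating\<close> applies.\<close>
    define r where "r v w = restr F (nbhd (\<rho> - {v} - {w})) (nbhd \<rho>) (x (\<rho> - {v} - {w}))" for v w
    have r: "r v w \<in> carrier ?G" if "v \<in> \<rho>" "w \<in> \<rho>" "v \<noteq> w" for v w
    proof -
      have f: "\<rho> - {v} \<in> cells (Suc p)" "\<rho> - {v} - {w} \<in> cells p"
        using cell_facet \<rho> that by auto
      then have "x (\<rho> - {v} - {w}) \<in> carrier (stalk F (\<rho> - {v} - {w}))"
        using x by (auto simp: cochains_def PiE_iff)
      then show ?thesis unfolding r_def
        using presheaf_closed[OF F cell_open[OF f(2)] cell_open[OF \<rho>] nbhd_anti] by blast
    qed
    define g where "g v w = r v w [^]\<^bsub>?G\<^esub> (pos_sign (\<rho> - {v}) w * pos_sign \<rho> v)" for v w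
    have "cech F (Suc p) (cech F p x) \<rho> =
      finprod ?G (\<lambda>v. facet_restr F \<rho> v (cech F p x (\<rho> - {v})) [^]\<^bsub>?G\<^esub> pos_sign \<rho> v) \<rho>"
      using \<rho> by (simp add: cech_def)
    also have "\<dots> = finprod ?G (\<lambda>v. finprod ?G (\<lambda>w. g v w) (\<rho> - {v})) \<rho>"
    proof (rule G.finprod_cong'[OF refl])
      show "(\<lambda>v. finprod ?G (\<lambda>w. g v w) (\<rho> - {v})) \<in> \<rho> \<rightarrow> carrier ?G"
        using r by (auto simp: g_def intro!: G.finprod_closed)
      fix v assume v: "v \<in> \<rho>"
      then have f: "\<rho> - {v} \<in> cells (Suc p)" using cell_facet \<rho> by auto
      have "facet_restr F \<rho> v (cech F p x (\<rho> - {v})) =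
        finprod ?G (\<lambda>w. facet_restr F \<rho> v (restr F (nbhd (\<rho> - {v} - {w})) (nbhd (\<rho> - {v}))
          (x (\<rho> - {v} - {w}))) [^]\<^bsub>?G\<^esub> pos_sign (\<rho> - {v}) w) (\<rho> - {v})"
        by (rule hom_cech[OF f x G.comm_group_axioms facet_restr_hom[OF \<rho> v]])
      also have "\<dots> = finprod ?G (\<lambda>w. r v w [^]\<^bsub>?G\<^esub> pos_sign (\<rho> - {v}) w) (\<rho> - {v})"
      proof (rule G.finprod_cong'[OF refl])
        show "(\<lambda>w. r v w [^]\<^bsub>?G\<^esub> pos_sign (\<rho> - {v}) w) \<in> \<rho> - {v} \<rightarrow> carrier ?G"
          using r v by auto
        fix w assume w: "w \<in> \<rho> - {v}"
        have f2: "\<rho> - {v} - {w} \<in> cells p" using cell_facet[OF f w] .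
        then have "x (\<rho> - {v} - {w}) \<in> carrier (stalk F (\<rho> - {v} - {w}))"
          using x by (auto simp: cochains_def PiE_iff)
        then show "facet_restr F \<rho> v (restr F (nbhd (\<rho> - {v} - {w})) (nbhd (\<rho> - {v}))
          (x (\<rho> - {v} - {w}))) [^]\<^bsub>?G\<^esub> pos_sign (\<rho> - {v}) w = r v w [^]\<^bsub>?G\<^esub> pos_sign (\<rho> - {v}) w"
          unfolding r_def
          using presheaf_trans[OF F cell_open[OF f2] cell_open[OF f] cell_open[OF \<rho>] nbhd_anti nbhd_anti]
          by (metis Diff_subset)
      qed
      finally have eq: "facet_restr F \<rho> v (cech F p x (\<rho> - {v})) = \<dots>" .
      show "facet_restr F \<rho> v (cech F p x (\<rho> - {v})) [^]\<^bsub>?G\<^esub> pos_sign \<rho> v =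
        finprod ?G (\<lambda>w. g v w) (\<rho> - {v})"
      proof -
        have pow: "(\<lambda>a. a [^]\<^bsub>?G\<^esub> pos_sign \<rho> v) \<in> hom ?G ?G"
          by (rule homI) (auto simp: G.int_pow_distrib)
        have "finprod ?G (\<lambda>w. r v w [^]\<^bsub>?G\<^esub> pos_sign (\<rho> - {v}) w) (\<rho> - {v}) [^]\<^bsub>?G\<^esub> pos_sign \<rho> v
          = finprod ?G (\<lambda>w. (r v w [^]\<^bsub>?G\<^esub> pos_sign (\<rho> - {v}) w) [^]\<^bsub>?G\<^esub> pos_sign \<rho> v) (\<rho> - {v})"
          using r v by (intro hom_finprod[OF G.comm_group_axioms G.comm_group_axioms pow]) auto
        also have "\<dots> = finprod ?G (\<lambda>w. g v w) (\<rho> - {v})"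
          using r v by (intro G.finprod_cong') (auto simp: g_def G.int_pow_pow)
        finally show ?thesis unfolding eq .
      qed
    qed
    also have "\<dots> = \<one>\<^bsub>?G\<^esub>"
    proof (rule G.finprod_alternating[OF fin])
      fix v w assume vw: "v \<in> \<rho>" "w \<in> \<rho>" "v \<noteq> w"
      show "g v w \<in> carrier ?G" using r vw by (simp add: g_def)
      have "r w v = r v w" by (simp add: r_def Diff_insert2[symmetric] insert_commute)
      then show "g v w \<otimes>\<^bsub>?G\<^esub> g w v = \<one>\<^bsub>?G\<^esub>"
        using G.int_pow_uminus_cancel[OF r[OF vw]] pos_sign_swap[OF fin vw(2,1)] vw
        by (simp add: g_def)
    qed
    finally show ?thesis using \<rho> by (simp add: cochains_def)
  qed (simp add: cech_def cochains_def)
qed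

end

section \<open>Functoriality of the Cech complex\<close>

definition cochain_map :: "('p set \<Rightarrow> 'a \<Rightarrow> 'b) \<Rightarrow> nat \<Rightarrow> ('v set \<Rightarrow> 'a) \<Rightarrow> 'v set \<Rightarrow> 'b" where
  "cochain_map \<phi> p x = (\<lambda>\<sigma>\<in>cells p. \<phi> (nbhd \<sigma>) (x \<sigma>))"

lemma cochain_map_hom:
  assumes "sheaf_morphism X F G \<phi>"
  shows "cochain_map \<phi> p \<in> hom (cochains F p) (cochains G p)"
proof -
  have h: "\<phi> (nbhd \<sigma>) \<in> hom (stalk F \<sigma>) (stalk G \<sigma>)" if "\<sigma> \<in> cells p" for \<sigma>
    using sheaf_morphism_hom[OF assms cell_open[OF that]] .
  show ?thesis
  proof (rule homI)
    fix x assume x: "x \<in> carrier (cochains F p)"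
    then show "cochain_map \<phi> p x \<in> carrier (cochains G p)"
      using hom_carrier[OF h] by (auto simp: cochain_map_def cochains_def PiE_iff image_subset_iff)
    fix y assume y: "y \<in> carrier (cochains F p)"
    show "cochain_map \<phi> p (x \<otimes>\<^bsub>cochains F p\<^esub> y) = cochain_map \<phi> p x \<otimes>\<^bsub>cochains G p\<^esub> cochain_map \<phi> p y"
      using x y by (auto simp: cochain_map_def cochains_def PiE_iff hom_mult[OF h] intro!: restrict_ext)
  qed
qed

lemma cech_cochain_map:
  assumes F: "presheaf X F" and G: "presheaf X G" and \<phi>: "sheaf_morphism X F G \<phi>"
    and x: "x \<in> carrier (cochains F p)"
  shows "cochain_map \<phi> (Suc p) (cech F p x) = cech G p (cochain_map \<phi> p x)"
proof
  fix \<tau>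
  show "cochain_map \<phi> (Suc p) (cech F p x) \<tau> = cech G p (cochain_map \<phi> p x) \<tau>"
  proof (cases "\<tau> \<in> cells (Suc p)")
    case \<tau>: True
    let ?G = "stalk G \<tau>"
    interpret G: comm_group ?G by (rule cell_comm_group[OF G \<tau>])
    have mx: "cochain_map \<phi> p x \<in> carrier (cochains G p)"
      using cochain_map_hom[OF \<phi>] x by (auto simp: hom_def)
    have "\<phi> (nbhd \<tau>) (cech F p x \<tau>) = finprod ?G
        (\<lambda>v. \<phi> (nbhd \<tau>) (facet_restr F \<tau> v (x (\<tau> - {v}))) [^]\<^bsub>?G\<^esub> pos_sign \<tau> v) \<tau>"
      by (rule hom_cech[OF F \<tau> x G.comm_group_axioms sheaf_morphism_hom[OF \<phi> cell_open[OF \<tau>]]])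
    also have "\<dots> = finprod ?G (\<lambda>v. facet_restr G \<tau> v (cochain_map \<phi> p x (\<tau> - {v}))
        [^]\<^bsub>?G\<^esub> pos_sign \<tau> v) \<tau>"
    proof (rule G.finprod_cong'[OF refl])
      fix v assume v: "v \<in> \<tau>"
      have f: "\<tau> - {v} \<in> cells p" using cell_facet[OF \<tau> v] .
      then have "x (\<tau> - {v}) \<in> carrier (stalk F (\<tau> - {v}))"
        using x by (auto simp: cochains_def PiE_iff)
      then have "\<phi> (nbhd \<tau>) (facet_restr F \<tau> v (x (\<tau> - {v}))) =
          facet_restr G \<tau> v (cochain_map \<phi> p x (\<tau> - {v}))"
        using sheaf_morphism_natural[OF \<phi> cell_open[OF f] cell_open[OF \<tau>] nbhd_anti] f
        by (simp add: cochain_map_def Diff_subset)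
      then show "\<phi> (nbhd \<tau>) (facet_restr F \<tau> v (x (\<tau> - {v}))) [^]\<^bsub>?G\<^esub> pos_sign \<tau> v =
          facet_restr G \<tau> v (cochain_map \<phi> p x (\<tau> - {v})) [^]\<^bsub>?G\<^esub> pos_sign \<tau> v"
        by simp
    qed (use cech_term_closed[OF G \<tau> mx] in auto)
    finally show ?thesis using \<tau> by (simp add: cech_def[of G] cochain_map_def)
  qed (simp add: cech_def cochain_map_def)
qed

section \<open>The Godement sheaf and the embedding by germs\<close>

definition supp :: "'p set \<Rightarrow> 'v set set" where
  "supp U = {\<sigma> \<in> \<Delta> - {{}}. pt \<sigma> \<in> U}"

lemma supp_nbhd: "\<sigma> \<noteq> {} \<Longrightarrow> supp (nbhd \<sigma>) = {\<rho> \<in> \<Delta>. \<sigma> \<subseteq> \<rho>}"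
  unfolding supp_def using pt_in_nbhd_iff by blast

lemma supp_mono: "W \<subseteq> U \<Longrightarrow> supp W \<subseteq> supp U"
  by (auto simp: supp_def)

lemma suppD: "\<sigma> \<in> supp U \<Longrightarrow> \<sigma> \<in> \<Delta> \<and> \<sigma> \<noteq> {} \<and> openin X (nbhd \<sigma>)"
  by (simp add: supp_def openin_nbhd)

lemma supp_nbhd_subset: "\<sigma> \<in> supp U \<Longrightarrow> openin X U \<Longrightarrow> nbhd \<sigma> \<subseteq> U"
  using nbhd_min by (simp add: supp_def)

lemma open_eq_Union_nbhd:
  assumes "openin X U"
  shows "U = \<Union>(nbhd ` supp U)"
proof (intro equalityI subsetI)
  fix x assume "x \<in> U"
  then obtain \<sigma> where "\<sigma> \<in> \<Delta> - {{}}" "x = pt \<sigma>"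
    using openin_subset[OF assms] topspace_pt by blast
  then show "x \<in> \<Union>(nbhd ` supp U)" using \<open>x \<in> U\<close> pt_in_nbhd by (auto simp: supp_def)
next
  fix x assume "x \<in> \<Union>(nbhd ` supp U)"
  then show "x \<in> U" using supp_nbhd_subset[OF _ assms] by blast
qed

definition stalks :: "('p, 'b) group_presheaf \<Rightarrow> 'p set \<Rightarrow> ('v set \<Rightarrow> 'b) monoid" where
  "stalks F U = product_group (supp U) (\<lambda>\<sigma>. stalk F \<sigma>)"

text \<open>The Godement sheaf \<open>U \<mapsto> \<Prod>\<^bsub>x\<in>U\<^esub> F\<^sub>x\<close>, whose sections are coded in the type of those of \<open>F\<close>, as
  is required of the sheaves against which \<open>injective_sheaf\<close> tests.\<close>

definition godement ::
    "('v set set \<Rightarrow> ('v set \<Rightarrow> 'b) \<Rightarrow> 'b) \<Rightarrow> ('p, 'b) group_presheaf \<Rightarrow> ('p, 'b) group_presheaf" where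
  "godement e F =
     \<lparr>sections = (\<lambda>U. image_group (e (supp U)) (stalks F U)),
      restr = (\<lambda>U W b. e (supp W) (restrict (inv_into (carrier (stalks F U)) (e (supp U)) b) (supp W)))\<rparr>"

context
  fixes F :: "('p, 'b) group_presheaf" and e :: "'v set set \<Rightarrow> ('v set \<Rightarrow> 'b) \<Rightarrow> 'b"
  assumes F: "sheaf X F" and e: "S \<subseteq> \<Delta> - {{}} \<Longrightarrow> inj_on (e S) (extensional S)"
begin

lemma presheaf_F: "presheaf X F"
  using F by (simp add: sheaf_def)

definition decode :: "'p set \<Rightarrow> 'b \<Rightarrow> 'v set \<Rightarrow> 'b" where
  "decode U = inv_into (carrier (stalks F U)) (e (supp U))"

private abbreviation "encode U \<equiv> e (supp U)"

private abbreviation "G \<equiv> godement e F"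

lemma comm_group_stalks: "comm_group (stalks F U)"
  unfolding stalks_def
  by (rule comm_group_product_group) (simp add: suppD presheaf_comm_group[OF presheaf_F])

lemma inj_encode: "inj_on (encode U) (carrier (stalks F U))"
proof (rule inj_on_subset[OF e])
  show "supp U \<subseteq> \<Delta> - {{}}" by (auto simp: supp_def)
  show "carrier (stalks F U) \<subseteq> extensional (supp U)" by (auto simp: stalks_def PiE_iff)
qed

lemma decode_encode: "y \<in> carrier (stalks F U) \<Longrightarrow> decode U (encode U y) = y"
  unfolding decode_def by (rule inv_into_f_f[OF inj_encode])

lemma carrier_G: "carrier (sections G U) = encode U ` carrier (stalks F U)"
  by (simp add: godement_def image_group_def)

lemma decode_closed: "b \<in> carrier (sections G U) \<Longrightarrow> decode U b \<in> carrier (stalks F U)"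
  by (auto simp: carrier_G decode_encode)

lemma encode_decode: "b \<in> carrier (sections G U) \<Longrightarrow> encode U (decode U b) = b"
  by (auto simp: carrier_G decode_encode)

lemma encode_iso: "encode U \<in> iso (stalks F U) (sections G U)"
  using inj_imp_image_group_iso[OF inj_encode] by (simp add: godement_def)

lemma encode_hom: "encode U \<in> hom (stalks F U) (sections G U)"
  using encode_iso by (simp add: iso_def)

lemma comm_group_G: "comm_group (sections G U)"
proof (rule comm_group.iso_imp_comm_group[OF comm_group_stalks])
  show "stalks F U \<cong> sections G U" using encode_iso by (auto simp: is_iso_def)
  have "group (stalks F U)" using comm_group_stalks by (rule comm_group.axioms)
  then have "group (sections G U)"
    using group.inj_imp_image_group_is_group[OF _ inj_encode] by (simp add: godement_def)
  then show "Group.monoid (sections G U)" by (rule group.is_monoid)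
qed

lemma decode_hom: "decode U \<in> hom (sections G U) (stalks F U)"
proof -
  have "inv_into (carrier (stalks F U)) (encode U) \<in> iso (sections G U) (stalks F U)"
    by (rule group.iso_set_sym[OF _ encode_iso]) (rule comm_group.axioms(2)[OF comm_group_stalks])
  then show ?thesis by (simp add: decode_def iso_def)
qed

lemma restr_G: "restr G U W b = encode W (restrict (decode U b) (supp W))"
  by (simp add: godement_def decode_def)

lemma restrict_stalks_hom:
  assumes "W \<subseteq> U"
  shows "(\<lambda>y. restrict y (supp W)) \<in> hom (stalks F U) (stalks F W)"
  using supp_mono[OF assms] unfolding stalks_def
  by (intro homI) (auto simp: PiE_iff subset_iff intro!: restrict_ext)

lemma restrict_stalks_closed:
  "W \<subseteq> U \<Longrightarrow> y \<in> carrier (stalks F U) \<Longrightarrow> restrict y (supp W) \<in> carrier (stalks F W)"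
  using restrict_stalks_hom[of W U] by (auto simp: hom_def)

lemma decode_restr:
  "W \<subseteq> U \<Longrightarrow> b \<in> carrier (sections G U) \<Longrightarrow> decode W (restr G U W b) = restrict (decode U b) (supp W)"
  unfolding restr_G by (rule decode_encode[OF restrict_stalks_closed[OF _ decode_closed]])

lemma presheaf_G: "presheaf X G"
  unfolding presheaf_def
proof (intro conjI allI impI ballI)
  fix U W assume "openin X U \<and> openin X W \<and> W \<subseteq> U"
  then have WU: "W \<subseteq> U" by blast
  have "encode W \<circ> ((\<lambda>y. restrict y (supp W)) \<circ> decode U) \<in> hom (sections G U) (sections G W)"
    by (rule hom_compose[OF hom_compose[OF decode_hom restrict_stalks_hom[OF WU]] encode_hom])
  also have "encode W \<circ> ((\<lambda>y. restrict y (supp W)) \<circ> decode U) = restr G U W"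
    by (auto simp: restr_G)
  finally show "restr G U W \<in> hom (sections G U) (sections G W)" .
next
  fix U s assume s: "s \<in> carrier (sections G U)"
  have "restrict (decode U s) (supp U) = decode U s"
    using decode_closed[OF s] by (simp add: stalks_def PiE_restrict)
  then show "restr G U U s = s" using s by (simp add: restr_G encode_decode)
next
  fix U V W s
  assume o: "openin X U \<and> openin X V \<and> openin X W \<and> W \<subseteq> V \<and> V \<subseteq> U" and s: "s \<in> carrier (sections G U)"
  then have "V \<subseteq> U" and V: "supp V \<inter> supp W = supp W" using supp_mono[of W V] by auto
  have "decode V (restr G U V s) = restrict (decode U s) (supp V)"
    by (rule decode_restr[OF \<open>V \<subseteq> U\<close> s])
  then show "restr G V W (restr G U V s) = restr G U W s"
    unfolding restr_G[of V W] restr_G[of U W] by (simp add: V)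
qed (rule comm_group_G)

lemma sheaf_G: "sheaf X G"
  unfolding sheaf_def
proof (intro conjI allI impI presheaf_G)
  fix \<U> :: "'p set set" and s
  assume "(\<forall>U\<in>\<U>. openin X U \<and> s U \<in> carrier (sections G U)) \<and>
    (\<forall>U\<in>\<U>. \<forall>W\<in>\<U>. restr G U (U \<inter> W) (s U) = restr G W (U \<inter> W) (s W))"
  then have s: "\<And>U. U \<in> \<U> \<Longrightarrow> s U \<in> carrier (sections G U)"
    and compat: "\<And>U W. U \<in> \<U> \<Longrightarrow> W \<in> \<U> \<Longrightarrow> restr G U (U \<inter> W) (s U) = restr G W (U \<inter> W) (s W)"
    by blast+
  have agree: "decode U (s U) \<sigma> = decode W (s W) \<sigma>"
    if UW: "U \<in> \<U>" "W \<in> \<U>" and \<sigma>: "\<sigma> \<in> supp U" "\<sigma> \<in> supp W" for U W \<sigma>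
  proof -
    have "restrict (decode U (s U)) (supp (U \<inter> W)) = restrict (decode W (s W)) (supp (U \<inter> W))"
      using decode_restr[OF Int_lower1 s[OF UW(1)], of W] decode_restr[OF Int_lower2 s[OF UW(2)], of U]
        compat[OF UW] by simp
    moreover have "\<sigma> \<in> supp (U \<inter> W)" using \<sigma> by (simp add: supp_def)
    ultimately show ?thesis by (metis restrict_apply')
  qed
  \<comment> \<open>Sections are families with no condition linking different points, so gluing is
    done point by point: any member of the cover containing the point supplies the component, and
    \<open>agree\<close> shows that the choice is immaterial.\<close>
  define y where "y = (\<lambda>\<sigma>\<in>supp (\<Union>\<U>). decode (SOME U. U \<in> \<U> \<and> pt \<sigma> \<in> U) (s (SOME U. U \<in> \<U> \<and> pt \<sigma> \<in> U)) \<sigma>)"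
  have y_eq: "y \<sigma> = decode U (s U) \<sigma>" if U: "U \<in> \<U>" "\<sigma> \<in> supp U" for U \<sigma>
  proof -
    have "\<exists>U. U \<in> \<U> \<and> pt \<sigma> \<in> U" using U by (auto simp: supp_def)
    then have V: "(SOME U. U \<in> \<U> \<and> pt \<sigma> \<in> U) \<in> \<U> \<and> pt \<sigma> \<in> (SOME U. U \<in> \<U> \<and> pt \<sigma> \<in> U)"
      by (rule someI_ex)
    then have "\<sigma> \<in> supp (SOME U. U \<in> \<U> \<and> pt \<sigma> \<in> U)" using U by (simp add: supp_def)
    from agree[OF conjunct1[OF V] U(1) this U(2)]
    show ?thesis using U by (auto simp: y_def supp_def)
  qed
  have y: "y \<in> carrier (stalks F (\<Union>\<U>))"
    unfolding stalks_def carrier_product_group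
  proof (rule PiE_I)
    fix \<sigma> assume "\<sigma> \<in> supp (\<Union>\<U>)"
    then obtain U where U: "U \<in> \<U>" "\<sigma> \<in> supp U" by (auto simp: supp_def)
    then show "y \<sigma> \<in> carrier (stalk F \<sigma>)"
      using decode_closed[OF s[OF U(1)]] by (auto simp: y_eq[OF U] stalks_def PiE_iff)
  qed (simp add: y_def)
  have ext: "decode U (s U) \<in> extensional (supp U)" if "U \<in> \<U>" for U
    using decode_closed[OF s[OF that]] by (auto simp: stalks_def PiE_iff)
  show "\<exists>!t. t \<in> carrier (sections G (\<Union>\<U>)) \<and> (\<forall>U\<in>\<U>. restr G (\<Union>\<U>) U t = s U)"
  proof (rule ex1I[of _ "encode (\<Union>\<U>) y"], intro conjI ballI)
    show "encode (\<Union>\<U>) y \<in> carrier (sections G (\<Union>\<U>))" using y by (simp add: carrier_G)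
    fix U assume U: "U \<in> \<U>"
    have "restrict y (supp U) = decode U (s U)"
      using ext[OF U] y_eq[OF U] by (intro extensionalityI[of _ "supp U"]) auto
    then show "restr G (\<Union>\<U>) U (encode (\<Union>\<U>) y) = s U"
      using s[OF U] by (simp add: restr_G decode_encode[OF y] encode_decode)
  next
    fix t assume t: "t \<in> carrier (sections G (\<Union>\<U>)) \<and> (\<forall>U\<in>\<U>. restr G (\<Union>\<U>) U t = s U)"
    have "decode (\<Union>\<U>) t = y"
    proof (rule extensionalityI[of _ "supp (\<Union>\<U>)"])
      show "decode (\<Union>\<U>) t \<in> extensional (supp (\<Union>\<U>))"
        using decode_closed t by (auto simp: stalks_def PiE_iff)
      fix \<sigma> assume "\<sigma> \<in> supp (\<Union>\<U>)"
      then obtain U where U: "U \<in> \<U>" "\<sigma> \<in> supp U" by (auto simp: supp_def)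
      have "decode U (s U) = restrict (decode (\<Union>\<U>) t) (supp U)"
        using decode_restr[of U "\<Union>\<U>" t] t U by auto
      then show "decode (\<Union>\<U>) t \<sigma> = y \<sigma>" using U by (simp add: y_eq)
    qed (simp add: y_def)
    then show "t = encode (\<Union>\<U>) y" using encode_decode t by metis
  qed
qed

text \<open>The germ at the point of \<open>\<sigma>\<close> is a plain restriction because the
  direct limit over its neighbourhoods is attained at the smallest one.\<close>

definition germs :: "'p set \<Rightarrow> 'b \<Rightarrow> 'b" where
  "germs U s = encode U (\<lambda>\<sigma>\<in>supp U. restr F U (nbhd \<sigma>) s)"

lemma germs_closed:
  assumes U: "openin X U" and s: "s \<in> carrier (sections F U)"
  shows "(\<lambda>\<sigma>\<in>supp U. restr F U (nbhd \<sigma>) s) \<in> carrier (stalks F U)"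
  using presheaf_closed[OF presheaf_F U _ supp_nbhd_subset[OF _ U] s] suppD
  by (simp add: stalks_def)

lemma decode_germs:
  "openin X U \<Longrightarrow> s \<in> carrier (sections F U) \<Longrightarrow> decode U (germs U s) = (\<lambda>\<sigma>\<in>supp U. restr F U (nbhd \<sigma>) s)"
  unfolding germs_def by (rule decode_encode[OF germs_closed])

lemma germs_mono: "sheaf_mono X F G germs"
  unfolding sheaf_mono_def sheaf_morphism_def
proof (intro conjI allI impI ballI)
  fix U assume U: "openin X U"
  have "(\<lambda>s. \<lambda>\<sigma>\<in>supp U. restr F U (nbhd \<sigma>) s) \<in> hom (sections F U) (stalks F U)"
  proof (rule homI)
    fix s t assume st: "s \<in> carrier (sections F U)" "t \<in> carrier (sections F U)"
    show "(\<lambda>\<sigma>\<in>supp U. restr F U (nbhd \<sigma>) (s \<otimes>\<^bsub>sections F U\<^esub> t)) =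
        (\<lambda>\<sigma>\<in>supp U. restr F U (nbhd \<sigma>) s) \<otimes>\<^bsub>stalks F U\<^esub> (\<lambda>\<sigma>\<in>supp U. restr F U (nbhd \<sigma>) t)"
    proof -
      have "restr F U (nbhd \<sigma>) (s \<otimes>\<^bsub>sections F U\<^esub> t) =
          restr F U (nbhd \<sigma>) s \<otimes>\<^bsub>stalk F \<sigma>\<^esub> restr F U (nbhd \<sigma>) t" if "\<sigma> \<in> supp U" for \<sigma>
        using hom_mult[OF presheaf_hom[OF presheaf_F U _ supp_nbhd_subset[OF that U]] st] suppD[OF that]
        by blast
      then show ?thesis by (simp add: stalks_def cong: restrict_cong)
    qed
  qed (rule germs_closed[OF U])
  from hom_compose[OF this encode_hom] show "germs U \<in> hom (sections F U) (sections G U)"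
    by (simp add: comp_def germs_def[abs_def])
  show "inj_on (germs U) (carrier (sections F U))"
  proof (rule inj_onI)
    fix s t assume st: "s \<in> carrier (sections F U)" "t \<in> carrier (sections F U)" and eq: "germs U s = germs U t"
    have *: "restr F U (nbhd \<sigma>) s = restr F U (nbhd \<sigma>) t" if "\<sigma> \<in> supp U" for \<sigma>
    proof -
      have "(\<lambda>\<sigma>\<in>supp U. restr F U (nbhd \<sigma>) s) = (\<lambda>\<sigma>\<in>supp U. restr F U (nbhd \<sigma>) t)"
        using decode_germs[OF U st(1)] decode_germs[OF U st(2)] eq by simp
      from fun_cong[OF this, of \<sigma>] that show ?thesis by simp
    qed
    \<comment> \<open>Injectivity is separatedness of \<open>F\<close> for the cover of
      \<open>U\<close> by the smallest neighbourhoods of its points.\<close>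
    have UU: "\<Union>(nbhd ` supp U) = U" by (rule open_eq_Union_nbhd[OF U, symmetric])
    show "s = t"
    proof (rule sheaf_separated[OF F, of "nbhd ` supp U", unfolded UU])
      show "openin X W" if "W \<in> nbhd ` supp U" for W using that suppD by blast
      show "restr F U W s = restr F U W t" if "W \<in> nbhd ` supp U" for W using that * by blast
    qed (use st in auto)
  qed
next
  fix U W s assume "openin X U \<and> openin X W \<and> W \<subseteq> U" and s: "s \<in> carrier (sections F U)"
  then have U: "openin X U" and W: "openin X W" and WU: "W \<subseteq> U" by blast+
  have "(\<lambda>\<sigma>\<in>supp U. restr F U (nbhd \<sigma>) s) \<sigma> = restr F W (nbhd \<sigma>) (restr F U W s)" if "\<sigma> \<in> supp W" for \<sigma>
    using presheaf_trans[OF presheaf_F U W _ supp_nbhd_subset[OF that W] WU s] suppD[OF that]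
      supp_mono[OF WU] that by auto
  then have "restrict (\<lambda>\<sigma>\<in>supp U. restr F U (nbhd \<sigma>) s) (supp W) = (\<lambda>\<sigma>\<in>supp W. restr F W (nbhd \<sigma>) (restr F U W s))"
    by (rule restrict_ext)
  then show "restr G U W (germs U s) = germs W (restr F U W s)"
    unfolding restr_G decode_germs[OF U s] by (simp add: germs_def)
qed

end

section \<open>Contraction of the Cech complex at each point\<close>

context
  fixes F :: "('p, 'b) group_presheaf" and e :: "'v set set \<Rightarrow> ('v set \<Rightarrow> 'b) \<Rightarrow> 'b"
  assumes F: "sheaf X F" and e: "S \<subseteq> \<Delta> - {{}} \<Longrightarrow> inj_on (e S) (extensional S)"
begin

text \<open>At the point of a face \<open>\<rho>\<close> the Cech complex of the Godement sheaf is the cochain complex of the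
  simplex \<open>\<rho>\<close>, which is contracted by adding the vertex \<open>Min \<rho>\<close>.\<close>

lemma cech_godement_exact:
  assumes c: "c \<in> carrier (cochains F (Suc p))"
    and cc: "cech F (Suc p) c = \<one>\<^bsub>cochains F (Suc (Suc p))\<^esub>"
  shows "\<exists>w\<in>carrier (cochains (godement e F) p).
    cech (godement e F) p w = cochain_map (germs F e) (Suc p) c"
proof -
  note FE = F e
  have pF: "presheaf X F" using F by (simp add: sheaf_def)
  let ?G = "godement e F"
  \<comment> \<open>The cone vertex is the minimum of \<open>\<rho>\<close> so that it always enters
    with sign 1. It changes with \<open>\<rho>\<close>, so the components are in general
    incompatible under restriction; therefore \<open>w\<close> is a cochain of the Godement sheaf
    and not of \<open>F\<close>.\<close>
  define y where "y \<sigma> \<rho> = (if Min \<rho> \<in> \<sigma> then \<one>\<^bsub>stalk F \<rho>\<^esub>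
    else restr F (nbhd (insert (Min \<rho>) \<sigma>)) (nbhd \<rho>) (c (insert (Min \<rho>) \<sigma>)))" for \<sigma> \<rho>
  define w where "w = (\<lambda>\<sigma>\<in>cells p. e (supp (nbhd \<sigma>)) (\<lambda>\<rho>\<in>supp (nbhd \<sigma>). y \<sigma> \<rho>))"
  have c_closed: "restr F (nbhd \<kappa>) (nbhd \<rho>) (c \<kappa>) \<in> carrier (stalk F \<rho>)"
    if "\<kappa> \<in> cells (Suc p)" "\<rho> \<in> \<Delta>" "\<kappa> \<subseteq> \<rho>" for \<kappa> \<rho>
  proof (rule presheaf_closed[OF pF cell_open[OF that(1)] _ nbhd_anti[OF that(3)]])
    show "openin X (nbhd \<rho>)" using cellD[OF that(1)] that by (intro openin_nbhd) auto
    show "c \<kappa> \<in> carrier (stalk F \<kappa>)"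
      using c that(1) by (auto simp: cochains_def PiE_iff)
  qed
  have grp: "comm_group (stalk F \<rho>)" if "\<rho> \<in> \<Delta>" "\<rho> \<noteq> {}" for \<rho>
    by (rule presheaf_comm_group[OF pF openin_nbhd[OF that]])
  have insert_cell: "insert v \<sigma> \<in> cells (Suc q)" if "\<sigma> \<in> cells q" "v \<notin> \<sigma>" "insert v \<sigma> \<subseteq> \<rho>" "\<rho> \<in> \<Delta>" for v \<sigma> \<rho> q
    using that face_mono[OF that(4,3)] cellD[OF that(1)] by (simp add: cells_def)
  have y_closed: "y \<sigma> \<rho> \<in> carrier (stalk F \<rho>)" if \<sigma>: "\<sigma> \<in> cells p" and \<rho>: "\<rho> \<in> \<Delta>" "\<sigma> \<subseteq> \<rho>" for \<sigma> \<rho>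
  proof -
    have ne: "\<rho> \<noteq> {}" using cellD[OF \<sigma>] \<rho> by auto
    interpret H: comm_group "stalk F \<rho>" by (rule grp[OF \<rho>(1) ne])
    have "Min \<rho> \<in> \<rho>" using finite_face[OF \<rho>(1)] ne by (rule Min_in)
    then have sub: "insert (Min \<rho>) \<sigma> \<subseteq> \<rho>" using \<rho> by auto
    show ?thesis
    proof (cases "Min \<rho> \<in> \<sigma>")
      case False
      then show ?thesis unfolding y_def
        using c_closed[OF insert_cell[OF \<sigma> False sub \<rho>(1)] \<rho>(1) sub] by simp
    qed (simp add: y_def)
  qed
  have supp: "supp (nbhd \<sigma>) = {\<rho> \<in> \<Delta>. \<sigma> \<subseteq> \<rho>}" if "\<sigma> \<in> cells q" for \<sigma> q
    using supp_nbhd cellD[OF that] by blast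
  have y_stalks: "(\<lambda>\<rho>\<in>supp (nbhd \<sigma>). y \<sigma> \<rho>) \<in> carrier (stalks F (nbhd \<sigma>))" if "\<sigma> \<in> cells p" for \<sigma>
    unfolding stalks_def carrier_product_group supp[OF that]
    by (rule restrict_PiE_iff[THEN iffD2]) (use y_closed[OF that] in blast)
  have w: "w \<in> carrier (cochains ?G p)"
    unfolding cochains_def carrier_product_group w_def
    by (rule restrict_PiE_iff[THEN iffD2]) (use y_stalks in \<open>simp add: carrier_G[OF FE]\<close>)
  have decode_w: "decode F e (nbhd \<sigma>) (w \<sigma>) = (\<lambda>\<rho>\<in>supp (nbhd \<sigma>). y \<sigma> \<rho>)" if "\<sigma> \<in> cells p" for \<sigma>
    using decode_encode[OF FE y_stalks[OF that]] that by (simp add: w_def)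
  have main: "decode F e (nbhd \<tau>) (cech ?G p w \<tau>) \<rho> = restr F (nbhd \<tau>) (nbhd \<rho>) (c \<tau>)"
    if \<tau>: "\<tau> \<in> cells (Suc p)" and \<rho>: "\<rho> \<in> \<Delta>" "\<tau> \<subseteq> \<rho>" for \<tau> \<rho>
  proof -
    have ne: "\<rho> \<noteq> {}" using cellD[OF \<tau>] \<rho> by auto
    let ?H = "stalk F \<rho>"
    interpret H: comm_group ?H by (rule grp[OF \<rho>(1) ne])
    define m where "m = Min \<rho>"
    have m: "m \<in> \<rho>" "\<forall>v\<in>\<rho>. m \<le> v" unfolding m_def using finite_face[OF \<rho>(1)] ne by auto
    have fin: "finite \<tau>" using cellD[OF \<tau>] by blast
    have \<rho>_supp: "\<rho> \<in> supp (nbhd \<tau>)" using \<rho> by (simp add: supp[OF \<tau>])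
    have ev: "(\<lambda>b. decode F e (nbhd \<tau>) b \<rho>) \<in> hom (stalk ?G \<tau>) ?H"
    proof -
      have "(\<lambda>y. y \<rho>) \<in> hom (stalks F (nbhd \<tau>)) ?H"
        using \<rho>_supp by (auto simp: hom_def stalks_def)
      from hom_compose[OF decode_hom[OF FE] this] show ?thesis by (simp add: comp_def)
    qed
    have "decode F e (nbhd \<tau>) (cech ?G p w \<tau>) \<rho> = finprod ?H
        (\<lambda>v. decode F e (nbhd \<tau>) (facet_restr ?G \<tau> v (w (\<tau> - {v}))) \<rho> [^]\<^bsub>?H\<^esub> pos_sign \<tau> v) \<tau>"
      by (rule hom_cech[OF presheaf_G[OF FE] \<tau> w H.comm_group_axioms ev])
    also have "\<dots> = finprod ?H (\<lambda>v. y (\<tau> - {v}) \<rho> [^]\<^bsub>?H\<^esub> pos_sign \<tau> v) \<tau>"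
    proof (rule H.finprod_cong'[OF refl])
      have f: "\<tau> - {v} \<in> cells p" "\<tau> - {v} \<subseteq> \<rho>" if "v \<in> \<tau>" for v
        using cell_facet[OF \<tau> that] \<rho> by auto
      show "(\<lambda>v. y (\<tau> - {v}) \<rho> [^]\<^bsub>?H\<^esub> pos_sign \<tau> v) \<in> \<tau> \<rightarrow> carrier ?H"
        using y_closed[OF f(1) \<rho>(1) f(2)] by simp
      fix v assume v: "v \<in> \<tau>"
      have wv: "w (\<tau> - {v}) \<in> carrier (stalk ?G (\<tau> - {v}))"
        using w f(1)[OF v] by (auto simp: cochains_def PiE_iff)
      have dr: "decode F e (nbhd \<tau>) (facet_restr ?G \<tau> v (w (\<tau> - {v}))) =
          restrict (decode F e (nbhd (\<tau> - {v})) (w (\<tau> - {v}))) (supp (nbhd \<tau>))"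
        using nbhd_anti[of "\<tau> - {v}" \<tau>] by (intro decode_restr[OF FE _ wv]) auto
      have "restrict (decode F e (nbhd (\<tau> - {v})) (w (\<tau> - {v}))) (supp (nbhd \<tau>)) \<rho> = y (\<tau> - {v}) \<rho>"
        using \<rho>_supp \<rho> f[OF v] by (simp add: decode_w[OF f(1)[OF v]] supp[OF f(1)[OF v]])
      then show "decode F e (nbhd \<tau>) (facet_restr ?G \<tau> v (w (\<tau> - {v}))) \<rho> [^]\<^bsub>?H\<^esub> pos_sign \<tau> v =
          y (\<tau> - {v}) \<rho> [^]\<^bsub>?H\<^esub> pos_sign \<tau> v" by (simp only: dr)
    qed
    also have "\<dots> = restr F (nbhd \<tau>) (nbhd \<rho>) (c \<tau>)"
    proof (cases "m \<in> \<tau>")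
      \<comment> \<open>Only \<open>v = m\<close> contributes: every other facet of
        \<open>\<tau>\<close> still contains \<open>m\<close>, and there \<open>y\<close> is
        trivial.\<close>
      case True
      let ?t = "restr F (nbhd \<tau>) (nbhd \<rho>) (c \<tau>)"
      have t: "?t \<in> carrier ?H" by (rule c_closed[OF \<tau> \<rho>])
      have "pos_sign \<tau> m = 1" using m \<rho> by (intro pos_sign_Min) blast
      then have "y (\<tau> - {v}) \<rho> [^]\<^bsub>?H\<^esub> pos_sign \<tau> v = (if m = v then ?t else \<one>\<^bsub>?H\<^esub>)" if "v \<in> \<tau>" for v
        using t True that by (auto simp: y_def m_def[symmetric] insert_absorb)
      then have "finprod ?H (\<lambda>v. y (\<tau> - {v}) \<rho> [^]\<^bsub>?H\<^esub> pos_sign \<tau> v) \<tau> =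
          finprod ?H (\<lambda>v. if m = v then ?t else \<one>\<^bsub>?H\<^esub>) \<tau>"
        using t by (intro H.finprod_cong') auto
      also have "\<dots> = ?t" using t by (intro H.finprod_singleton[OF True fin]) auto
      finally show ?thesis .
    next
      \<comment> \<open>The cocycle condition on \<open>\<kappa>\<close>, which is
        \<open>\<tau>\<close> with \<open>m\<close> adjoined, expresses the value at its facet
        \<open>\<tau>\<close> by the values at the other facets. Their signs are opposite to those
        in \<open>\<tau>\<close> because \<open>m\<close> precedes every vertex of
        \<open>\<tau>\<close>.\<close>
      case False
      define \<kappa> where "\<kappa> = insert m \<tau>"
      have sub: "insert m \<tau> \<subseteq> \<rho>" using m \<rho> by auto
      have \<kappa>: "\<kappa> \<in> cells (Suc (Suc p))" unfolding \<kappa>_def by (rule insert_cell[OF \<tau> False sub \<rho>(1)])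
      define r where "r v = restr F (nbhd (\<kappa> - {v})) (nbhd \<rho>) (c (\<kappa> - {v}))" for v
      have r: "r v \<in> carrier ?H" if "v \<in> \<kappa>" for v
        unfolding r_def using cell_facet[OF \<kappa> that] sub \<rho> by (intro c_closed) (auto simp: \<kappa>_def)
      have r\<tau>: "r v \<in> carrier ?H" if "v \<in> \<tau>" for v using r[of v] that by (simp add: \<kappa>_def)
      have m_less: "m < v" if "v \<in> \<tau>" for v
        using m(2) \<rho>(2) that False by (metis order_le_less subsetD)
      have hm: "restr F (nbhd \<kappa>) (nbhd \<rho>) \<in> hom (stalk F \<kappa>) ?H"
        by (rule presheaf_hom[OF pF cell_open[OF \<kappa>] openin_nbhd[OF \<rho>(1) ne] nbhd_anti])
          (use sub in \<open>simp add: \<kappa>_def\<close>)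
      interpret hm: group_hom "stalk F \<kappa>" ?H "restr F (nbhd \<kappa>) (nbhd \<rho>)"
        using hm cell_group[OF pF \<kappa>] H.group_axioms by (simp add: group_hom_def group_hom_axioms_def)
      have "\<one>\<^bsub>?H\<^esub> = restr F (nbhd \<kappa>) (nbhd \<rho>) (cech F (Suc p) c \<kappa>)"
        using \<kappa> by (simp add: cc cochains_def)
      also have "\<dots> = finprod ?H (\<lambda>v. restr F (nbhd \<kappa>) (nbhd \<rho>)
          (facet_restr F \<kappa> v (c (\<kappa> - {v}))) [^]\<^bsub>?H\<^esub> pos_sign \<kappa> v) \<kappa>"
        by (rule hom_cech[OF pF \<kappa> c H.comm_group_axioms hm])
      also have "\<dots> = finprod ?H (\<lambda>v. r v [^]\<^bsub>?H\<^esub> pos_sign \<kappa> v) \<kappa>"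
      proof (rule H.finprod_cong'[OF refl])
        fix v assume v: "v \<in> \<kappa>"
        have f: "\<kappa> - {v} \<in> cells (Suc p)" by (rule cell_facet[OF \<kappa> v])
        have "restr F (nbhd \<kappa>) (nbhd \<rho>) (facet_restr F \<kappa> v (c (\<kappa> - {v}))) = r v"
          unfolding r_def
          by (rule presheaf_trans[OF pF cell_open[OF f] cell_open[OF \<kappa>] openin_nbhd[OF \<rho>(1) ne] nbhd_anti nbhd_anti])
            (use sub c f in \<open>auto simp: \<kappa>_def cochains_def PiE_iff\<close>)
        then show "restr F (nbhd \<kappa>) (nbhd \<rho>)
          (facet_restr F \<kappa> v (c (\<kappa> - {v}))) [^]\<^bsub>?H\<^esub> pos_sign \<kappa> v = r v [^]\<^bsub>?H\<^esub> pos_sign \<kappa> v" by simp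
      qed (use r in simp)
      also have "\<dots> = r m [^]\<^bsub>?H\<^esub> pos_sign \<kappa> m \<otimes>\<^bsub>?H\<^esub> finprod ?H (\<lambda>v. r v [^]\<^bsub>?H\<^esub> pos_sign \<kappa> v) \<tau>"
        unfolding \<kappa>_def by (rule H.finprod_insert[OF fin False]) (use r in \<open>auto simp: \<kappa>_def\<close>)
      also have "pos_sign \<kappa> m = 1" using m(2) sub by (intro pos_sign_Min) (auto simp: \<kappa>_def)
      also have "finprod ?H (\<lambda>v. r v [^]\<^bsub>?H\<^esub> pos_sign \<kappa> v) \<tau> = finprod ?H (\<lambda>v. r v [^]\<^bsub>?H\<^esub> (- pos_sign \<tau> v)) \<tau>"
        by (rule H.finprod_cong'[OF refl])
          (use r\<tau> in \<open>auto simp: \<kappa>_def pos_sign_insert_less[OF fin False m_less]\<close>)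
      finally have 1: "\<one>\<^bsub>?H\<^esub> = r m \<otimes>\<^bsub>?H\<^esub> finprod ?H (\<lambda>v. r v [^]\<^bsub>?H\<^esub> (- pos_sign \<tau> v)) \<tau>"
        using r[of m] by (simp add: \<kappa>_def)
      have "finprod ?H (\<lambda>v. r v [^]\<^bsub>?H\<^esub> pos_sign \<tau> v) \<tau> \<otimes>\<^bsub>?H\<^esub> finprod ?H (\<lambda>v. r v [^]\<^bsub>?H\<^esub> (- pos_sign \<tau> v)) \<tau>
        = finprod ?H (\<lambda>v. r v [^]\<^bsub>?H\<^esub> pos_sign \<tau> v \<otimes>\<^bsub>?H\<^esub> r v [^]\<^bsub>?H\<^esub> (- pos_sign \<tau> v)) \<tau>"
        using r\<tau> by (intro H.finprod_multf[symmetric]) auto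
      also have "\<dots> = \<one>\<^bsub>?H\<^esub>"
        by (rule H.finprod_one_eqI) (rule H.int_pow_uminus_cancel[OF r\<tau>])
      also note 1
      finally have "finprod ?H (\<lambda>v. r v [^]\<^bsub>?H\<^esub> pos_sign \<tau> v) \<tau> = r m"
        using r[of m] r\<tau> by (subst (asm) H.right_cancel) (auto simp: \<kappa>_def intro!: H.finprod_closed)
      also have "r m = restr F (nbhd \<tau>) (nbhd \<rho>) (c \<tau>)"
        using False by (simp add: r_def \<kappa>_def)
      finally have "finprod ?H (\<lambda>v. r v [^]\<^bsub>?H\<^esub> pos_sign \<tau> v) \<tau> = restr F (nbhd \<tau>) (nbhd \<rho>) (c \<tau>)" .
      moreover have "y (\<tau> - {v}) \<rho> = r v" if v: "v \<in> \<tau>" for v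
      proof -
        have "insert m (\<tau> - {v}) = \<kappa> - {v}" using False v by (auto simp: \<kappa>_def)
        then show ?thesis using False by (simp add: y_def r_def m_def[symmetric])
      qed
      then have "finprod ?H (\<lambda>v. y (\<tau> - {v}) \<rho> [^]\<^bsub>?H\<^esub> pos_sign \<tau> v) \<tau> =
          finprod ?H (\<lambda>v. r v [^]\<^bsub>?H\<^esub> pos_sign \<tau> v) \<tau>"
        using r\<tau> by (intro H.finprod_cong') auto
      ultimately show ?thesis by simp
    qed
    finally show ?thesis .
  qed
  have "cech ?G p w = cochain_map (germs F e) (Suc p) c"
  proof
    fix \<tau> show "cech ?G p w \<tau> = cochain_map (germs F e) (Suc p) c \<tau>"
    proof (cases "\<tau> \<in> cells (Suc p)")
      case \<tau>: True
      have cw: "cech ?G p w \<tau> \<in> carrier (stalk ?G \<tau>)"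
        using hom_in_carrier[OF cech_hom[OF presheaf_G[OF FE]] w] \<tau> by (auto simp: cochains_def PiE_iff)
      have "decode F e (nbhd \<tau>) (cech ?G p w \<tau>) = (\<lambda>\<rho>\<in>supp (nbhd \<tau>). restr F (nbhd \<tau>) (nbhd \<rho>) (c \<tau>))"
      proof (rule extensionalityI[of _ "supp (nbhd \<tau>)"])
        show "decode F e (nbhd \<tau>) (cech ?G p w \<tau>) \<in> extensional (supp (nbhd \<tau>))"
          using decode_closed[OF FE cw] by (auto simp: stalks_def PiE_iff)
      qed (use main[OF \<tau>] in \<open>simp_all add: supp[OF \<tau>]\<close>)
      then have "cech ?G p w \<tau> = germs F e (nbhd \<tau>) (c \<tau>)"
        using encode_decode[OF FE cw] by (simp add: germs_def[OF FE])
      then show ?thesis using \<tau> by (simp add: cochain_map_def)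
    qed (simp add: cech_def cochain_map_def)
  qed
  then show ?thesis using w by blast
qed

end

section \<open>Acyclicity of injective sheaves\<close>

text \<open>Injectivity extends the identity of \<open>I\<close> along the embedding by germs to a
  retraction \<open>\<beta>\<close> of the Godement sheaf. A cocycle of \<open>I\<close> becomes a
  coboundary in the Godement sheaf, and \<open>\<beta>\<close> carries the primitive back to
  \<open>I\<close>.\<close>

lemma cech_injective_exact:
  fixes I :: "('p, 'b) group_presheaf"
  assumes I: "injective_sheaf X I" and inf: "topspace X = {} \<or> infinite (UNIV :: 'b set)"
  shows "kernel (cochains I (Suc p)) (cochains I (Suc (Suc p))) (cech I (Suc p)) =
    cech I p ` carrier (cochains I p)"
proof
  have shI: "sheaf X I" using I by (simp add: injective_sheaf_def)
  then have pI: "presheaf X I" by (simp add: sheaf_def)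
  show "cech I p ` carrier (cochains I p) \<subseteq> kernel (cochains I (Suc p)) (cochains I (Suc (Suc p))) (cech I (Suc p))"
    using cech_cech[OF pI] hom_in_carrier[OF cech_hom[OF pI]] by (auto simp: kernel_def)
  show "kernel (cochains I (Suc p)) (cochains I (Suc (Suc p))) (cech I (Suc p)) \<subseteq> cech I p ` carrier (cochains I p)"
  proof
    fix c assume "c \<in> kernel (cochains I (Suc p)) (cochains I (Suc (Suc p))) (cech I (Suc p))"
    then have c: "c \<in> carrier (cochains I (Suc p))" "cech I (Suc p) c = \<one>\<^bsub>cochains I (Suc (Suc p))\<^esub>"
      by (auto simp: kernel_def)
    \<comment> \<open>Supports are finite sets of nonempty faces, and over an empty space only the
      empty support occurs; the coding lemma applies in either case.\<close>
    have "\<exists>e :: ('v set \<Rightarrow> 'b) \<Rightarrow> 'b. inj_on e (extensional S)" if S: "S \<subseteq> \<Delta> - {{}}" for S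
    proof (rule infinite_inj_on_extensional)
      show "finite S" using S finite_faces by (meson finite_Diff finite_subset)
      show "S = {} \<or> infinite (UNIV :: 'b set)" using inf S topspace_pt by auto
    qed
    then obtain e :: "'v set set \<Rightarrow> ('v set \<Rightarrow> 'b) \<Rightarrow> 'b"
      where e: "\<And>S. S \<subseteq> \<Delta> - {{}} \<Longrightarrow> inj_on (e S) (extensional S)" by metis
    let ?G = "godement e I"
    have mono: "sheaf_mono X I ?G (germs I e)" by (rule germs_mono[OF shI e])
    have shG: "sheaf X ?G" by (rule sheaf_G[OF shI e])
    have "sheaf_morphism X I I (\<lambda>_ s. s)" by (simp add: sheaf_morphism_def hom_def)
    then obtain \<beta> where \<beta>: "sheaf_morphism X ?G I \<beta>"
      and \<beta>_germs: "\<And>U s. openin X U \<Longrightarrow> s \<in> carrier (sections I U) \<Longrightarrow> \<beta> U (germs I e U s) = s"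
      using I[unfolded injective_sheaf_def, THEN conjunct2, rule_format, of I ?G "germs I e" "\<lambda>_ s. s"]
        shI shG mono by blast
    obtain w where w: "w \<in> carrier (cochains ?G p)" "cech ?G p w = cochain_map (germs I e) (Suc p) c"
      using cech_godement_exact[OF shI e c] by blast
    have pG: "presheaf X ?G" using shG by (simp add: sheaf_def)
    have "cech I p (cochain_map \<beta> p w) = cochain_map \<beta> (Suc p) (cochain_map (germs I e) (Suc p) c)"
      using cech_cochain_map[OF pG pI \<beta> w(1)] w(2) by simp
    also have "\<dots> = c"
    proof (rule extensionalityI[of _ "cells (Suc p)"])
      fix \<sigma> assume \<sigma>: "\<sigma> \<in> cells (Suc p)"
      then have "c \<sigma> \<in> carrier (stalk I \<sigma>)" using c(1) by (auto simp: cochains_def PiE_iff)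
      then show "cochain_map \<beta> (Suc p) (cochain_map (germs I e) (Suc p) c) \<sigma> = c \<sigma>"
        using \<sigma> \<beta>_germs[OF cell_open[OF \<sigma>]] by (simp add: cochain_map_def)
    qed (use c(1) in \<open>auto simp: cochain_map_def cochains_def PiE_iff\<close>)
    finally show "c \<in> cech I p ` carrier (cochains I p)"
      using hom_in_carrier[OF cochain_map_hom[OF \<beta>] w(1)] by (metis image_eqI)
  qed
qed

text \<open>A neighbourhood of \<open>pt \<sigma>\<close> inside \<open>nbhd \<sigma>\<close> is all
  of \<open>nbhd \<sigma>\<close>, so a section lying locally in the image lies in the
  image.\<close>

lemma exact_nbhd:
  assumes ex: "sheaf_exact X F \<phi> G \<psi> H" and G: "presheaf X G"
    and \<sigma>: "\<sigma> \<in> \<Delta>" "\<sigma> \<noteq> {}" and s: "s \<in> carrier (stalk G \<sigma>)"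
  shows "\<psi> (nbhd \<sigma>) s = \<one>\<^bsub>stalk H \<sigma>\<^esub> \<longleftrightarrow> s \<in> \<phi> (nbhd \<sigma>) ` carrier (stalk F \<sigma>)"
proof -
  have op: "openin X (nbhd \<sigma>)" by (rule openin_nbhd[OF \<sigma>])
  have id: "restr G (nbhd \<sigma>) (nbhd \<sigma>) s = s" by (rule presheaf_id[OF G op s])
  have "\<psi> (nbhd \<sigma>) s = \<one>\<^bsub>stalk H \<sigma>\<^esub> \<longleftrightarrow>
    (\<forall>x\<in>nbhd \<sigma>. \<exists>W. openin X W \<and> x \<in> W \<and> W \<subseteq> nbhd \<sigma> \<and>
      restr G (nbhd \<sigma>) W s \<in> \<phi> W ` carrier (sections F W))" (is "_ \<longleftrightarrow> ?loc")
    by (rule ex[unfolded sheaf_exact_def, THEN conjunct2, THEN conjunct2, THEN spec, THEN mp, THEN bspec, OF op s])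
  also have "?loc \<longleftrightarrow> s \<in> \<phi> (nbhd \<sigma>) ` carrier (stalk F \<sigma>)"
  proof
    assume loc: ?loc
    obtain W where W: "openin X W" "pt \<sigma> \<in> W" "W \<subseteq> nbhd \<sigma>"
      "restr G (nbhd \<sigma>) W s \<in> \<phi> W ` carrier (sections F W)"
      using bspec[OF loc pt_in_nbhd[OF \<sigma>(1)]] by (elim exE conjE) (rule that)
    moreover have "W = nbhd \<sigma>" using nbhd_min[OF \<sigma> W(1,2)] W(3) by blast
    ultimately show "s \<in> \<phi> (nbhd \<sigma>) ` carrier (stalk F \<sigma>)" using id by simp
  next
    assume "s \<in> \<phi> (nbhd \<sigma>) ` carrier (stalk F \<sigma>)"
    then show ?loc using op id by (intro ballI exI[of _ "nbhd \<sigma>"]) simp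
  qed
  finally show ?thesis .
qed

lemma cochain_map_exact:
  assumes ex: "sheaf_exact X F \<phi> G \<psi> H" and G: "presheaf X G"
  shows "kernel (cochains G p) (cochains H p) (cochain_map \<psi> p) = cochain_map \<phi> p ` carrier (cochains F p)"
proof (intro equalityI subsetI)
  have cell_exact: "\<psi> (nbhd \<sigma>) s = \<one>\<^bsub>stalk H \<sigma>\<^esub> \<longleftrightarrow> s \<in> \<phi> (nbhd \<sigma>) ` carrier (stalk F \<sigma>)"
    if "\<sigma> \<in> cells p" "s \<in> carrier (stalk G \<sigma>)" for \<sigma> s
    using exact_nbhd[OF ex G _ _ that(2)] cellD[OF that(1)] by blast
  have \<phi>: "sheaf_morphism X F G \<phi>" using ex by (simp add: sheaf_exact_def)
  {
    fix x assume "x \<in> kernel (cochains G p) (cochains H p) (cochain_map \<psi> p)"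
    then have x: "x \<in> carrier (cochains G p)" "cochain_map \<psi> p x = \<one>\<^bsub>cochains H p\<^esub>" by (auto simp: kernel_def)
    have "\<exists>t. t \<in> carrier (stalk F \<sigma>) \<and> x \<sigma> = \<phi> (nbhd \<sigma>) t" if \<sigma>: "\<sigma> \<in> cells p" for \<sigma>
    proof -
      have "x \<sigma> \<in> carrier (stalk G \<sigma>)" using x(1) \<sigma> by (auto simp: cochains_def PiE_iff)
      moreover have "\<psi> (nbhd \<sigma>) (x \<sigma>) = \<one>\<^bsub>stalk H \<sigma>\<^esub>"
        using fun_cong[OF x(2), of \<sigma>] \<sigma> by (simp add: cochain_map_def cochains_def)
      ultimately show ?thesis using cell_exact[OF \<sigma>] by blast
    qed
    then obtain t where t: "\<And>\<sigma>. \<sigma> \<in> cells p \<Longrightarrow> t \<sigma> \<in> carrier (stalk F \<sigma>) \<and> x \<sigma> = \<phi> (nbhd \<sigma>) (t \<sigma>)"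
      by metis
    have "restrict t (cells p) \<in> carrier (cochains F p)" using t by (simp add: cochains_def)
    moreover have "x = cochain_map \<phi> p (restrict t (cells p))"
      using x(1) t by (intro extensionalityI[of _ "cells p"]) (auto simp: cochain_map_def cochains_def PiE_iff)
    ultimately show "x \<in> cochain_map \<phi> p ` carrier (cochains F p)" by blast
  next
    fix x assume "x \<in> cochain_map \<phi> p ` carrier (cochains F p)"
    then obtain t where t: "t \<in> carrier (cochains F p)" "x = cochain_map \<phi> p t" by blast
    have xG: "x \<in> carrier (cochains G p)" using hom_in_carrier[OF cochain_map_hom[OF \<phi>] t(1)] t(2) by simp
    moreover have "cochain_map \<psi> p x = \<one>\<^bsub>cochains H p\<^esub>"
      unfolding cochain_map_def cochains_def one_product_group
    proof (rule restrict_ext)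
      fix \<sigma> assume \<sigma>: "\<sigma> \<in> cells p"
      have "x \<sigma> = \<phi> (nbhd \<sigma>) (t \<sigma>)" "t \<sigma> \<in> carrier (stalk F \<sigma>)"
        using t \<sigma> by (auto simp: cochain_map_def cochains_def PiE_iff)
      moreover have "x \<sigma> \<in> carrier (stalk G \<sigma>)" using xG \<sigma> by (auto simp: cochains_def PiE_iff)
      ultimately show "\<psi> (nbhd \<sigma>) (x \<sigma>) = \<one>\<^bsub>stalk H \<sigma>\<^esub>"
        using cell_exact[OF \<sigma>] by blast
    qed
    ultimately show "x \<in> kernel (cochains G p) (cochains H p) (cochain_map \<psi> p)" by (simp add: kernel_def)
  }
qed

section \<open>Global sections as Cech cocycles of degree zero\<close>

definition to_cochain :: "('p, 'b) group_presheaf \<Rightarrow> 'b \<Rightarrow> 'v set \<Rightarrow> 'b" where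
  "to_cochain F s = (\<lambda>\<sigma>\<in>cells 0. restr F (topspace X) (nbhd \<sigma>) s)"

lemma to_cochain_hom:
  assumes F: "presheaf X F"
  shows "to_cochain F \<in> hom (sections F (topspace X)) (cochains F 0)"
proof (rule homI)
  have r: "restr F (topspace X) (nbhd \<sigma>) \<in> hom (sections F (topspace X)) (stalk F \<sigma>)"
    if "\<sigma> \<in> cells 0" for \<sigma>
    by (rule presheaf_hom[OF F openin_topspace cell_open[OF that] openin_subset[OF cell_open[OF that]]])
  fix s assume s: "s \<in> carrier (sections F (topspace X))"
  show "to_cochain F s \<in> carrier (cochains F 0)"
    using hom_in_carrier[OF r s] by (simp add: to_cochain_def cochains_def)
  fix t assume t: "t \<in> carrier (sections F (topspace X))"
  show "to_cochain F (s \<otimes>\<^bsub>sections F (topspace X)\<^esub> t) = to_cochain F s \<otimes>\<^bsub>cochains F 0\<^esub> to_cochain F t"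
    using hom_mult[OF r s t] by (auto simp: to_cochain_def cochains_def intro!: restrict_ext)
qed

lemma to_cochain_cochain_map:
  assumes \<phi>: "sheaf_morphism X F G \<phi>" and s: "s \<in> carrier (sections F (topspace X))"
  shows "to_cochain G (\<phi> (topspace X) s) = cochain_map \<phi> 0 (to_cochain F s)"
  using sheaf_morphism_natural[OF \<phi> openin_topspace cell_open openin_subset[OF cell_open] s]
  by (auto simp: to_cochain_def cochain_map_def intro!: restrict_ext)

lemma cell_0_iff: "\<sigma> \<in> cells 0 \<longleftrightarrow> (\<exists>v. \<sigma> = {v} \<and> {v} \<in> \<Delta>)"
  by (auto simp: cells_def card_1_singleton_iff)

lemma Union_nbhd_cell_0: "\<Union>(nbhd ` cells 0) = topspace X"
proof (intro equalityI subsetI)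
  fix x assume "x \<in> topspace X"
  then obtain \<sigma> v where \<sigma>: "\<sigma> \<in> \<Delta>" "x = pt \<sigma>" "v \<in> \<sigma>" unfolding topspace_pt by blast
  then have "{v} \<in> cells 0" using face_mono[of \<sigma> "{v}"] by (simp add: cells_def)
  moreover have "x \<in> nbhd {v}" using \<sigma> by (simp add: pt_in_nbhd_iff)
  ultimately show "x \<in> \<Union>(nbhd ` cells 0)" by blast
next
  fix x assume "x \<in> \<Union>(nbhd ` cells 0)"
  then show "x \<in> topspace X" using openin_subset[OF cell_open] by blast
qed

text \<open>For \<open>a < b\<close> the signs at \<open>a\<close> and \<open>b\<close> are 1 and
  -1, so the differential on an edge is a quotient of two restrictions, and its vanishing is the
  gluing condition on the overlap.\<close>

lemma cech_edge:
  assumes F: "presheaf X F" and ab: "a < b" "{a, b} \<in> \<Delta>" and x: "x \<in> carrier (cochains F 0)"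
  shows "cech F 0 x {a, b} = \<one>\<^bsub>stalk F {a, b}\<^esub> \<longleftrightarrow>
    restr F (nbhd {b}) (nbhd {a, b}) (x {b}) = restr F (nbhd {a}) (nbhd {a, b}) (x {a})"
proof -
  have \<tau>: "{a, b} \<in> cells (Suc 0)" using ab by (auto simp: cells_def)
  let ?G = "stalk F {a, b}"
  interpret G: comm_group ?G by (rule cell_comm_group[OF F \<tau>])
  have d: "{a, b} - {a} = {b}" "{a, b} - {b} = {a}" using ab by auto
  have s: "pos_sign {a, b} a = 1" "pos_sign {a, b} b = - 1"
    using ab pos_sign_Min[of "{a, b}" a] pos_sign_insert_less[of "{b}" a b] pos_sign_Min[of "{b}" b] by auto
  have c: "restr F (nbhd {b}) (nbhd {a, b}) (x {b}) \<in> carrier ?G"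
    "restr F (nbhd {a}) (nbhd {a, b}) (x {a}) \<in> carrier ?G"
    using facet_restr_closed[OF F \<tau> _ x, of a] facet_restr_closed[OF F \<tau> _ x, of b] by (simp_all add: d)
  have "cech F 0 x {a, b} = restr F (nbhd {b}) (nbhd {a, b}) (x {b}) \<otimes>\<^bsub>?G\<^esub> inv\<^bsub>?G\<^esub> (restr F (nbhd {a}) (nbhd {a, b}) (x {a}))"
    using \<tau> ab c by (simp add: cech_def d s G.int_pow_neg)
  then show ?thesis using c by (simp add: G.inv_solve_right')
qed

lemma to_cochain_inj:
  assumes F: "sheaf X F"
  shows "inj_on (to_cochain F) (carrier (sections F (topspace X)))"
proof (rule inj_onI)
  fix s t assume st: "s \<in> carrier (sections F (topspace X))" "t \<in> carrier (sections F (topspace X))"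
    and eq: "to_cochain F s = to_cochain F t"
  show "s = t"
  proof (rule sheaf_separated[OF F, of "nbhd ` cells 0", unfolded Union_nbhd_cell_0])
    show "openin X U" if "U \<in> nbhd ` cells 0" for U using that cell_open by blast
    show "restr F (topspace X) U s = restr F (topspace X) U t" if U: "U \<in> nbhd ` cells 0" for U
    proof -
      obtain \<sigma> where \<sigma>: "\<sigma> \<in> cells 0" "U = nbhd \<sigma>" using U by blast
      then show ?thesis using fun_cong[OF eq, of \<sigma>] by (simp add: to_cochain_def)
    qed
  qed (use st in auto)
qed

text \<open>This is the sheaf axiom for the vertex cover, with agreement on overlaps rephrased by
  \<open>cech_edge\<close>.\<close>

lemma to_cochain_image:
  assumes F: "sheaf X F"
  shows "to_cochain F ` carrier (sections F (topspace X)) = kernel (cochains F 0) (cochains F (Suc 0)) (cech F 0)"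
proof (intro equalityI subsetI)
  have pF: "presheaf X F" using F by (simp add: sheaf_def)
  {
    fix x assume "x \<in> to_cochain F ` carrier (sections F (topspace X))"
    then obtain s where s: "s \<in> carrier (sections F (topspace X))" "x = to_cochain F s" by blast
    have x: "x \<in> carrier (cochains F 0)" using hom_in_carrier[OF to_cochain_hom[OF pF] s(1)] s(2) by simp
    have "cech F 0 x \<tau> = \<one>\<^bsub>stalk F \<tau>\<^esub>" if \<tau>: "\<tau> \<in> cells (Suc 0)" for \<tau>
    proof -
      obtain a b where ab: "\<tau> = {a, b}" "a < b"
        using \<tau> by (auto simp: cells_def card_Suc_eq numeral_2_eq_2) (metis insert_commute neqE)
      have "restr F (nbhd {v}) (nbhd \<tau>) (x {v}) = restr F (topspace X) (nbhd \<tau>) s" if v: "v \<in> \<tau>" for v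
      proof -
        have c: "{v} \<in> cells 0" using v \<tau> face_mono[of \<tau> "{v}"] by (auto simp: cells_def)
        have "restr F (nbhd {v}) (nbhd \<tau>) (restr F (topspace X) (nbhd {v}) s) = restr F (topspace X) (nbhd \<tau>) s"
          by (rule presheaf_trans[OF pF openin_topspace cell_open[OF c] cell_open[OF \<tau>] nbhd_anti openin_subset[OF cell_open[OF c]] s(1)])
            (use v in auto)
        then show ?thesis using c s(2) by (simp add: to_cochain_def)
      qed
      then have "restr F (nbhd {b}) (nbhd \<tau>) (x {b}) = restr F (nbhd {a}) (nbhd \<tau>) (x {a})" using ab by simp
      then show ?thesis using cech_edge[OF pF ab(2) _ x] \<tau> cellD[OF \<tau>] by (simp add: ab(1))
    qed
    then have "cech F 0 x = \<one>\<^bsub>cochains F (Suc 0)\<^esub>"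
      by (intro extensionalityI[of _ "cells (Suc 0)"]) (simp_all add: cech_def[of F 0 x] cochains_def)
    then show "x \<in> kernel (cochains F 0) (cochains F (Suc 0)) (cech F 0)" using x by (simp add: kernel_def)
  next
    fix x assume "x \<in> kernel (cochains F 0) (cochains F (Suc 0)) (cech F 0)"
    then have x: "x \<in> carrier (cochains F 0)" and cx: "cech F 0 x = \<one>\<^bsub>cochains F (Suc 0)\<^esub>" by (auto simp: kernel_def)
    have xv: "x {v} \<in> carrier (stalk F {v})" if "{v} \<in> \<Delta>" for v
      using x that by (auto simp: cochains_def PiE_iff cells_def)
    have compat_less: "restr F (nbhd {b}) (nbhd {a, b}) (x {b}) = restr F (nbhd {a}) (nbhd {a, b}) (x {a})"
      if "a < b" "{a} \<in> \<Delta>" "{b} \<in> \<Delta>" for a b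
    proof (cases "{a, b} \<in> \<Delta>")
      case True
      then have "{a, b} \<in> cells (Suc 0)" using that by (auto simp: cells_def)
      then have "cech F 0 x {a, b} = \<one>\<^bsub>stalk F {a, b}\<^esub>" by (simp add: cx cochains_def)
      then show ?thesis using cech_edge[OF pF that(1) True x] by blast
    next
      \<comment> \<open>No cell records this overlap, but it is empty and thus carries a single
        section.\<close>
      case False
      then have e: "nbhd {a, b} = {}" by (rule nbhd_nonface)
      have o: "openin X (nbhd {v})" if "{v} \<in> \<Delta>" for v using that by (intro openin_nbhd) auto
      show ?thesis unfolding e
        by (rule sheaf_empty[OF F]) (rule presheaf_closed[OF pF o _ _ xv]; use that in simp)+
    qed
    have compat: "restr F (nbhd {a}) (nbhd {a} \<inter> nbhd {b}) (x {a}) = restr F (nbhd {b}) (nbhd {a} \<inter> nbhd {b}) (x {b})"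
      if "{a} \<in> \<Delta>" "{b} \<in> \<Delta>" for a b
    proof -
      have "{a} \<union> {b} = {a, b}" "{b} \<union> {a} = {a, b}" by auto
      then show ?thesis
        using compat_less[of a b] compat_less[of b a] that
        by (cases a b rule: linorder_cases) (simp_all add: nbhd_Int insert_commute)
    qed
    have nbhd_inj: "a = b" if "{a} \<in> \<Delta>" "{b} \<in> \<Delta>" "nbhd {a} = nbhd {b}" for a b
      using pt_in_nbhd[OF that(1)] that pt_in_nbhd_iff[OF that(1), of "{b}"] by auto
    \<comment> \<open>The gluing axiom indexes local sections by open sets, a cochain by vertices.
      By \<open>nbhd_inj\<close> distinct vertices have distinct neighbourhoods, so the vertex can
      be recovered from its open set.\<close>
    define s where "s U = x {SOME v. {v} \<in> \<Delta> \<and> U = nbhd {v}}" for U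
    have s: "s (nbhd {v}) = x {v}" if "{v} \<in> \<Delta>" for v
    proof -
      have "{SOME w. {w} \<in> \<Delta> \<and> nbhd {v} = nbhd {w}} = {v}"
        using someI[of "\<lambda>w. {w} \<in> \<Delta> \<and> nbhd {v} = nbhd {w}" v] that nbhd_inj by blast
      then show ?thesis by (simp add: s_def)
    qed
    have "\<exists>!t. t \<in> carrier (sections F (\<Union>(nbhd ` cells 0))) \<and> (\<forall>U\<in>nbhd ` cells 0. restr F (\<Union>(nbhd ` cells 0)) U t = s U)"
    proof (rule F[unfolded sheaf_def, THEN conjunct2, rule_format], intro conjI ballI)
      fix U assume "U \<in> nbhd ` cells 0"
      then obtain a where a: "{a} \<in> \<Delta>" "U = nbhd {a}" by (auto simp: cell_0_iff)
      show "openin X U" using openin_nbhd[OF a(1)] a(2) by simp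
      show "s U \<in> carrier (sections F U)" using xv[OF a(1)] a(2) s[OF a(1)] by simp
      fix W assume "W \<in> nbhd ` cells 0"
      then obtain b where b: "{b} \<in> \<Delta>" "W = nbhd {b}" by (auto simp: cell_0_iff)
      show "restr F U (U \<inter> W) (s U) = restr F W (U \<inter> W) (s W)"
        using compat[OF a(1) b(1)] by (simp add: a(2) b(2) s[OF a(1)] s[OF b(1)])
    qed
    from ex1_implies_ex[OF this, unfolded Union_nbhd_cell_0]
    obtain t where t: "t \<in> carrier (sections F (topspace X))"
      "\<forall>U\<in>nbhd ` cells 0. restr F (topspace X) U t = s U"
      by (elim exE conjE) (rule that)
    have "to_cochain F t = x"
    proof (rule extensionalityI[of _ "cells 0"])
      fix \<sigma> assume \<sigma>: "\<sigma> \<in> cells 0"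
      then obtain v where v: "\<sigma> = {v}" "{v} \<in> \<Delta>" by (auto simp: cell_0_iff)
      then show "to_cochain F t \<sigma> = x \<sigma>" using bspec[OF t(2) imageI[OF \<sigma>]] s[OF v(2)] \<sigma> by (simp add: to_cochain_def)
    qed (use x in \<open>auto simp: to_cochain_def cochains_def PiE_iff\<close>)
    then show "x \<in> to_cochain F ` carrier (sections F (topspace X))" using t(1) by blast
  }
qed

text \<open>The two edges of the Cech double complex of a resolution: global sections of its terms
  are the kernels of \<open>\<delta>\<close> in Cech degree zero, and the kernel of
  \<open>D 0\<close> stands for the image of \<open>F\<close> in \<open>T 0\<close>. The right-hand
  side is therefore the Cech cohomology of that image.\<close>

theorem derived_global_sections_iso:
  fixes R :: "('p, 'a, 'b) sheaf_resolution"
  assumes res: "injective_resolution X F R" and inf: "topspace X = {} \<or> infinite (UNIV :: 'b set)"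
  defines "T \<equiv> term_of R" and "D \<equiv> differential R"
  shows "derived_global_sections X R j \<cong>
    (cochains (T 0) j)\<lparr>carrier := kernel (cochains (T 0) j) (cochains (T 1) j) (cochain_map (D 0) j)
        \<inter> kernel (cochains (T 0) j) (cochains (T 0) (Suc j)) (cech (T 0) j)\<rparr>
    Mod (case j of 0 \<Rightarrow> {\<one>\<^bsub>cochains (T 0) 0\<^esub>}
      | Suc i \<Rightarrow> cech (T 0) i ` kernel (cochains (T 0) i) (cochains (T 1) i) (cochain_map (D 0) i))"
proof -
  have I: "injective_sheaf X (T q)" for q using res by (simp add: injective_resolution_def T_def)
  then have sh: "sheaf X (T q)" for q by (simp add: injective_sheaf_def)
  then have pr: "presheaf X (T q)" for q by (simp add: sheaf_def)
  have ex: "sheaf_exact X (T q) (D q) (T (Suc q)) (D (Suc q)) (T (Suc (Suc q)))" for q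
    using res by (simp add: injective_resolution_def T_def D_def)
  have D: "sheaf_morphism X (T q) (T (Suc q)) (D q)" for q using ex[of q] by (simp add: sheaf_exact_def)
  \<comment> \<open>\<open>p\<close> is the Cech degree and \<open>q\<close> the degree in the
    resolution; the presheaf argument comes first in \<open>cochains\<close>, which explains the
    exchanged order.\<close>
  interpret C: exact_double_complex "\<lambda>p q. cochains (T q) p" "\<lambda>p q. cochain_map (D q) p" "\<lambda>p q. cech (T q) p"
  proof (rule exact_double_complex.intro)
    show "comm_group (cochains (T q) p)" for p q by (rule comm_group_cochains[OF pr])
    show "cochain_map (D q) p \<in> hom (cochains (T q) p) (cochains (T (Suc q)) p)" for p q
      by (rule cochain_map_hom[OF D])
    show "cech (T q) p \<in> hom (cochains (T q) p) (cochains (T q) (Suc p))" for p q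
      by (rule cech_hom[OF pr])
    show "cochain_map (D q) (Suc p) (cech (T q) p x) = cech (T (Suc q)) p (cochain_map (D q) p x)"
      if "x \<in> carrier (cochains (T q) p)" for x p q
      by (rule cech_cochain_map[OF pr pr D that])
    show "kernel (cochains (T (Suc q)) p) (cochains (T (Suc (Suc q))) p) (cochain_map (D (Suc q)) p) =
        cochain_map (D q) p ` carrier (cochains (T q) p)" for p q
      by (rule cochain_map_exact[OF ex pr])
    show "kernel (cochains (T q) (Suc p)) (cochains (T q) (Suc (Suc p))) (cech (T q) (Suc p)) =
        cech (T q) p ` carrier (cochains (T q) p)" for p q
      by (rule cech_injective_exact[OF I inf])
  qed
  let ?\<Gamma> = "\<lambda>q. sections (T q) (topspace X)"
  let ?d = "\<lambda>q. D q (topspace X)"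
  have \<Gamma>: "comm_group (?\<Gamma> q)" for q by (rule presheaf_comm_group[OF pr openin_topspace])
  then have \<Gamma>g: "group (?\<Gamma> q)" for q by (rule comm_group.axioms)
  have d: "?d q \<in> hom (?\<Gamma> q) (?\<Gamma> (Suc q))" for q by (rule sheaf_morphism_hom[OF D openin_topspace])
  define K where "K q = kernel (?\<Gamma> q) (?\<Gamma> (Suc q)) (?d q)" for q
  have K: "subgroup (K q) (?\<Gamma> q)" for q unfolding K_def by (rule subgroup_kernel_hom[OF \<Gamma>g \<Gamma>g d])
  have tc: "to_cochain (T q) \<in> hom (?\<Gamma> q) (cochains (T q) 0)" for q by (rule to_cochain_hom[OF pr])
  have tc_one: "to_cochain (T q) s = \<one>\<^bsub>cochains (T q) 0\<^esub> \<longleftrightarrow> s = \<one>\<^bsub>?\<Gamma> q\<^esub>" if "s \<in> carrier (?\<Gamma> q)" for q s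
  proof -
    have "\<one>\<^bsub>cochains (T q) 0\<^esub> = to_cochain (T q) \<one>\<^bsub>?\<Gamma> q\<^esub>" by (rule hom_one[OF tc \<Gamma>g C.grp, symmetric])
    then show ?thesis
      using inj_on_eq_iff[OF to_cochain_inj[OF sh] that] group.is_monoid[OF \<Gamma>g] by (simp add: monoid.one_closed)
  qed
  have tc_image: "to_cochain (T q) ` carrier (?\<Gamma> q) = C.\<delta>_cycles 0 q" for q
    using to_cochain_image[OF sh] by (simp add: C.\<delta>_cycles_def)
  have tc_d: "to_cochain (T (Suc q)) (?d q s) = cochain_map (D q) 0 (to_cochain (T q) s)"
    if "s \<in> carrier (?\<Gamma> q)" for q s by (rule to_cochain_cochain_map[OF D that])
  have tc_K: "to_cochain (T q) s \<in> C.d_cycles 0 q \<longleftrightarrow> s \<in> K q" if "s \<in> carrier (?\<Gamma> q)" for q s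
    using that hom_in_carrier[OF tc that] tc_d[OF that] tc_one[OF hom_in_carrier[OF d that]]
    by (simp add: C.d_cycles_def K_def kernel_def)
  define B where "B q = (case q of 0 \<Rightarrow> {\<one>\<^bsub>?\<Gamma> 0\<^esub>} | Suc i \<Rightarrow> ?d i ` carrier (?\<Gamma> i))" for q
  define N where "N q = (case q of 0 \<Rightarrow> {\<one>\<^bsub>cochains (T 0) 0\<^esub>}
    | Suc i \<Rightarrow> cochain_map (D i) 0 ` C.\<delta>_cycles 0 i)" for q
  have triv: "subgroup {\<one>\<^bsub>cochains (T 0) 0\<^esub>} (C.bicycles 0 0)"
    using group.triv_subgroup[OF comm_group.axioms(2)[OF C.comm_group_bicycles[of 0 0]]]
    by (simp add: C.bicycles_def)
  have N: "subgroup (N q) (C.bicycles 0 q)" for q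
    using triv C.d_image_bicycles by (cases q) (simp_all add: N_def)
  have BN: "s \<in> B q \<longleftrightarrow> to_cochain (T q) s \<in> N q" if s: "s \<in> carrier (?\<Gamma> q)" for q s
  proof (cases q)
    case 0
    then show ?thesis using tc_one s by (simp add: B_def N_def)
  next
    case (Suc i)
    have "N q = to_cochain (T q) ` B q"
      unfolding N_def B_def Suc nat.case tc_image[symmetric] image_image
      by (rule image_cong) (simp_all add: tc_d)
    moreover have "B q \<subseteq> carrier (?\<Gamma> q)" using hom_in_carrier[OF d] by (auto simp: B_def Suc)
    ultimately show ?thesis using inj_on_image_mem_iff[OF to_cochain_inj[OF sh] s] by metis
  qed
  have sub_B: "subgroup (B q) (?\<Gamma> q)" for q
  proof (cases q)
    case 0
    then show ?thesis using group.triv_subgroup[OF \<Gamma>g] by (simp add: B_def)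
  next
    case (Suc i)
    then show ?thesis
      using group_hom.img_is_subgroup[of "?\<Gamma> i" "?\<Gamma> q" "?d i"] \<Gamma>g d
      by (simp add: B_def group_hom_def group_hom_axioms_def)
  qed
  have BK: "B q \<subseteq> K q" for q
  proof
    fix s assume "s \<in> B q"
    then have "s \<in> carrier (?\<Gamma> q)" "to_cochain (T q) s \<in> N q" using subgroup.subset[OF sub_B] BN by blast+
    then show "s \<in> K q" using tc_K subgroup.subset[OF N] by (auto simp: C.bicycles_def)
  qed
  have G: "comm_group ((?\<Gamma> j)\<lparr>carrier := K j\<rparr>)" by (rule comm_group_subgroup[OF \<Gamma> K])
  have 1: "derived_global_sections X R j = (?\<Gamma> j)\<lparr>carrier := K j\<rparr> Mod B j"
    unfolding derived_global_sections_def Let_def K_def B_def global_coboundaries_def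
    by (cases j) (simp_all add: T_def D_def)
  have "(?\<Gamma> j)\<lparr>carrier := K j\<rparr> Mod B j \<cong> C.bicycles 0 j Mod N j"
  proof (rule subgroup_Mod_iso_by_span[OF comm_group.axioms(2)[OF G] G _ C.comm_group_bicycles N])
    show "subgroup (B j) ((?\<Gamma> j)\<lparr>carrier := K j\<rparr>)"
      by (rule subgroup_of_subgroup[OF \<Gamma>g K sub_B BK])
    show "(\<lambda>s. s) \<in> hom ((?\<Gamma> j)\<lparr>carrier := K j\<rparr>) ((?\<Gamma> j)\<lparr>carrier := K j\<rparr>)" by (simp add: hom_def)
    have Kc: "s \<in> carrier (?\<Gamma> j)" if "s \<in> K j" for s using that by (simp add: K_def kernel_def)
    have im: "to_cochain (T j) ` K j = C.d_cycles 0 j \<inter> C.\<delta>_cycles 0 j"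
    proof (intro equalityI subsetI)
      fix x assume "x \<in> to_cochain (T j) ` K j"
      then show "x \<in> C.d_cycles 0 j \<inter> C.\<delta>_cycles 0 j"
        using tc_K Kc tc_image[of j] by blast
    next
      fix x assume x: "x \<in> C.d_cycles 0 j \<inter> C.\<delta>_cycles 0 j"
      then obtain s where "s \<in> carrier (?\<Gamma> j)" "x = to_cochain (T j) s" using tc_image[of j] by blast
      then show "x \<in> to_cochain (T j) ` K j" using x tc_K by blast
    qed
    then show "to_cochain (T j) ` carrier ((?\<Gamma> j)\<lparr>carrier := K j\<rparr>) = carrier (C.bicycles 0 j)"
      by (simp add: C.bicycles_def)
    show "to_cochain (T j) \<in> hom ((?\<Gamma> j)\<lparr>carrier := K j\<rparr>) (C.bicycles 0 j)"
    proof (rule homI)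
      fix s t assume "s \<in> carrier ((?\<Gamma> j)\<lparr>carrier := K j\<rparr>)"
      then have s: "s \<in> K j" by simp
      then show "to_cochain (T j) s \<in> carrier (C.bicycles 0 j)" using im by (auto simp: C.bicycles_def)
      assume "t \<in> carrier ((?\<Gamma> j)\<lparr>carrier := K j\<rparr>)"
      then show "to_cochain (T j) (s \<otimes>\<^bsub>(?\<Gamma> j)\<lparr>carrier := K j\<rparr>\<^esub> t) = to_cochain (T j) s \<otimes>\<^bsub>C.bicycles 0 j\<^esub> to_cochain (T j) t"
        using hom_mult[OF tc Kc[OF s] Kc, of t] by (simp add: C.bicycles_def)
    qed
    show "w \<in> B j \<longleftrightarrow> to_cochain (T j) w \<in> N j" if "w \<in> carrier ((?\<Gamma> j)\<lparr>carrier := K j\<rparr>)" for w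
      using BN Kc that by simp
  qed simp
  \<comment> \<open>After \<open>to_cochain\<close> has identified the edge \<open>p = 0\<close>,
    the staircase passes to the edge \<open>q = 0\<close>. In degree zero both edges meet and there
    is nothing to move.\<close>
  also have "C.bicycles 0 j Mod N j \<cong> C.bicycles j 0 Mod (case j of 0 \<Rightarrow> {\<one>\<^bsub>cochains (T 0) 0\<^esub>}
      | Suc i \<Rightarrow> cech (T 0) i ` C.d_cycles i 0)"
    using C.staircase by (cases j) (simp_all add: N_def)
  finally show ?thesis
    unfolding 1 C.bicycles_def C.d_cycles_def C.\<delta>_cycles_def One_nat_def .
qed

end

section \<open>Sheaves of lattices and cohomology of links\<close>

text \<open>Added to its transpose the double sum cancels term by term, and the integers have no
  2-torsion. Filling the diagonal with zeros in \<open>h\<close> allows the summations to be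
  exchanged.\<close>

lemma sum_alternating:
  fixes g :: "'a \<Rightarrow> 'a \<Rightarrow> int"
  assumes "finite S" and g: "\<And>v w. v \<in> S \<Longrightarrow> w \<in> S \<Longrightarrow> v \<noteq> w \<Longrightarrow> g v w + g w v = 0"
  shows "(\<Sum>v\<in>S. \<Sum>w\<in>S - {v}. g v w) = 0"
proof -
  define h where "h v w = (if v = w then 0 else g v w)" for v w
  have "(\<Sum>w\<in>S - {v}. g v w) = (\<Sum>w\<in>S. h v w)" if "v \<in> S" for v
  proof -
    have "(\<Sum>w\<in>S. h v w) = h v v + (\<Sum>w\<in>S - {v}. h v w)" by (rule sum.remove[OF assms(1) that])
    also have "(\<Sum>w\<in>S - {v}. h v w) = (\<Sum>w\<in>S - {v}. g v w)" by (rule sum.cong) (auto simp: h_def)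
    finally show ?thesis by (simp add: h_def)
  qed
  then have 1: "(\<Sum>v\<in>S. \<Sum>w\<in>S - {v}. g v w) = (\<Sum>v\<in>S. \<Sum>w\<in>S. h v w)" by simp
  have "(\<Sum>v\<in>S. \<Sum>w\<in>S. h v w) + (\<Sum>v\<in>S. \<Sum>w\<in>S. h v w) = (\<Sum>v\<in>S. \<Sum>w\<in>S. h v w) + (\<Sum>w\<in>S. \<Sum>v\<in>S. h v w)"
    using sum.swap[of h S S] by simp
  also have "\<dots> = (\<Sum>v\<in>S. \<Sum>w\<in>S. h v w + h w v)" by (simp add: sum.distrib)
  also have "\<dots> = 0" by (intro sum.neutral ballI) (simp add: h_def g)
  finally show ?thesis using 1 by simp
qed

section \<open>Reduced simplicial cochains\<close>

lemma coboundary_apply: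
  "F \<in> faces_of_dim L (k + 1) \<Longrightarrow> coboundary L k c F = (\<Sum>v\<in>F. pos_sign F v * c (F - {v}))"
  by (simp add: coboundary_def pos_sign_def)

text \<open>A link need not contain every singleton of the ambient vertex set, so closure under
  subsets is what is kept of the notion of a complex.\<close>

definition down_closed :: "'v set set \<Rightarrow> bool" where
  "down_closed L \<longleftrightarrow> (\<forall>F\<in>L. \<forall>G. G \<subseteq> F \<longrightarrow> G \<in> L)"

lemma down_closedD: "down_closed L \<Longrightarrow> F \<in> L \<Longrightarrow> G \<subseteq> F \<Longrightarrow> G \<in> L"
  by (simp add: down_closed_def)

definition cocycles :: "'v::linorder set set \<Rightarrow> int \<Rightarrow> ('v set \<Rightarrow> int) set" where
  "cocycles L k = kernel (simplicial_cochains L k) (simplicial_cochains L (k + 1)) (coboundary L k)"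

definition coboundaries :: "'v::linorder set set \<Rightarrow> int \<Rightarrow> ('v set \<Rightarrow> int) set" where
  "coboundaries L k = coboundary L (k - 1) ` carrier (simplicial_cochains L (k - 1))"

lemma comm_group_simplicial_cochains: "comm_group (simplicial_cochains L k)"
  unfolding simplicial_cochains_def by (rule comm_group_product_group) (rule abelian_integer_group)

lemma group_simplicial_cochains: "group (simplicial_cochains L k)"
  using comm_group_simplicial_cochains by (rule comm_group.axioms)

lemma reduced_cohomology_eq:
  "reduced_cohomology L k = (simplicial_cochains L k)\<lparr>carrier := cocycles L k\<rparr> Mod coboundaries L k"
  by (simp add: reduced_cohomology_def cocycles_def coboundaries_def)

context
  fixes L :: "'v::linorder set set"
  assumes L: "down_closed L"
begin

lemma faces_of_dim_facet: "F \<in> faces_of_dim L (k + 1) \<Longrightarrow> v \<in> F \<Longrightarrow> F - {v} \<in> faces_of_dim L k"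
  using down_closedD[OF L, of F "F - {v}"] card_Suc_Diff1[of F v] by (auto simp: faces_of_dim_def)

lemma coboundary_hom: "coboundary L k \<in> hom (simplicial_cochains L k) (simplicial_cochains L (k + 1))"
proof (rule homI)
  show "coboundary L k x \<in> carrier (simplicial_cochains L (k + 1))" for x
    by (simp add: coboundary_def simplicial_cochains_def)
  fix x y
  show "coboundary L k (x \<otimes>\<^bsub>simplicial_cochains L k\<^esub> y) =
      coboundary L k x \<otimes>\<^bsub>simplicial_cochains L (k + 1)\<^esub> coboundary L k y"
  proof (rule extensionalityI[of _ "faces_of_dim L (k + 1)"])
    fix F assume F: "F \<in> faces_of_dim L (k + 1)"
    have "coboundary L k (x \<otimes>\<^bsub>simplicial_cochains L k\<^esub> y) F =
        (\<Sum>v\<in>F. pos_sign F v * x (F - {v}) + pos_sign F v * y (F - {v}))"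
      unfolding coboundary_apply[OF F]
      by (rule sum.cong) (simp_all add: simplicial_cochains_def faces_of_dim_facet[OF F] distrib_left)
    then show "coboundary L k (x \<otimes>\<^bsub>simplicial_cochains L k\<^esub> y) F =
      (coboundary L k x \<otimes>\<^bsub>simplicial_cochains L (k + 1)\<^esub> coboundary L k y) F"
      using F by (simp add: simplicial_cochains_def coboundary_apply sum.distrib)
  qed (auto simp: coboundary_def simplicial_cochains_def)
qed

lemma coboundary_coboundary: "coboundary L (k + 1) (coboundary L k c) = \<one>\<^bsub>simplicial_cochains L (k + 2)\<^esub>"
proof (rule extensionalityI[of _ "faces_of_dim L (k + 1 + 1)"])
  fix F assume F: "F \<in> faces_of_dim L (k + 1 + 1)"
  then have fin: "finite F" by (simp add: faces_of_dim_def)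
  have "coboundary L (k + 1) (coboundary L k c) F = (\<Sum>v\<in>F. \<Sum>w\<in>F - {v}.
      pos_sign (F - {v}) w * pos_sign F v * c (F - {v} - {w}))"
    unfolding coboundary_apply[OF F]
    by (rule sum.cong)
      (simp_all add: coboundary_apply[OF faces_of_dim_facet[OF F]] sum_distrib_left mult_ac)
  also have "\<dots> = 0"
  proof (rule sum_alternating[OF fin])
    fix v w assume vw: "v \<in> F" "w \<in> F" "v \<noteq> w"
    have "F - {w} - {v} = F - {v} - {w}" by blast
    then show "pos_sign (F - {v}) w * pos_sign F v * c (F - {v} - {w}) +
        pos_sign (F - {w}) v * pos_sign F w * c (F - {w} - {v}) = 0"
      using pos_sign_swap[OF fin vw] by simp
  qed
  finally show "coboundary L (k + 1) (coboundary L k c) F = \<one>\<^bsub>simplicial_cochains L (k + 2)\<^esub> F"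
    using F by (simp add: simplicial_cochains_def add.assoc)
qed (simp_all add: coboundary_def simplicial_cochains_def add.assoc)

lemma subgroup_cocycles: "subgroup (cocycles L k) (simplicial_cochains L k)"
  unfolding cocycles_def
  by (rule subgroup_kernel_hom[OF group_simplicial_cochains group_simplicial_cochains coboundary_hom])

lemma comm_group_cocycles: "comm_group ((simplicial_cochains L k)\<lparr>carrier := cocycles L k\<rparr>)"
  by (rule comm_group_subgroup[OF comm_group_simplicial_cochains subgroup_cocycles])

lemma subgroup_coboundaries: "subgroup (coboundaries L k) ((simplicial_cochains L k)\<lparr>carrier := cocycles L k\<rparr>)"
proof (rule subgroup_of_subgroup[OF group_simplicial_cochains subgroup_cocycles])
  have hom: "coboundary L (k - 1) \<in> hom (simplicial_cochains L (k - 1)) (simplicial_cochains L k)"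
    using coboundary_hom[of "k - 1"] by simp
  then show "subgroup (coboundaries L k) (simplicial_cochains L k)"
    unfolding coboundaries_def
    by (intro group_hom.img_is_subgroup) (simp add: group_hom_def group_hom_axioms_def group_simplicial_cochains)
  have "coboundary L k (coboundary L (k - 1) c) = \<one>\<^bsub>simplicial_cochains L (k + 1)\<^esub>" for c
    using coboundary_coboundary[of "k - 1" c] by (simp add: add.commute)
  then show "coboundaries L k \<subseteq> cocycles L k"
    using hom_in_carrier[OF hom] by (auto simp: coboundaries_def cocycles_def kernel_def)
qed

end

lemma down_closed_link:
  assumes "down_closed \<Delta>"
  shows "down_closed (link \<Delta> i)"
  unfolding down_closed_def
proof (intro ballI allI impI)
  fix F G assume F: "F \<in> link \<Delta> i" "G \<subseteq> F"
  then have "{i} \<union> G \<subseteq> {i} \<union> F" by auto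
  then show "G \<in> link \<Delta> i"
    using F down_closedD[OF assms] unfolding link_def by blast
qed

lemma pos_sign_cases: "pos_sign \<tau> v = 1 \<or> pos_sign \<tau> v = - 1"
  unfolding pos_sign_def by (cases "even (card {w \<in> \<tau>. w < v})") simp_all

text \<open>\<open>a \<sigma>\<close> embeds \<open>\<int>\<^sup>\<sigma>\<close> into the sections over \<open>nbhd \<sigma>\<close>; it is given on all functions, of which it only
  sees the values on \<open>\<sigma>\<close>. Restriction to a smaller neighbourhood is extension by zero.\<close>

locale face_lattice_system = face_space \<Delta> X pt
  for \<Delta> :: "'v::linorder set set" and X :: "'p topology" and pt :: "'v set \<Rightarrow> 'p" +
  fixes I :: "('p, 'b) group_presheaf" and a :: "'v set \<Rightarrow> ('v \<Rightarrow> int) \<Rightarrow> 'b" and V :: "'v set"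
  assumes I: "presheaf X I"
    and a_closed: "\<sigma> \<in> \<Delta> \<Longrightarrow> \<sigma> \<noteq> {} \<Longrightarrow> a \<sigma> z \<in> carrier (stalk I \<sigma>)"
    and a_add: "\<sigma> \<in> \<Delta> \<Longrightarrow> \<sigma> \<noteq> {} \<Longrightarrow> a \<sigma> (\<lambda>i. z i + y i) = a \<sigma> z \<otimes>\<^bsub>stalk I \<sigma>\<^esub> a \<sigma> y"
    and a_eq: "\<sigma> \<in> \<Delta> \<Longrightarrow> \<sigma> \<noteq> {} \<Longrightarrow> a \<sigma> z = a \<sigma> y \<longleftrightarrow> (\<forall>i\<in>\<sigma>. z i = y i)"
    and a_restr: "\<tau> \<in> \<Delta> \<Longrightarrow> \<sigma> \<noteq> {} \<Longrightarrow> \<sigma> \<subseteq> \<tau> \<Longrightarrow>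
      restr I (nbhd \<sigma>) (nbhd \<tau>) (a \<sigma> z) = a \<tau> (\<lambda>i. if i \<in> \<sigma> then z i else 0)"
    and finite_V: "finite V"
    and vertices: "{i} \<in> \<Delta> \<longleftrightarrow> i \<in> V"
begin

lemma face_subset_V: "\<sigma> \<in> \<Delta> \<Longrightarrow> i \<in> \<sigma> \<Longrightarrow> i \<in> V"
  using face_mono[of \<sigma> "{i}"] vertices by auto

lemma group_sections: "\<sigma> \<in> \<Delta> \<Longrightarrow> \<sigma> \<noteq> {} \<Longrightarrow> comm_group (stalk I \<sigma>)"
  by (rule presheaf_comm_group[OF I openin_nbhd])

lemma a_zero:
  assumes \<sigma>: "\<sigma> \<in> \<Delta>" "\<sigma> \<noteq> {}"
  shows "a \<sigma> (\<lambda>_. 0) = \<one>\<^bsub>stalk I \<sigma>\<^esub>"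
proof -
  interpret H: comm_group "stalk I \<sigma>" by (rule group_sections[OF \<sigma>])
  have "a \<sigma> (\<lambda>_. 0) \<otimes>\<^bsub>stalk I \<sigma>\<^esub> a \<sigma> (\<lambda>_. 0) = a \<sigma> (\<lambda>_. 0)"
    using a_add[OF \<sigma>, of "\<lambda>_. 0" "\<lambda>_. 0"] by simp
  then show ?thesis using a_closed[OF \<sigma>] by (metis H.l_cancel_one')
qed

lemma a_eq_one: "\<sigma> \<in> \<Delta> \<Longrightarrow> \<sigma> \<noteq> {} \<Longrightarrow> a \<sigma> z = \<one>\<^bsub>stalk I \<sigma>\<^esub> \<longleftrightarrow> (\<forall>i\<in>\<sigma>. z i = 0)"
  by (simp add: a_eq flip: a_zero)

lemma a_sum:
  assumes \<sigma>: "\<sigma> \<in> \<Delta>" "\<sigma> \<noteq> {}" and "finite S"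
  shows "finprod (stalk I \<sigma>) (\<lambda>v. a \<sigma> (z v)) S = a \<sigma> (\<lambda>i. \<Sum>v\<in>S. z v i)"
proof -
  interpret H: comm_group "stalk I \<sigma>" by (rule group_sections[OF \<sigma>])
  show ?thesis
    using \<open>finite S\<close> by induction (simp_all add: a_zero[OF \<sigma>] a_closed[OF \<sigma>] a_add[OF \<sigma>])
qed

lemma a_sign:
  assumes \<sigma>: "\<sigma> \<in> \<Delta>" "\<sigma> \<noteq> {}"
  shows "a \<sigma> z [^]\<^bsub>stalk I \<sigma>\<^esub> pos_sign \<tau> v = a \<sigma> (\<lambda>i. pos_sign \<tau> v * z i)"
proof -
  interpret H: comm_group "stalk I \<sigma>" by (rule group_sections[OF \<sigma>])
  have "a \<sigma> (\<lambda>i. - z i) \<otimes>\<^bsub>stalk I \<sigma>\<^esub> a \<sigma> z = \<one>\<^bsub>stalk I \<sigma>\<^esub>"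
    using a_add[OF \<sigma>, of "\<lambda>i. - z i" z] by (simp add: a_zero[OF \<sigma>])
  then have "inv\<^bsub>stalk I \<sigma>\<^esub> (a \<sigma> z) = a \<sigma> (\<lambda>i. - z i)"
    by (rule H.inv_equality) (rule a_closed[OF \<sigma>])+
  then show ?thesis
    using pos_sign_cases[of \<tau> v] a_closed[OF \<sigma>] by (auto simp: H.int_pow_neg)
qed

section \<open>Splitting the lattice cochains into cochains of links\<close>

definition link_cochains :: "nat \<Rightarrow> 'v \<Rightarrow> ('v set \<Rightarrow> int) monoid" where
  "link_cochains j i = simplicial_cochains (link \<Delta> i) (int j - 1)"

definition link_coboundary :: "nat \<Rightarrow> 'v \<Rightarrow> ('v set \<Rightarrow> int) \<Rightarrow> 'v set \<Rightarrow> int" where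
  "link_coboundary j i = coboundary (link \<Delta> i) (int j - 1)"

lemma link_down_closed: "down_closed (link \<Delta> i)"
  using face_mono by (intro down_closed_link) (auto simp: down_closed_def)

text \<open>Removing \<open>i\<close> from a face with \<open>j + 1\<close> vertices leaves
  \<open>j\<close> of them, hence dimension \<open>j - 1\<close>. For \<open>j = 0\<close> this is
  the empty face in degree -1, the source of the reduced cohomology.\<close>

lemma link_faces: "faces_of_dim (link \<Delta> i) (int j - 1) = {G. insert i G \<in> \<Delta> \<and> i \<notin> G \<and> card G = j}"
proof (rule Set.set_eqI)
  show "G \<in> faces_of_dim (link \<Delta> i) (int j - 1) \<longleftrightarrow> G \<in> {G. insert i G \<in> \<Delta> \<and> i \<notin> G \<and> card G = j}" for G
    using face_mono[of "insert i G" G] finite_face[of "insert i G"] by (auto simp: faces_of_dim_def link_def)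
qed

lemma cell_link_face:
  assumes "\<sigma> \<in> cells j" "i \<in> \<sigma>"
  shows "\<sigma> - {i} \<in> faces_of_dim (link \<Delta> i) (int j - 1)"
  unfolding link_faces using assms by (simp add: insert_absorb cells_def)

lemma link_face_cell:
  assumes "G \<in> faces_of_dim (link \<Delta> i) (int j - 1)"
  shows "insert i G \<in> cells j"
  using assms finite_face[of "insert i G"] unfolding link_faces by (simp add: cells_def)

lemma link_coboundary_apply:
  assumes "\<tau> \<in> cells (Suc j)" "i \<in> \<tau>"
  shows "link_coboundary j i c (\<tau> - {i}) = (\<Sum>v\<in>\<tau> - {i}. pos_sign (\<tau> - {i}) v * c (\<tau> - {i} - {v}))"
  using cell_link_face[OF assms] unfolding link_coboundary_def by (intro coboundary_apply) simp

text \<open>The sign moves \<open>i\<close> to the front of \<open>\<sigma>\<close>. Without it the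
  Cech differential in the coordinate \<open>i\<close> would agree with the coboundary of the link
  only up to signs varying with the face.\<close>

definition coefficients :: "('v \<Rightarrow> 'v set \<Rightarrow> int) \<Rightarrow> 'v set \<Rightarrow> 'v \<Rightarrow> int" where
  "coefficients w \<sigma> i = pos_sign \<sigma> i * w i (\<sigma> - {i})"

definition assemble :: "nat \<Rightarrow> ('v \<Rightarrow> 'v set \<Rightarrow> int) \<Rightarrow> 'v set \<Rightarrow> 'b" where
  "assemble j w = (\<lambda>\<sigma>\<in>cells j. a \<sigma> (coefficients w \<sigma>))"

lemma assemble_closed: "assemble j w \<in> carrier (cochains I j)"
  using a_closed cellD by (simp add: assemble_def cochains_def)

lemma assemble_add:
  "assemble j (\<lambda>i G. w i G + w' i G) = assemble j w \<otimes>\<^bsub>cochains I j\<^esub> assemble j w'"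
proof (rule extensionalityI[of _ "cells j"])
  fix \<sigma> assume \<sigma>: "\<sigma> \<in> cells j"
  then have "\<sigma> \<in> \<Delta>" "\<sigma> \<noteq> {}" using cellD by blast+
  from a_add[OF this] show "assemble j (\<lambda>i G. w i G + w' i G) \<sigma> = (assemble j w \<otimes>\<^bsub>cochains I j\<^esub> assemble j w') \<sigma>"
    using \<sigma> by (simp add: assemble_def coefficients_def[abs_def] cochains_def distrib_left)
qed (simp_all add: assemble_def cochains_def)

text \<open>A cell with a chosen vertex \<open>i\<close> is the same as a vertex \<open>i\<close>
  with a face of its link, and \<open>a \<sigma>\<close> is faithful on the coordinates in
  \<open>\<sigma>\<close>.\<close>

lemma assemble_eq_iff:
  "assemble j w = assemble j w' \<longleftrightarrow> (\<forall>i\<in>V. \<forall>G\<in>faces_of_dim (link \<Delta> i) (int j - 1). w i G = w' i G)"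
proof
  assume eq: "assemble j w = assemble j w'"
  show "\<forall>i\<in>V. \<forall>G\<in>faces_of_dim (link \<Delta> i) (int j - 1). w i G = w' i G"
  proof (intro ballI)
    fix i G assume G: "G \<in> faces_of_dim (link \<Delta> i) (int j - 1)"
    have c: "insert i G \<in> cells j" by (rule link_face_cell[OF G])
    have "i \<notin> G" using G by (simp add: link_faces)
    moreover have "coefficients w (insert i G) i = coefficients w' (insert i G) i"
      using fun_cong[OF eq, of "insert i G"] c a_eq cellD[OF c] by (simp add: assemble_def)
    ultimately have "pos_sign (insert i G) i * w i G = pos_sign (insert i G) i * w' i G"
      by (simp add: coefficients_def)
    then show "w i G = w' i G" using pos_sign_cases[of "insert i G" i] by auto
  qed
next
  assume eq: "\<forall>i\<in>V. \<forall>G\<in>faces_of_dim (link \<Delta> i) (int j - 1). w i G = w' i G"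
  show "assemble j w = assemble j w'"
    unfolding assemble_def
  proof (rule restrict_ext)
    fix \<sigma> assume \<sigma>: "\<sigma> \<in> cells j"
    have "coefficients w \<sigma> i = coefficients w' \<sigma> i" if "i \<in> \<sigma>" for i
      using eq cell_link_face[OF \<sigma> that] face_subset_V[OF _ that] cellD[OF \<sigma>] by (simp add: coefficients_def)
    then show "a \<sigma> (coefficients w \<sigma>) = a \<sigma> (coefficients w' \<sigma>)"
      using a_eq cellD[OF \<sigma>] by simp
  qed
qed

lemma assemble_zero: "assemble j (\<lambda>_ _. 0) = \<one>\<^bsub>cochains I j\<^esub>"
  unfolding assemble_def cochains_def one_product_group
  by (rule restrict_ext) (use a_eq_one cellD in \<open>simp add: coefficients_def\<close>)

text \<open>Extension by zero does not mix coordinates, so the differential acts on each vertex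
  separately. Exchanging \<open>i\<close> with the deleted vertex costs the same factor -1 for every
  face, which alters neither kernels nor images.\<close>

lemma cech_assemble:
  "cech I j (assemble j w) = assemble (Suc j) (\<lambda>i G. - link_coboundary j i (w i) G)"
proof (rule extensionalityI[of _ "cells (Suc j)"])
  fix \<tau> assume \<tau>: "\<tau> \<in> cells (Suc j)"
  have \<tau>': "\<tau> \<in> \<Delta>" "\<tau> \<noteq> {}" "finite \<tau>" using cellD[OF \<tau>] by auto
  let ?H = "stalk I \<tau>"
  interpret H: comm_group ?H by (rule group_sections[OF \<tau>'(1,2)])
  define z where "z v i = pos_sign \<tau> v * (if i \<in> \<tau> - {v} then coefficients w (\<tau> - {v}) i else 0)" for v i
  have "cech I j (assemble j w) \<tau> = finprod ?H (\<lambda>v. a \<tau> (z v)) \<tau>"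
    unfolding cech_def restrict_apply'[OF \<tau>]
  proof (rule H.finprod_cong'[OF refl])
    fix v assume v: "v \<in> \<tau>"
    have f: "\<tau> - {v} \<in> cells j" by (rule cell_facet[OF \<tau> v])
    then have ne: "\<tau> - {v} \<noteq> {}" using cellD by blast
    have "facet_restr I \<tau> v (assemble j w (\<tau> - {v})) =
        a \<tau> (\<lambda>i. if i \<in> \<tau> - {v} then coefficients w (\<tau> - {v}) i else 0)"
      using a_restr[OF \<tau>'(1) ne Diff_subset] by (simp only: assemble_def restrict_apply'[OF f])
    then show "facet_restr I \<tau> v (assemble j w (\<tau> - {v})) [^]\<^bsub>?H\<^esub> pos_sign \<tau> v = a \<tau> (z v)"
      by (simp only: a_sign[OF \<tau>'(1,2)] z_def[abs_def])
  qed (use a_closed[OF \<tau>'(1,2)] in simp)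
  also have "\<dots> = a \<tau> (\<lambda>i. \<Sum>v\<in>\<tau>. z v i)" by (rule a_sum[OF \<tau>'])
  also have "\<dots> = a \<tau> (coefficients (\<lambda>i G. - link_coboundary j i (w i) G) \<tau>)"
  proof (subst a_eq[OF \<tau>'(1,2)], intro ballI)
    fix i assume i: "i \<in> \<tau>"
    \<comment> \<open>The facet \<open>\<tau> - {i}\<close> has no coordinate \<open>i\<close>, so
      its extension by zero contributes nothing.\<close>
    have "(\<Sum>v\<in>\<tau>. z v i) = (\<Sum>v\<in>\<tau> - {i}. z v i)"
      using \<tau>'(3) i by (simp add: sum.remove[of \<tau> i] z_def)
    also have "\<dots> = (\<Sum>v\<in>\<tau> - {i}. - (pos_sign \<tau> i * (pos_sign (\<tau> - {i}) v * w i (\<tau> - {i} - {v}))))"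
    proof (rule sum.cong[OF refl])
      fix v assume v: "v \<in> \<tau> - {i}"
      have "\<tau> - {v} - {i} = \<tau> - {i} - {v}" "i \<in> \<tau> - {v}" using v i by blast+
      then have "z v i = (pos_sign (\<tau> - {v}) i * pos_sign \<tau> v) * w i (\<tau> - {i} - {v})"
        by (simp add: z_def coefficients_def)
      then show "z v i = - (pos_sign \<tau> i * (pos_sign (\<tau> - {i}) v * w i (\<tau> - {i} - {v})))"
        using pos_sign_swap[OF \<tau>'(3), of v i] v i by simp
    qed
    also have "\<dots> = coefficients (\<lambda>i G. - link_coboundary j i (w i) G) \<tau> i"
      by (simp add: coefficients_def link_coboundary_apply[OF \<tau> i] sum_distrib_left sum_negf)
    finally show "(\<Sum>v\<in>\<tau>. z v i) = coefficients (\<lambda>i G. - link_coboundary j i (w i) G) \<tau> i" .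
  qed
  finally show "cech I j (assemble j w) \<tau> = assemble (Suc j) (\<lambda>i G. - link_coboundary j i (w i) G) \<tau>"
    using \<tau> by (simp add: assemble_def)
qed (simp_all add: cech_def assemble_def)

text \<open>For the first term of a resolution of the unit sheaf this will turn out to be the kernel
  of the first differential.\<close>

definition lattice_cochains :: "nat \<Rightarrow> ('v set \<Rightarrow> 'b) set" where
  "lattice_cochains j = {x \<in> carrier (cochains I j). \<forall>\<sigma>\<in>cells j. x \<sigma> \<in> range (a \<sigma>)}"

lemma assemble_lattice: "assemble j w \<in> lattice_cochains j"
  using assemble_closed by (auto simp: lattice_cochains_def assemble_def)

lemma assemble_surj:
  assumes x: "x \<in> lattice_cochains j"
  shows "\<exists>w. (\<forall>i. w i \<in> carrier (link_cochains j i)) \<and> x = assemble j w"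
proof -
  have "\<forall>\<sigma>\<in>cells j. \<exists>z. x \<sigma> = a \<sigma> z" using x by (auto simp: lattice_cochains_def)
  then obtain z where z: "\<And>\<sigma>. \<sigma> \<in> cells j \<Longrightarrow> x \<sigma> = a \<sigma> (z \<sigma>)" by metis
  \<comment> \<open>The sign has square 1, so the twist in \<open>coefficients\<close> is undone by
    the same sign.\<close>
  define w where "w i = (\<lambda>G\<in>faces_of_dim (link \<Delta> i) (int j - 1). pos_sign (insert i G) i * z (insert i G) i)" for i
  have "x = assemble j w"
  proof (rule extensionalityI[of _ "cells j"])
    fix \<sigma> assume \<sigma>: "\<sigma> \<in> cells j"
    have "z \<sigma> i = coefficients w \<sigma> i" if i: "i \<in> \<sigma>" for i
      using cell_link_face[OF \<sigma> i] i
      by (simp add: coefficients_def w_def insert_absorb mult.assoc[symmetric])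
    then have "a \<sigma> (z \<sigma>) = a \<sigma> (coefficients w \<sigma>)" using a_eq cellD[OF \<sigma>] by simp
    then show "x \<sigma> = assemble j w \<sigma>" using z \<sigma> by (simp add: assemble_def)
  qed (use x in \<open>auto simp: lattice_cochains_def cochains_def PiE_iff assemble_def\<close>)
  moreover have "w i \<in> carrier (link_cochains j i)" for i
    by (simp add: w_def link_cochains_def simplicial_cochains_def)
  ultimately show ?thesis by blast
qed

lemma subgroup_lattice_cochains: "subgroup (lattice_cochains j) (cochains I j)"
proof -
  interpret C: comm_group "cochains I j" by (rule comm_group_cochains[OF I])
  show ?thesis
  proof (rule C.subgroupI)
    show "lattice_cochains j \<subseteq> carrier (cochains I j)" by (auto simp: lattice_cochains_def)
    show "lattice_cochains j \<noteq> {}" using assemble_lattice by blast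
    fix x y assume "x \<in> lattice_cochains j"
    then obtain w where w: "x = assemble j w" using assemble_surj by blast
    have "assemble j (\<lambda>i G. - w i G) \<otimes>\<^bsub>cochains I j\<^esub> x = \<one>\<^bsub>cochains I j\<^esub>"
      using assemble_add[of j "\<lambda>i G. - w i G" w] by (simp add: w assemble_zero)
    then have "inv\<^bsub>cochains I j\<^esub> x = assemble j (\<lambda>i G. - w i G)"
      by (rule C.inv_equality) (simp_all add: w assemble_closed)
    then show "inv\<^bsub>cochains I j\<^esub> x \<in> lattice_cochains j" by (simp add: assemble_lattice)
    assume "y \<in> lattice_cochains j"
    then obtain w' where w': "y = assemble j w'" using assemble_surj by blast
    show "x \<otimes>\<^bsub>cochains I j\<^esub> y \<in> lattice_cochains j"
      unfolding w w' assemble_add[symmetric] by (rule assemble_lattice)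
  qed
qed

text \<open>The span is the product over \<open>V\<close> of the cocycle groups of the links:
  \<open>assemble\<close> maps it onto the lattice cocycles, passage to cosets onto the sum of the
  cohomology groups. What remains is to match the coboundaries.\<close>

theorem lattice_cohomology_iso:
  "(cochains I j)\<lparr>carrier := lattice_cochains j \<inter> kernel (cochains I j) (cochains I (Suc j)) (cech I j)\<rparr>
     Mod (case j of 0 \<Rightarrow> {\<one>\<^bsub>cochains I 0\<^esub>} | Suc i \<Rightarrow> cech I i ` lattice_cochains i)
   \<cong> sum_group V (\<lambda>i. reduced_cohomology (link \<Delta> i) (int j - 1))"
proof -
  let ?faces = "\<lambda>j i. faces_of_dim (link \<Delta> i) (int j - 1)"
  define Z where "Z i = cocycles (link \<Delta> i) (int j - 1)" for i
  define B where "B i = coboundaries (link \<Delta> i) (int j - 1)" for i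
  define S where "S i = (link_cochains j i)\<lparr>carrier := Z i\<rparr>" for i
  define W where "W = product_group V S"
  define K where "K = kernel (cochains I j) (cochains I (Suc j)) (cech I j)"
  define N where "N = (case j of 0 \<Rightarrow> {\<one>\<^bsub>cochains I 0\<^esub>} | Suc i \<Rightarrow> cech I i ` lattice_cochains i)"
  define G where "G = (cochains I j)\<lparr>carrier := lattice_cochains j \<inter> K\<rparr>"
  have S: "comm_group (S i)" for i
    unfolding S_def Z_def link_cochains_def by (rule comm_group_cocycles[OF link_down_closed])
  have BS: "subgroup (B i) (S i)" for i
    unfolding S_def Z_def B_def link_cochains_def by (rule subgroup_coboundaries[OF link_down_closed])
  have norm: "B i \<lhd> S i" for i by (rule comm_group.subgroup_imp_normal[OF S BS])
  have red: "reduced_cohomology (link \<Delta> i) (int j - 1) = S i Mod B i" for i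
    unfolding S_def Z_def B_def link_cochains_def by (rule reduced_cohomology_eq)
  have W: "group W" unfolding W_def by (rule product_group) (rule comm_group.axioms(2)[OF S])
  have Z_iff: "c \<in> Z i \<longleftrightarrow> c \<in> carrier (link_cochains j i) \<and> (\<forall>F\<in>?faces (Suc j) i. link_coboundary j i c F = 0)" for i c
  proof -
    have "link_coboundary j i c = \<one>\<^bsub>simplicial_cochains (link \<Delta> i) (int j - 1 + 1)\<^esub> \<longleftrightarrow>
        (\<forall>F\<in>?faces (Suc j) i. link_coboundary j i c F = 0)"
      by (auto simp: link_coboundary_def coboundary_def simplicial_cochains_def restrict_def fun_eq_iff)
    then show ?thesis
      by (simp add: Z_def cocycles_def kernel_def link_cochains_def link_coboundary_def)
  qed
  have carrier_W: "w \<in> carrier W \<longleftrightarrow> w \<in> (\<Pi>\<^sub>E i\<in>V. Z i)" for w by (simp add: W_def S_def)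
  have assemble_cong: "assemble q w = assemble q w'" if "\<And>i F. i \<in> V \<Longrightarrow> F \<in> ?faces q i \<Longrightarrow> w i F = w' i F" for q w w'
    using that by (simp add: assemble_eq_iff)
  have cech_one: "cech I j (assemble j w) = \<one>\<^bsub>cochains I (Suc j)\<^esub> \<longleftrightarrow>
      (\<forall>i\<in>V. \<forall>F\<in>?faces (Suc j) i. link_coboundary j i (w i) F = 0)" for w
    unfolding cech_assemble assemble_zero[symmetric] assemble_eq_iff by simp
  have sub: "subgroup (lattice_cochains j \<inter> K) (cochains I j)"
  proof -
    have g: "group (cochains I q)" for q by (rule comm_group.axioms(2)[OF comm_group_cochains[OF I]])
    have "subgroup K (cochains I j)" unfolding K_def by (rule subgroup_kernel_hom[OF g g cech_hom[OF I]])
    then show ?thesis using group.subgroups_Inter_pair[OF g subgroup_lattice_cochains] by blast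
  qed
  have G: "comm_group G" unfolding G_def by (rule comm_group_subgroup[OF comm_group_cochains[OF I] sub])
  have N: "subgroup N G"
  proof -
    have g: "group (cochains I q)" for q by (rule comm_group.axioms(2)[OF comm_group_cochains[OF I]])
    show ?thesis
    proof (cases j)
      case 0
      then show ?thesis
        using group.triv_subgroup[OF comm_group.axioms(2)[OF G]] by (simp add: N_def G_def)
    next
      case (Suc m)
      have "subgroup (cech I m ` lattice_cochains m) (cochains I j)"
        unfolding Suc by (rule subgroup_hom_image[OF g g cech_hom[OF I] subgroup_lattice_cochains])
      moreover have "cech I m ` lattice_cochains m \<subseteq> lattice_cochains j \<inter> K"
      proof
        fix x assume "x \<in> cech I m ` lattice_cochains m"
        then obtain y where y: "y \<in> lattice_cochains m" "x = cech I m y" by blast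
        obtain w where w: "y = assemble m w" using assemble_surj[OF y(1)] by blast
        have "x \<in> lattice_cochains j" unfolding y(2) w cech_assemble Suc by (rule assemble_lattice)
        moreover have "x \<in> K"
          using cech_cech[OF I, of y m] hom_in_carrier[OF cech_hom[OF I], of y m] y
          by (simp add: K_def kernel_def Suc lattice_cochains_def)
        ultimately show "x \<in> lattice_cochains j \<inter> K" by blast
      qed
      ultimately show ?thesis
        unfolding G_def N_def Suc nat.case by (rule subgroup_of_subgroup[OF g sub[unfolded Suc], unfolded Suc])
    qed
  qed
  have H: "group (sum_group V (\<lambda>i. S i Mod B i))"
    by (rule sum_group) (rule normal.factorgroup_is_group[OF norm])
  \<comment> \<open>For finite \<open>V\<close> the direct sum has the full product as its carrier,
    so families of cosets carry no support condition.\<close>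
  have carrier_H: "carrier (sum_group V (\<lambda>i. S i Mod B i)) = (\<Pi>\<^sub>E i\<in>V. carrier (S i Mod B i))"
    using finite_V by (subst carrier_sum_group) (auto intro: normal.factorgroup_is_group[OF norm])
  define h where "h w = (\<lambda>i\<in>V. B i #>\<^bsub>S i\<^esub> w i)" for w
  have Bi: "w i \<in> B i \<longleftrightarrow> B i #>\<^bsub>S i\<^esub> w i = B i" if "w i \<in> Z i" for w i
  proof -
    have "w i \<in> carrier (S i)" using that by (simp add: S_def)
    then show ?thesis
      using group.coset_join1[OF comm_group.axioms(2)[OF S] _ _ BS]
        group.coset_join2[OF comm_group.axioms(2)[OF S] _ BS] by blast
  qed
  have "G Mod N \<cong> sum_group V (\<lambda>i. S i Mod B i)"
  proof (rule Mod_iso_by_span[OF W G N H])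
    show "assemble j \<in> hom W G"
    proof (rule homI)
      fix w assume "w \<in> carrier W"
      then have "w i \<in> Z i" if "i \<in> V" for i using that by (auto simp: carrier_W)
      then have "cech I j (assemble j w) = \<one>\<^bsub>cochains I (Suc j)\<^esub>" unfolding cech_one using Z_iff by blast
      then show "assemble j w \<in> carrier G"
        by (simp add: G_def assemble_lattice K_def kernel_def assemble_closed)
      fix w'
      have "assemble j (w \<otimes>\<^bsub>W\<^esub> w') = assemble j (\<lambda>i F. w i F + w' i F)"
        by (rule assemble_cong) (simp add: W_def S_def link_cochains_def simplicial_cochains_def)
      then show "assemble j (w \<otimes>\<^bsub>W\<^esub> w') = assemble j w \<otimes>\<^bsub>G\<^esub> assemble j w'"
        by (simp add: G_def assemble_add)
    qed
    show "assemble j ` carrier W = carrier G"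
    proof (intro equalityI subsetI)
      fix x assume "x \<in> assemble j ` carrier W"
      then show "x \<in> carrier G" using hom_in_carrier[OF \<open>assemble j \<in> hom W G\<close>] by blast
    next
      fix x assume "x \<in> carrier G"
      then have x: "x \<in> lattice_cochains j" "cech I j x = \<one>\<^bsub>cochains I (Suc j)\<^esub>"
        by (auto simp: G_def K_def kernel_def)
      obtain w where w: "\<forall>i. w i \<in> carrier (link_cochains j i)" "x = assemble j w"
        using assemble_surj[OF x(1)] by blast
      have "restrict w V \<in> carrier W"
        using x(2) w(1) unfolding w(2) cech_one by (simp add: carrier_W Z_iff)
      moreover have "x = assemble j (restrict w V)" unfolding w(2) by (rule assemble_cong) simp
      ultimately show "x \<in> assemble j ` carrier W" by blast
    qed
    show "h \<in> hom W (sum_group V (\<lambda>i. S i Mod B i))"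
    proof (rule homI)
      have r: "(\<lambda>c. B i #>\<^bsub>S i\<^esub> c) \<in> hom (S i) (S i Mod B i)" for i by (rule normal.r_coset_hom_Mod[OF norm])
      fix w assume "w \<in> carrier W"
      then have w: "w i \<in> carrier (S i)" if "i \<in> V" for i using that by (auto simp: W_def)
      show "h w \<in> carrier (sum_group V (\<lambda>i. S i Mod B i))"
        unfolding carrier_H using hom_in_carrier[OF r w] by (simp add: h_def)
      fix w' assume "w' \<in> carrier W"
      then have w': "w' i \<in> carrier (S i)" if "i \<in> V" for i using that by (auto simp: W_def)
      show "h (w \<otimes>\<^bsub>W\<^esub> w') = h w \<otimes>\<^bsub>sum_group V (\<lambda>i. S i Mod B i)\<^esub> h w'"
        using hom_mult[OF r w w'] by (auto simp: h_def W_def intro!: restrict_ext)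
    qed
    show "h ` carrier W = carrier (sum_group V (\<lambda>i. S i Mod B i))"
    proof (intro equalityI subsetI)
      fix y assume "y \<in> h ` carrier W"
      then show "y \<in> carrier (sum_group V (\<lambda>i. S i Mod B i))"
        using hom_in_carrier[OF \<open>h \<in> hom W (sum_group V (\<lambda>i. S i Mod B i))\<close>] by blast
    next
      fix y assume "y \<in> carrier (sum_group V (\<lambda>i. S i Mod B i))"
      then have y: "y \<in> (\<Pi>\<^sub>E i\<in>V. carrier (S i Mod B i))" by (simp add: carrier_H)
      then have "\<forall>i\<in>V. \<exists>c. c \<in> carrier (S i) \<and> y i = B i #>\<^bsub>S i\<^esub> c"
        by (auto simp: PiE_iff FactGroup_def RCOSETS_def)
      then obtain c where c: "\<And>i. i \<in> V \<Longrightarrow> c i \<in> carrier (S i) \<and> y i = B i #>\<^bsub>S i\<^esub> c i" by metis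
      have "restrict c V \<in> carrier W" using c by (simp add: W_def)
      moreover have "y = h (restrict c V)"
        using y c by (intro extensionalityI[of _ V]) (auto simp: h_def PiE_iff)
      ultimately show "y \<in> h ` carrier W" by blast
    qed
    fix w assume "w \<in> carrier W"
    then have w: "w i \<in> Z i" if "i \<in> V" for i using that by (auto simp: carrier_W)
    then have wc: "w i \<in> carrier (link_cochains j i)" if "i \<in> V" for i using that Z_iff by blast
    have "h w = \<one>\<^bsub>sum_group V (\<lambda>i. S i Mod B i)\<^esub> \<longleftrightarrow> (\<forall>i\<in>V. w i \<in> B i)"
      using Bi w by (auto simp: h_def restrict_def fun_eq_iff)
    also have "\<dots> \<longleftrightarrow> assemble j w \<in> N"
    proof (cases j)
      case 0
      have "w i \<in> B i \<longleftrightarrow> (\<forall>F\<in>?faces j i. w i F = 0)" if i: "i \<in> V" for i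
      proof -
        \<comment> \<open>The target degree is -1, where the only possible face is empty and the sum
          over its vertices is an empty sum. So the coboundaries are trivial, in accordance with the
          trivial \<open>N\<close> in Cech degree zero.\<close>
        have triv: "coboundary (link \<Delta> i) (int j - 1 - 1) c = \<one>\<^bsub>link_cochains j i\<^esub>" for c
          unfolding coboundary_def link_cochains_def simplicial_cochains_def
          by (auto simp: 0 faces_of_dim_def intro!: restrict_ext)
        have "group (simplicial_cochains (link \<Delta> i) (int j - 1 - 1))"
          by (rule group_simplicial_cochains)
        then have ne: "carrier (simplicial_cochains (link \<Delta> i) (int j - 1 - 1)) \<noteq> {}"
          using group.is_monoid monoid.one_closed by blast
        have "B i = (\<lambda>_. \<one>\<^bsub>link_cochains j i\<^esub>) ` carrier (simplicial_cochains (link \<Delta> i) (int j - 1 - 1))"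
          unfolding B_def coboundaries_def by (rule image_cong) (simp_all only: triv)
        also have "\<dots> = {\<one>\<^bsub>link_cochains j i\<^esub>}" using ne by (simp add: image_constant_conv)
        finally have "B i = {\<one>\<^bsub>link_cochains j i\<^esub>}" .
        then have "w i \<in> B i \<longleftrightarrow> w i = \<one>\<^bsub>link_cochains j i\<^esub>" by simp
        also have "\<dots> \<longleftrightarrow> (\<forall>F\<in>?faces j i. w i F = 0)"
        proof
          assume "\<forall>F\<in>?faces j i. w i F = 0"
          then show "w i = \<one>\<^bsub>link_cochains j i\<^esub>"
            using wc[OF i] by (intro extensionalityI[of _ "?faces j i"])
              (auto simp: link_cochains_def simplicial_cochains_def PiE_iff)
        qed (simp add: link_cochains_def simplicial_cochains_def)
        finally show ?thesis .
      qed
      then have "(\<forall>i\<in>V. w i \<in> B i) \<longleftrightarrow> (\<forall>i\<in>V. \<forall>F\<in>?faces j i. w i F = 0)" by blast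
      also have "\<dots> \<longleftrightarrow> assemble j w = \<one>\<^bsub>cochains I j\<^esub>"
        unfolding assemble_zero[symmetric] assemble_eq_iff ..
      finally show ?thesis by (simp add: N_def 0)
    next
      case (Suc m)
      have jm: "int j - 1 - 1 = int m - 1" by (simp add: Suc)
      have B_eq: "B i = link_coboundary m i ` carrier (link_cochains m i)" for i
        unfolding B_def coboundaries_def jm link_coboundary_def link_cochains_def ..
      have ext: "link_coboundary m i c \<in> extensional (?faces j i)" for i c
        by (simp add: link_coboundary_def coboundary_def Suc)
      have eq_iff: "w i = link_coboundary m i c \<longleftrightarrow> (\<forall>F\<in>?faces j i. w i F = link_coboundary m i c F)" if "i \<in> V" for i c
      proof
        assume "\<forall>F\<in>?faces j i. w i F = link_coboundary m i c F"
        then show "w i = link_coboundary m i c"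
          using wc[OF that] ext[of i c] by (intro extensionalityI[of _ "?faces j i"])
            (auto simp: link_cochains_def simplicial_cochains_def PiE_iff)
      qed simp
      \<comment> \<open>The Cech differential is minus the coboundary of the link, so primitives on
        the two sides differ by a sign.\<close>
      have neg: "link_coboundary m i (\<lambda>F\<in>?faces m i. - c F) F = - link_coboundary m i c F" if F: "F \<in> ?faces j i" for i c F
      proof -
        have F': "F \<in> faces_of_dim (link \<Delta> i) (int m - 1 + 1)" using F by (simp add: Suc)
        show ?thesis
          unfolding link_coboundary_def coboundary_apply[OF F']
          using faces_of_dim_facet[OF link_down_closed F'] by (simp add: sum_negf)
      qed
      show ?thesis
      proof
        assume "\<forall>i\<in>V. w i \<in> B i"
        then have "\<forall>i\<in>V. \<exists>c. w i = link_coboundary m i c" unfolding B_eq by blast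
        then obtain c where c: "\<And>i. i \<in> V \<Longrightarrow> w i = link_coboundary m i (c i)" by metis
        have "assemble j w = cech I m (assemble m (\<lambda>i. \<lambda>F\<in>?faces m i. - c i F))"
          unfolding cech_assemble Suc[symmetric] by (rule assemble_cong) (simp add: neg c)
        then show "assemble j w \<in> N" using assemble_lattice by (auto simp: N_def Suc)
      next
        assume "assemble j w \<in> N"
        then obtain x where x: "x \<in> lattice_cochains m" "assemble j w = cech I m x" by (auto simp: N_def Suc)
        obtain c where c: "x = assemble m c" using assemble_surj[OF x(1)] by blast
        have "assemble j w = assemble j (\<lambda>i F. - link_coboundary m i (c i) F)"
          using x(2) unfolding c cech_assemble Suc .
        then have "w i F = link_coboundary m i (\<lambda>F\<in>?faces m i. - c i F) F" if "i \<in> V" "F \<in> ?faces j i" for i F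
          using that by (simp add: assemble_eq_iff neg)
        then have "w i = link_coboundary m i (\<lambda>F\<in>?faces m i. - c i F)" if "i \<in> V" for i
          using eq_iff that by blast
        then show "\<forall>i\<in>V. w i \<in> B i"
          unfolding B_eq by (auto simp: link_cochains_def simplicial_cochains_def intro!: image_eqI)
      qed
    qed
    finally show "assemble j w \<in> N \<longleftrightarrow> h w = \<one>\<^bsub>sum_group V (\<lambda>i. S i Mod B i)\<^esub>" by blast
  qed
  then show ?thesis unfolding G_def N_def K_def red .
qed

end

text \<open>The augmentation carries the lattices of sections of \<open>F\<close> into the first
  term of the resolution, and exactness there identifies the kernel of the first differential with
  the lattice cochains. Thus the Cech edge of the double complex becomes the complex that splits
  over the vertices.\<close>

theorem (in face_space) derived_iso_link_cohomology:
  fixes F :: "('p, 'a) group_presheaf" and R :: "('p, 'a, 'b) sheaf_resolution"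
  assumes res: "injective_resolution X F R"
    and V: "finite V" "\<And>i. {i} \<in> \<Delta> \<longleftrightarrow> i \<in> V"
    and u_closed: "\<And>\<sigma> z. \<sigma> \<in> \<Delta> \<Longrightarrow> \<sigma> \<noteq> {} \<Longrightarrow> u \<sigma> z \<in> carrier (stalk F \<sigma>)"
    and u_add: "\<And>\<sigma> z y. \<sigma> \<in> \<Delta> \<Longrightarrow> \<sigma> \<noteq> {} \<Longrightarrow>
      u \<sigma> (\<lambda>i. z i + y i) = u \<sigma> z \<otimes>\<^bsub>stalk F \<sigma>\<^esub> u \<sigma> y"
    and u_eq: "\<And>\<sigma> z y. \<sigma> \<in> \<Delta> \<Longrightarrow> \<sigma> \<noteq> {} \<Longrightarrow> u \<sigma> z = u \<sigma> y \<longleftrightarrow> (\<forall>i\<in>\<sigma>. z i = (y i :: int))"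
    and u_surj: "\<And>\<sigma> s. \<sigma> \<in> \<Delta> \<Longrightarrow> \<sigma> \<noteq> {} \<Longrightarrow> s \<in> carrier (stalk F \<sigma>) \<Longrightarrow> \<exists>z. s = u \<sigma> z"
    and u_restr: "\<And>\<sigma> \<tau> z. \<tau> \<in> \<Delta> \<Longrightarrow> \<sigma> \<noteq> {} \<Longrightarrow> \<sigma> \<subseteq> \<tau> \<Longrightarrow>
      restr F (nbhd \<sigma>) (nbhd \<tau>) (u \<sigma> z) = u \<tau> (\<lambda>i. if i \<in> \<sigma> then z i else 0)"
  shows "derived_global_sections X R j \<cong> sum_group V (\<lambda>i. reduced_cohomology (link \<Delta> i) (int j - 1))"
proof -
  define I where "I = term_of R 0"
  define a where "a \<sigma> z = augm R (nbhd \<sigma>) (u \<sigma> z)" for \<sigma> z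
  have mono: "sheaf_mono X F I (augm R)" using res by (simp add: injective_resolution_def I_def)
  have mor: "sheaf_morphism X F I (augm R)" using mono by (simp add: sheaf_mono_def)
  have ex: "sheaf_exact X F (augm R) I (differential R 0) (term_of R 1)"
    using res by (simp add: injective_resolution_def I_def)
  have I: "presheaf X I" using res by (simp add: injective_resolution_def injective_sheaf_def sheaf_def I_def)
  have hom: "augm R (nbhd \<sigma>) \<in> hom (stalk F \<sigma>) (stalk I \<sigma>)"
    if "\<sigma> \<in> \<Delta>" "\<sigma> \<noteq> {}" for \<sigma> using sheaf_morphism_hom[OF mor openin_nbhd[OF that]] .
  have a_eq: "a \<sigma> z = a \<sigma> y \<longleftrightarrow> (\<forall>i\<in>\<sigma>. z i = y i)" if \<sigma>: "\<sigma> \<in> \<Delta>" "\<sigma> \<noteq> {}" for \<sigma> z y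
  proof -
    have "inj_on (augm R (nbhd \<sigma>)) (carrier (stalk F \<sigma>))"
      using mono openin_nbhd[OF \<sigma>] by (simp add: sheaf_mono_def)
    then show ?thesis
      unfolding a_def u_eq[OF \<sigma>, symmetric] by (rule inj_on_eq_iff) (rule u_closed[OF \<sigma>])+
  qed
  interpret S: face_lattice_system \<Delta> X pt I a V
  proof
    fix \<sigma> z y assume \<sigma>: "\<sigma> \<in> \<Delta>" "\<sigma> \<noteq> {}"
    show "a \<sigma> z \<in> carrier (stalk I \<sigma>)"
      unfolding a_def by (rule hom_in_carrier[OF hom[OF \<sigma>] u_closed[OF \<sigma>]])
    show "a \<sigma> (\<lambda>i. z i + y i) = a \<sigma> z \<otimes>\<^bsub>stalk I \<sigma>\<^esub> a \<sigma> y"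
      unfolding a_def u_add[OF \<sigma>] by (rule hom_mult[OF hom[OF \<sigma>] u_closed[OF \<sigma>] u_closed[OF \<sigma>]])
    show "a \<sigma> z = a \<sigma> y \<longleftrightarrow> (\<forall>i\<in>\<sigma>. z i = y i)" by (rule a_eq[OF \<sigma>])
  next
    fix \<tau> \<sigma> z assume \<sigma>: "\<tau> \<in> \<Delta>" "\<sigma> \<noteq> {}" "\<sigma> \<subseteq> \<tau>"
    have s: "\<sigma> \<in> \<Delta>" "\<tau> \<noteq> {}" using face_mono[OF \<sigma>(1,3)] \<sigma>(2,3) by auto
    show "restr I (nbhd \<sigma>) (nbhd \<tau>) (a \<sigma> z) = a \<tau> (\<lambda>i. if i \<in> \<sigma> then z i else 0)"
      unfolding a_def u_restr[OF \<sigma>, symmetric]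
      by (rule sheaf_morphism_natural[OF mor openin_nbhd[OF s(1) \<sigma>(2)] openin_nbhd[OF \<sigma>(1) s(2)]
            nbhd_anti[OF \<sigma>(3)] u_closed[OF s(1) \<sigma>(2)]])
  qed (use V I in auto)
  \<comment> \<open>A point of the space is a nonempty face, whose lattice contains a copy of the
    integers inside \<open>'b\<close>.\<close>
  have inf: "topspace X = {} \<or> infinite (UNIV :: 'b set)"
  proof (cases "topspace X = {}")
    case False
    then obtain \<sigma> where \<sigma>: "\<sigma> \<in> \<Delta>" "\<sigma> \<noteq> {}" using topspace_pt by auto
    have "inj (\<lambda>k. a \<sigma> (\<lambda>_. k))" using \<sigma>(2) by (auto simp: inj_def a_eq[OF \<sigma>])
    then have "infinite (range (\<lambda>k. a \<sigma> (\<lambda>_. k)))" by (simp add: finite_image_iff infinite_UNIV_int)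
    then show ?thesis by (meson finite_subset subset_UNIV)
  qed simp
  have lattice: "kernel (cochains I q) (cochains (term_of R 1) q) (cochain_map (differential R 0) q) = S.lattice_cochains q" for q
  proof (intro equalityI subsetI)
    fix x assume x: "x \<in> kernel (cochains I q) (cochains (term_of R 1) q) (cochain_map (differential R 0) q)"
    then have "x \<in> cochain_map (augm R) q ` carrier (cochains F q)" using cochain_map_exact[OF ex I] by simp
    then obtain t where t: "t \<in> carrier (cochains F q)" "x = cochain_map (augm R) q t" by blast
    have "x \<sigma> \<in> range (a \<sigma>)" if \<sigma>: "\<sigma> \<in> cells q" for \<sigma>
    proof -
      have "t \<sigma> \<in> carrier (stalk F \<sigma>)" using t(1) \<sigma> by (auto simp: cochains_def PiE_iff)
      then obtain z where "t \<sigma> = u \<sigma> z" using u_surj cellD[OF \<sigma>] by blast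
      then show ?thesis using t(2) \<sigma> by (simp add: cochain_map_def a_def)
    qed
    then show "x \<in> S.lattice_cochains q" using x by (simp add: S.lattice_cochains_def kernel_def)
  next
    fix x assume "x \<in> S.lattice_cochains q"
    then have x: "x \<in> carrier (cochains I q)" "\<forall>\<sigma>\<in>cells q. \<exists>z. x \<sigma> = a \<sigma> z"
      by (auto simp: S.lattice_cochains_def)
    then obtain z where z: "\<And>\<sigma>. \<sigma> \<in> cells q \<Longrightarrow> x \<sigma> = a \<sigma> (z \<sigma>)" by metis
    have "(\<lambda>\<sigma>\<in>cells q. u \<sigma> (z \<sigma>)) \<in> carrier (cochains F q)"
      using u_closed cellD by (simp add: cochains_def)
    moreover have "x = cochain_map (augm R) q (\<lambda>\<sigma>\<in>cells q. u \<sigma> (z \<sigma>))"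
      using x(1) z by (intro extensionalityI[of _ "cells q"]) (auto simp: cochain_map_def cochains_def PiE_iff a_def)
    ultimately show "x \<in> kernel (cochains I q) (cochains (term_of R 1) q) (cochain_map (differential R 0) q)"
      using cochain_map_exact[OF ex I, of q] by blast
  qed
  show ?thesis
    using derived_global_sections_iso[OF res inf, folded I_def, unfolded lattice] S.lattice_cohomology_iso
    by (rule iso_trans)
qed

section \<open>The spectrum of a simplicial binoid\<close>

locale simplicial_binoid_on =
  fixes V :: "'v::linorder set" and \<Delta> :: "'v set set"
  assumes finite_V: "finite V" and complex: "simplicial_complex V \<Delta>"
begin

lemma face_V: "F \<in> \<Delta> \<Longrightarrow> F \<subseteq> V"
  using complex by (auto simp: simplicial_complex_def)

lemma face_down: "F \<in> \<Delta> \<Longrightarrow> G \<subseteq> F \<Longrightarrow> G \<in> \<Delta>"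
  using complex by (simp add: simplicial_complex_def)

lemma face_finite: "F \<in> \<Delta> \<Longrightarrow> finite F"
  by (rule finite_subset[OF face_V finite_V])

section \<open>Explicit form of the simplicial binoid\<close>

definition M :: "'v multiset option set binoid" where
  "M = simplicial_binoid V \<Delta>"

definition congr :: "('v multiset option \<times> 'v multiset option) set" where
  "congr = binoid_congruence (free_binoid V) (simplicial_relations V \<Delta>)"

definition nonface :: "'v multiset option \<Rightarrow> bool" where
  "nonface x \<longleftrightarrow> (case x of None \<Rightarrow> True | Some m \<Rightarrow> set_mset m \<notin> \<Delta>)"

lemma carrier_free: "x \<in> carrier (free_binoid V) \<longleftrightarrow> (case x of None \<Rightarrow> True | Some m \<Rightarrow> set_mset m \<subseteq> V)"
  by (auto simp: free_binoid_def split: option.splits)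

lemma mult_free: "x \<otimes>\<^bsub>free_binoid V\<^esub> y = (case (x, y) of (Some m, Some m') \<Rightarrow> Some (m + m') | _ \<Rightarrow> None)"
  by (simp add: free_binoid_def)

lemma mult_free_closed:
  "x \<in> carrier (free_binoid V) \<Longrightarrow> y \<in> carrier (free_binoid V) \<Longrightarrow> x \<otimes>\<^bsub>free_binoid V\<^esub> y \<in> carrier (free_binoid V)"
  by (auto simp: carrier_free mult_free split: option.splits)

lemma nonface_mult: "nonface x \<Longrightarrow> nonface (x \<otimes>\<^bsub>free_binoid V\<^esub> y)" "nonface y \<Longrightarrow> nonface (x \<otimes>\<^bsub>free_binoid V\<^esub> y)"
  by (auto simp: nonface_def mult_free split: option.splits dest: face_down)

text \<open>The relation on the right is a congruence containing the generators, because nonfaces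
  are inherited by products. Conversely, a multiset whose support is not a face is a multiple of the
  square-free monomial of its support, and that monomial is identified with
  \<open>None\<close>.\<close>

lemma congr_iff:
  "(x, y) \<in> congr \<longleftrightarrow> x \<in> carrier (free_binoid V) \<and> y \<in> carrier (free_binoid V) \<and>
    (x = y \<or> nonface x \<and> nonface y)"
proof
  assume "(x, y) \<in> congr"
  then show "x \<in> carrier (free_binoid V) \<and> y \<in> carrier (free_binoid V) \<and> (x = y \<or> nonface x \<and> nonface y)"
    unfolding congr_def
  proof induction
    case (cong_gen a b)
    then obtain F where "F \<subseteq> V" "F \<notin> \<Delta>" "a = Some (mset_set F)" "b = None"
      by (auto simp: simplicial_relations_def)
    then show ?case using cong_gen finite_subset[OF _ finite_V] by (simp add: nonface_def)
  next
    case (cong_mult a b c)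
    then show ?case using mult_free_closed nonface_mult(1) by blast
  qed blast+
next
  have None: "(x, None) \<in> congr" if x: "x \<in> carrier (free_binoid V)" "nonface x" for x
  proof (cases x)
    case None
    then show ?thesis using x unfolding congr_def by (auto intro: binoid_congruence.cong_refl)
  next
    case (Some m)
    let ?F = "set_mset m"
    have F: "?F \<subseteq> V" "?F \<notin> \<Delta>" using x by (auto simp: Some carrier_free nonface_def)
    have sub: "mset_set ?F \<subseteq># m" by (rule mset_set_set_mset_msubset)
    have "(Some (mset_set ?F), None) \<in> congr"
      unfolding congr_def
      by (rule binoid_congruence.cong_gen) (use F in \<open>auto simp: simplicial_relations_def carrier_free\<close>)
    then have "(Some (mset_set ?F) \<otimes>\<^bsub>free_binoid V\<^esub> Some (m - mset_set ?F), None \<otimes>\<^bsub>free_binoid V\<^esub> Some (m - mset_set ?F)) \<in> congr"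
      unfolding congr_def
      by (rule binoid_congruence.cong_mult) (use F in \<open>auto simp: carrier_free dest: in_diffD\<close>)
    then show ?thesis using sub by (simp add: mult_free Some)
  qed
  assume "x \<in> carrier (free_binoid V) \<and> y \<in> carrier (free_binoid V) \<and> (x = y \<or> nonface x \<and> nonface y)"
  then show "(x, y) \<in> congr"
    using None[of x] None[of y] unfolding congr_def
    by (blast intro: binoid_congruence.cong_refl binoid_congruence.cong_sym binoid_congruence.cong_trans)
qed

definition cls :: "'v multiset option \<Rightarrow> 'v multiset option set" where
  "cls x = congr `` {x}"

definition monomial :: "'v multiset \<Rightarrow> 'v multiset option set" where
  "monomial m = cls (Some m)"

lemma cls_eq_iff:
  "x \<in> carrier (free_binoid V) \<Longrightarrow> y \<in> carrier (free_binoid V) \<Longrightarrow>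
    cls x = cls y \<longleftrightarrow> x = y \<or> nonface x \<and> nonface y"
  unfolding cls_def by (auto simp: congr_iff set_eq_iff)

lemma mult_cls:
  assumes "x \<in> carrier (free_binoid V)" "y \<in> carrier (free_binoid V)"
  shows "cls x \<otimes>\<^bsub>M\<^esub> cls y = cls (x \<otimes>\<^bsub>free_binoid V\<^esub> y)"
proof -
  have *: "cls (x' \<otimes>\<^bsub>free_binoid V\<^esub> y') = cls (x \<otimes>\<^bsub>free_binoid V\<^esub> y)" if xy: "x' \<in> cls x" "y' \<in> cls y" for x' y'
  proof -
    have c: "x' \<in> carrier (free_binoid V)" "y' \<in> carrier (free_binoid V)"
      and x: "x = x' \<or> nonface x \<and> nonface x'" and y: "y = y' \<or> nonface y \<and> nonface y'"
      using xy by (auto simp: cls_def congr_iff)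
    show ?thesis
      unfolding cls_eq_iff[OF mult_free_closed[OF c] mult_free_closed[OF assms]]
      using x y nonface_mult by blast
  qed
  have "x \<in> cls x" "y \<in> cls y" using assms by (auto simp: cls_def congr_iff)
  then have "(\<Union>x'\<in>cls x. \<Union>y'\<in>cls y. cls (x' \<otimes>\<^bsub>free_binoid V\<^esub> y')) = cls (x \<otimes>\<^bsub>free_binoid V\<^esub> y)"
    using * by blast
  then show ?thesis
    by (simp add: M_def simplicial_binoid_def quotient_binoid_def cls_def congr_def)
qed

lemma monomial_mult: "set_mset m \<subseteq> V \<Longrightarrow> set_mset m' \<subseteq> V \<Longrightarrow> monomial m \<otimes>\<^bsub>M\<^esub> monomial m' = monomial (m + m')"
  unfolding monomial_def by (subst mult_cls) (simp_all add: carrier_free mult_free)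

lemma one_M: "\<one>\<^bsub>M\<^esub> = monomial {#}"
  by (simp add: M_def simplicial_binoid_def quotient_binoid_def monomial_def cls_def congr_def free_binoid_def)

lemma infty_M: "infty M = cls None"
  by (simp add: M_def simplicial_binoid_def quotient_binoid_def cls_def congr_def free_binoid_def)

lemma carrier_M: "x \<in> carrier M \<longleftrightarrow> x = infty M \<or> (\<exists>m. set_mset m \<subseteq> V \<and> x = monomial m)"
proof -
  have "carrier M = cls ` carrier (free_binoid V)"
    by (auto simp: M_def simplicial_binoid_def quotient_binoid_def quotient_def cls_def congr_def)
  also have "carrier (free_binoid V) = insert None (Some ` {m. set_mset m \<subseteq> V})" by (simp add: free_binoid_def)
  finally show ?thesis by (auto simp: infty_M monomial_def)
qed

lemma monomial_closed: "set_mset m \<subseteq> V \<Longrightarrow> monomial m \<in> carrier M"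
  by (auto simp: carrier_M)

lemma monomial_eq_iff:
  "set_mset m \<subseteq> V \<Longrightarrow> set_mset m' \<subseteq> V \<Longrightarrow> monomial m = monomial m' \<longleftrightarrow> m = m' \<or> set_mset m \<notin> \<Delta> \<and> set_mset m' \<notin> \<Delta>"
  unfolding monomial_def by (subst cls_eq_iff) (simp_all add: carrier_free nonface_def)

lemma monomial_eq_infty_iff: "set_mset m \<subseteq> V \<Longrightarrow> monomial m = infty M \<longleftrightarrow> set_mset m \<notin> \<Delta>"
  unfolding monomial_def infty_M by (subst cls_eq_iff) (simp_all add: carrier_free nonface_def)

lemma binoid_M: "is_binoid M"
  unfolding M_def by (rule is_binoid_simplicial_binoid)

lemma comm_monoid_M: "comm_monoid M"
  using binoid_M by (simp add: is_binoid_def)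

section \<open>Prime ideals and faces\<close>

definition face_monomials :: "'v set \<Rightarrow> 'v multiset option set set" where
  "face_monomials F = {monomial m | m. set_mset m \<subseteq> F}"

text \<open>For a face \<open>F\<close> this is the ideal generated by \<open>infty M\<close> and
  the variables outside \<open>F\<close>; hence larger faces give smaller primes.\<close>

definition prime_of :: "'v set \<Rightarrow> 'v multiset option set set" where
  "prime_of F = carrier M - face_monomials F"

lemma monomial_in_face_monomials:
  assumes "F \<in> \<Delta>" "set_mset m \<subseteq> V"
  shows "monomial m \<in> face_monomials F \<longleftrightarrow> set_mset m \<subseteq> F"
proof
  assume "monomial m \<in> face_monomials F"
  then obtain m' where m': "monomial m = monomial m'" "set_mset m' \<subseteq> F" by (auto simp: face_monomials_def)
  have "set_mset m' \<subseteq> V" "set_mset m' \<in> \<Delta>" using m'(2) face_V[OF assms(1)] face_down[OF assms(1)] by auto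
  then show "set_mset m \<subseteq> F" using m' monomial_eq_iff[OF assms(2)] by auto
qed (auto simp: face_monomials_def)

lemma infty_notin_face_monomials: "F \<in> \<Delta> \<Longrightarrow> infty M \<notin> face_monomials F"
proof
  assume F: "F \<in> \<Delta>" and "infty M \<in> face_monomials F"
  then obtain m where m: "monomial m = infty M" "set_mset m \<subseteq> F" by (auto simp: face_monomials_def)
  then show False using monomial_eq_infty_iff[of m] face_V[OF F] face_down[OF F] by auto
qed

lemma carrier_minus_prime_of: "F \<in> \<Delta> \<Longrightarrow> carrier M - prime_of F = face_monomials F"
  using face_V monomial_closed by (fastforce simp: prime_of_def face_monomials_def)

lemma monomial_in_prime_of:
  "F \<in> \<Delta> \<Longrightarrow> set_mset m \<subseteq> V \<Longrightarrow> monomial m \<in> prime_of F \<longleftrightarrow> \<not> set_mset m \<subseteq> F"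
  using monomial_in_face_monomials monomial_closed by (simp add: prime_of_def)

lemma infty_in_prime_of: "F \<in> \<Delta> \<Longrightarrow> infty M \<in> prime_of F"
  using infty_notin_face_monomials by (simp add: prime_of_def carrier_M)

lemma submonoid_face_monomials:
  assumes F: "F \<in> \<Delta>"
  shows "submonoid (face_monomials F) M"
proof
  show "face_monomials F \<subseteq> carrier M" using carrier_minus_prime_of[OF F] by blast
  show "\<one>\<^bsub>M\<^esub> \<in> face_monomials F" by (auto simp: one_M face_monomials_def)
  fix x y assume "x \<in> face_monomials F" "y \<in> face_monomials F"
  then obtain m m' where m: "x = monomial m" "y = monomial m'" "set_mset m \<subseteq> F" "set_mset m' \<subseteq> F"
    by (auto simp: face_monomials_def)
  then have "x \<otimes>\<^bsub>M\<^esub> y = monomial (m + m')" using monomial_mult[of m m'] face_V[OF F] by simp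
  moreover have "set_mset (m + m') \<subseteq> F" using m by simp
  ultimately show "x \<otimes>\<^bsub>M\<^esub> y \<in> face_monomials F" unfolding face_monomials_def by blast
qed

lemma infty_mult: "x \<in> carrier M \<Longrightarrow> infty M \<otimes>\<^bsub>M\<^esub> x = infty M"
  using binoid_M comm_monoid.m_comm[OF comm_monoid_M, of "infty M" x] by (simp add: is_binoid_def)

lemma mult_infty: "x \<in> carrier M \<Longrightarrow> x \<otimes>\<^bsub>M\<^esub> infty M = infty M"
  using binoid_M by (simp add: is_binoid_def)

lemma prime_prime_of:
  assumes F: "F \<in> \<Delta>"
  shows "prime_binoid_ideal M (prime_of F)"
  unfolding prime_binoid_ideal_def
proof (intro conjI ballI)
  show "prime_of F \<subseteq> carrier M" by (auto simp: prime_of_def)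
  show "infty M \<in> prime_of F" by (rule infty_in_prime_of[OF F])
  show "submonoid (carrier M - prime_of F) M"
    unfolding carrier_minus_prime_of[OF F] by (rule submonoid_face_monomials[OF F])
  fix x y assume x: "x \<in> prime_of F" and y: "y \<in> carrier M"
  have xM: "x \<in> carrier M" using x by (simp add: prime_of_def)
  show "x \<otimes>\<^bsub>M\<^esub> y \<in> prime_of F"
  proof (cases "x = infty M \<or> y = infty M")
    case True
    then show ?thesis using xM y infty_mult mult_infty infty_in_prime_of[OF F] by auto
  next
    case False
    then obtain m m' where m: "set_mset m \<subseteq> V" "x = monomial m" "set_mset m' \<subseteq> V" "y = monomial m'"
      using xM y by (auto simp: carrier_M)
    then show ?thesis using x monomial_in_prime_of[OF F] by (simp add: monomial_mult)
  qed
qed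

text \<open>A prime is determined by the variables it omits, since it contains a product iff it
  contains a factor. The omitted variables form a face: otherwise their product would be
  \<open>infty M\<close>, which lies in every prime.\<close>

lemma spec_M: "spec M = prime_of ` \<Delta>"
proof (intro equalityI subsetI)
  fix p assume "p \<in> prime_of ` \<Delta>"
  then show "p \<in> spec M" using prime_prime_of by (auto simp: spec_def)
next
  fix p assume "p \<in> spec M"
  then have p: "p \<subseteq> carrier M" "infty M \<in> p" "\<And>x y. x \<in> p \<Longrightarrow> y \<in> carrier M \<Longrightarrow> x \<otimes>\<^bsub>M\<^esub> y \<in> p"
    and sub: "submonoid (carrier M - p) M"
    by (auto simp: spec_def prime_binoid_ideal_def)
  interpret S: submonoid "carrier M - p" M by (rule sub)
  interpret M: comm_monoid M by (rule comm_monoid_M)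
  define F where "F = {i \<in> V. monomial {#i#} \<notin> p}"
  have monomial: "set_mset m \<subseteq> V \<Longrightarrow> monomial m \<in> p \<longleftrightarrow> \<not> set_mset m \<subseteq> F" for m
  proof (induction m)
    case empty
    then show ?case using S.one_closed by (simp add: one_M)
  next
    case (add i m)
    then have i: "i \<in> V" and m: "set_mset m \<subseteq> V" by auto
    have eq: "monomial (add_mset i m) = monomial {#i#} \<otimes>\<^bsub>M\<^esub> monomial m" using i m by (simp add: monomial_mult)
    have c: "monomial {#i#} \<in> carrier M" "monomial m \<in> carrier M" using i m by (simp_all add: monomial_closed)
    have "monomial (add_mset i m) \<in> p \<longleftrightarrow> monomial {#i#} \<in> p \<or> monomial m \<in> p"
    proof
      assume "monomial (add_mset i m) \<in> p"
      then show "monomial {#i#} \<in> p \<or> monomial m \<in> p" using S.m_closed[of "monomial {#i#}" "monomial m"] c eq by auto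
    next
      assume "monomial {#i#} \<in> p \<or> monomial m \<in> p"
      then show "monomial (add_mset i m) \<in> p"
        unfolding eq using p(3)[of "monomial {#i#}" "monomial m"] p(3)[of "monomial m" "monomial {#i#}"] c M.m_comm by auto
    qed
    then show ?case using add.IH[OF m] i by (auto simp: F_def)
  qed
  have FV: "F \<subseteq> V" by (auto simp: F_def)
  then have fin: "finite F" using finite_V finite_subset by blast
  have F: "F \<in> \<Delta>"
  proof (rule ccontr)
    assume "F \<notin> \<Delta>"
    then have "monomial (mset_set F) = infty M" using monomial_eq_infty_iff[of "mset_set F"] FV fin by simp
    then show False using monomial[of "mset_set F"] FV fin p(2) by simp
  qed
  have "x \<in> p \<longleftrightarrow> x \<in> prime_of F" if "x \<in> carrier M" for x
    using that monomial monomial_in_prime_of[OF F] p(2) infty_in_prime_of[OF F] by (auto simp: carrier_M)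
  then have "p = prime_of F" using p(1) by (auto simp: prime_of_def)
  then show "p \<in> prime_of ` \<Delta>" using F by blast
qed

lemma prime_of_inj: "inj_on prime_of \<Delta>"
proof (rule inj_onI)
  fix F G assume F: "F \<in> \<Delta>" and G: "G \<in> \<Delta>" and eq: "prime_of F = prime_of G"
  have "F \<subseteq> G" if "F \<in> \<Delta>" "G \<in> \<Delta>" "prime_of F = prime_of G" for F G
    using monomial_in_prime_of[OF that(1), of "mset_set F"] monomial_in_prime_of[OF that(2), of "mset_set F"]
      face_V[OF that(1)] face_finite[OF that(1)] that(3) by simp
  then show "F = G" using F G eq by blast
qed

text \<open>Exponents add, so a product of monomials is the unit only if both factors are. The
  hypothesis keeps the unit apart from \<open>infty M\<close>.\<close>

lemma nonunits_M:
  assumes "{} \<in> \<Delta>"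
  shows "nonunits M = prime_of {}"
proof -
  interpret M: comm_monoid M by (rule comm_monoid_M)
  have "x = monomial {#}" if x: "x \<in> Units M" for x
  proof -
    obtain y where y: "y \<in> carrier M" "x \<in> carrier M" "x \<otimes>\<^bsub>M\<^esub> y = monomial {#}"
      using x by (auto simp: Units_def one_M)
    have ne: "monomial {#} \<noteq> infty M" using monomial_eq_infty_iff[of "{#}"] assms by simp
    then have "x \<noteq> infty M" "y \<noteq> infty M" using y infty_mult mult_infty by auto
    then obtain m m' where m: "set_mset m \<subseteq> V" "x = monomial m" "set_mset m' \<subseteq> V" "y = monomial m'"
      using y by (auto simp: carrier_M)
    then have "m + m' = {#}" using y(3) monomial_eq_iff[of "m + m'" "{#}"] assms by (simp add: monomial_mult)
    then show ?thesis using m by simp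
  qed
  moreover have "monomial {#} \<in> Units M" using M.Units_one_closed by (simp add: one_M)
  ultimately have "Units M = {monomial {#}}" by blast
  then show ?thesis by (simp add: nonunits_def prime_of_def face_monomials_def)
qed

section \<open>The topology of the punctured spectrum\<close>

lemma basic_open_monomial:
  assumes "F \<in> \<Delta>"
  shows "basic_open M (monomial (mset_set F)) = prime_of ` {G \<in> \<Delta>. F \<subseteq> G}"
  using monomial_in_prime_of[of _ "mset_set F"] face_V[OF assms] face_finite[OF assms]
  by (auto simp: basic_open_def spec_M)

text \<open>An element avoiding the prime of \<open>F\<close> avoids the smaller prime of
  \<open>G\<close> as well, which settles basic open sets; unions and finite intersections inherit
  the property.\<close>

lemma openin_up_closed:
  assumes W: "openin (spec_topology M) W" and F: "F \<in> \<Delta>" "prime_of F \<in> W" and G: "G \<in> \<Delta>" "F \<subseteq> G"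
  shows "prime_of G \<in> W"
proof -
  have "generate_topology_on (basic_open M ` carrier M) W"
    using W unfolding spec_topology_def by (rule openin_topology_generated_by)
  then have "prime_of F \<in> W \<longrightarrow> prime_of G \<in> W"
  proof induction
    case (Basis W)
    then obtain f where f: "f \<in> carrier M" "W = basic_open M f" by auto
    show ?case
    proof
      assume "prime_of F \<in> W"
      then have "f \<notin> prime_of F" using f by (simp add: basic_open_def)
      then have "f \<in> face_monomials F" using f by (simp add: prime_of_def)
      then have "f \<in> face_monomials G" using G(2) by (auto simp: face_monomials_def)
      then show "prime_of G \<in> W" using f G(1) by (auto simp: basic_open_def spec_M prime_of_def)
    qed
  qed auto
  then show ?thesis using F by blast
qed

lemma topspace_spec: "topspace (spec_topology M) = spec M"
proof -
  interpret M: comm_monoid M by (rule comm_monoid_M)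
  have "\<one>\<^bsub>M\<^esub> \<notin> p" if "p \<in> spec M" for p
    using that submonoid.one_closed[of "carrier M - p" M] by (auto simp: spec_def prime_binoid_ideal_def)
  then have "basic_open M \<one>\<^bsub>M\<^esub> = spec M" by (auto simp: basic_open_def)
  then have "spec M \<subseteq> topspace (spec_topology M)"
    using openin_subset[OF openin_basic_open[OF M.one_closed]] by simp
  moreover have "topspace (spec_topology M) \<subseteq> spec M"
    unfolding spec_topology_def topology_generated_by_topspace by (auto simp: basic_open_def)
  ultimately show ?thesis by blast
qed

lemma punctured_points: "spec M - {nonunits M} = prime_of ` (\<Delta> - {{}})"
proof (cases "\<Delta> = {}")
  case False
  then have e: "{} \<in> \<Delta>" using face_down by blast
  then show ?thesis
    unfolding spec_M nonunits_M[OF e] using inj_on_image_set_diff[OF prime_of_inj, of \<Delta> "{{}}"] by simp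
next
  \<comment> \<open>With no vertices, \<open>simplicial_complex\<close> also admits the family
    without any face. Then the unit coincides with \<open>infty M\<close> and the spectrum is
    empty.\<close>
  case True
  have "prime_of ` \<Delta> = {}" "prime_of ` (\<Delta> - {{}}) = {}"
    by (rule image_is_empty[THEN iffD2], use True in blast)+
  then show ?thesis using spec_M by (metis empty_Diff)
qed

text \<open>The smallest neighbourhood of the prime of \<open>\<sigma>\<close> is the basic open set
  of the product of the variables in \<open>\<sigma>\<close>; it is minimal because open sets are
  up-closed.\<close>

sublocale face_space \<Delta> "punctured_spec_topology M" prime_of
proof
  show "finite \<Delta>" using finite_V face_V by (meson PowI finite_Pow_iff finite_subset subsetI)
  show "finite \<sigma>" if "\<sigma> \<in> \<Delta>" for \<sigma> using face_finite[OF that] .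
  show "\<tau> \<in> \<Delta>" if "\<sigma> \<in> \<Delta>" "\<tau> \<subseteq> \<sigma>" for \<sigma> \<tau> using face_down[OF that] .
  show "inj_on prime_of \<Delta>" by (rule prime_of_inj)
  show "topspace (punctured_spec_topology M) = prime_of ` (\<Delta> - {{}})"
    using punctured_points by (auto simp: punctured_spec_topology_def topspace_spec)
  fix \<sigma> assume \<sigma>: "\<sigma> \<in> \<Delta>" "\<sigma> \<noteq> {}"
  show "openin (punctured_spec_topology M) (prime_of ` {\<tau> \<in> \<Delta>. \<sigma> \<subseteq> \<tau>})"
    unfolding punctured_spec_topology_def openin_subtopology punctured_points
  proof (intro exI conjI)
    show "openin (spec_topology M) (basic_open M (monomial (mset_set \<sigma>)))"
      by (rule openin_basic_open[OF monomial_closed]) (use face_V[OF \<sigma>(1)] face_finite[OF \<sigma>(1)] in simp)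
    show "prime_of ` {\<tau> \<in> \<Delta>. \<sigma> \<subseteq> \<tau>} = basic_open M (monomial (mset_set \<sigma>)) \<inter> prime_of ` (\<Delta> - {{}})"
      unfolding basic_open_monomial[OF \<sigma>(1)] using \<sigma>(2) by blast
  qed
  fix W assume W: "openin (punctured_spec_topology M) W" "prime_of \<sigma> \<in> W"
  then obtain T where T: "openin (spec_topology M) T" "W = T \<inter> prime_of ` (\<Delta> - {{}})"
    by (auto simp: punctured_spec_topology_def openin_subtopology punctured_points)
  show "prime_of ` {\<tau> \<in> \<Delta>. \<sigma> \<subseteq> \<tau>} \<subseteq> W"
    using openin_up_closed[OF T(1) \<sigma>(1)] W(2) \<sigma>(2) unfolding T(2) by blast
qed

end

section \<open>Units of the structure sheaf\<close>

lemma units_of_simps: "carrier (units_of M) = Units M" "x \<otimes>\<^bsub>units_of M\<^esub> y = x \<otimes>\<^bsub>M\<^esub> y"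
  by (simp_all add: units_of_def)

context simplicial_binoid_on begin

abbreviation "frac_at p \<equiv> binoid_frac M (carrier M - p)"

abbreviation "\<O> \<sigma> \<equiv> structure_sheaf M (nbhd \<sigma>)"

definition frac_section :: "'v set \<Rightarrow> 'v multiset \<Rightarrow> 'v multiset \<Rightarrow>
    'v multiset option set set \<Rightarrow> ('v multiset option set \<times> 'v multiset option set) set" where
  "frac_section \<sigma> m m' = (\<lambda>p\<in>nbhd \<sigma>. frac_at p (monomial m) (monomial m'))"

lemma nbhd_cases:
  assumes "p \<in> nbhd \<sigma>"
  obtains \<tau> where "\<tau> \<in> \<Delta>" "\<sigma> \<subseteq> \<tau>" "p = prime_of \<tau>"
  using assms by (auto simp: nbhd_def)

lemma submonoid_prime_of: "\<tau> \<in> \<Delta> \<Longrightarrow> submonoid (carrier M - prime_of \<tau>) M"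
  by (simp add: carrier_minus_prime_of submonoid_face_monomials)

lemma monomial_notin_prime_of:
  assumes "\<tau> \<in> \<Delta>" "set_mset m \<subseteq> \<tau>"
  shows "monomial m \<in> carrier M - prime_of \<tau>"
  using assms by (auto simp: carrier_minus_prime_of face_monomials_def)

text \<open>Monomials supported in the face \<open>\<tau>\<close> form a free, hence cancellative,
  monoid inside \<open>M\<close>, so the auxiliary factor \<open>u\<close> in the equality of
  fractions can be cancelled.\<close>

lemma frac_eq_iff:
  assumes \<tau>: "\<tau> \<in> \<Delta>" and m: "set_mset m \<subseteq> \<tau>" "set_mset m' \<subseteq> \<tau>" "set_mset k \<subseteq> \<tau>" "set_mset k' \<subseteq> \<tau>"
  shows "frac_at (prime_of \<tau>) (monomial m) (monomial m') =
      frac_at (prime_of \<tau>) (monomial k) (monomial k') \<longleftrightarrow> m + k' = k + m'"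
proof -
  have V: "set_mset q \<subseteq> V" if "set_mset q \<subseteq> \<tau>" for q using that face_V[OF \<tau>] by auto
  have "frac_at (prime_of \<tau>) (monomial m) (monomial m') =
      frac_at (prime_of \<tau>) (monomial k) (monomial k') \<longleftrightarrow>
      (\<exists>u\<in>carrier M - prime_of \<tau>. u \<otimes>\<^bsub>M\<^esub> (monomial m \<otimes>\<^bsub>M\<^esub> monomial k') = u \<otimes>\<^bsub>M\<^esub> (monomial k \<otimes>\<^bsub>M\<^esub> monomial m'))"
    by (rule binoid_frac_eq_iff[OF comm_monoid_M submonoid_prime_of[OF \<tau>]])
      (use monomial_notin_prime_of[OF \<tau>] m in auto)
  also have "\<dots> \<longleftrightarrow> m + k' = k + m'"
  proof
    assume "\<exists>u\<in>carrier M - prime_of \<tau>. u \<otimes>\<^bsub>M\<^esub> (monomial m \<otimes>\<^bsub>M\<^esub> monomial k') = u \<otimes>\<^bsub>M\<^esub> (monomial k \<otimes>\<^bsub>M\<^esub> monomial m')"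
    then obtain q where q: "set_mset q \<subseteq> \<tau>"
      "monomial q \<otimes>\<^bsub>M\<^esub> (monomial m \<otimes>\<^bsub>M\<^esub> monomial k') = monomial q \<otimes>\<^bsub>M\<^esub> (monomial k \<otimes>\<^bsub>M\<^esub> monomial m')"
      by (auto simp: carrier_minus_prime_of[OF \<tau>] face_monomials_def)
    have "monomial (q + (m + k')) = monomial (q + (k + m'))"
      using q m V by (simp add: monomial_mult)
    moreover have "set_mset (q + (m + k')) \<in> \<Delta>" by (rule face_down[OF \<tau>]) (use q m in auto)
    ultimately have "q + (m + k') = q + (k + m')"
      using monomial_eq_iff[of "q + (m + k')" "q + (k + m')"] q m V by simp
    then show "m + k' = k + m'" by simp
  next
    assume "m + k' = k + m'"
    then have "monomial m \<otimes>\<^bsub>M\<^esub> monomial k' = monomial k \<otimes>\<^bsub>M\<^esub> monomial m'"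
      using m V by (simp add: monomial_mult)
    then show "\<exists>u\<in>carrier M - prime_of \<tau>. u \<otimes>\<^bsub>M\<^esub> (monomial m \<otimes>\<^bsub>M\<^esub> monomial k') = u \<otimes>\<^bsub>M\<^esub> (monomial k \<otimes>\<^bsub>M\<^esub> monomial m')"
      using monomial_notin_prime_of[OF \<tau>, of "{#}"] by auto
  qed
  finally show ?thesis .
qed

text \<open>The criterion of \<open>frac_eq_iff\<close> is the same at every face containing
  \<open>\<sigma>\<close>, so agreement at the point of \<open>\<sigma>\<close> spreads over the
  whole neighbourhood.\<close>

lemma frac_section_eq_iff:
  assumes \<sigma>: "\<sigma> \<in> \<Delta>" and m: "set_mset m \<subseteq> \<sigma>" "set_mset m' \<subseteq> \<sigma>" "set_mset k \<subseteq> \<sigma>" "set_mset k' \<subseteq> \<sigma>"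
  shows "frac_section \<sigma> m m' = frac_section \<sigma> k k' \<longleftrightarrow> m + k' = k + m'"
proof
  assume "frac_section \<sigma> m m' = frac_section \<sigma> k k'"
  from fun_cong[OF this, of "prime_of \<sigma>"] show "m + k' = k + m'"
    using pt_in_nbhd[OF \<sigma>] frac_eq_iff[OF \<sigma> m] by (simp add: frac_section_def)
next
  assume eq: "m + k' = k + m'"
  show "frac_section \<sigma> m m' = frac_section \<sigma> k k'"
    unfolding frac_section_def
  proof (rule restrict_ext)
    fix p assume "p \<in> nbhd \<sigma>"
    then obtain \<tau> where \<tau>: "\<tau> \<in> \<Delta>" "\<sigma> \<subseteq> \<tau>" "p = prime_of \<tau>" by (rule nbhd_cases)
    then show "frac_at p (monomial m) (monomial m') =
        frac_at p (monomial k) (monomial k')"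
      using frac_eq_iff[OF \<tau>(1), of m m' k k'] m eq by (simp add: subset_trans[OF _ \<tau>(2)])
  qed
qed

lemma nbhd_basic_open: "\<sigma> \<in> \<Delta> \<Longrightarrow> nbhd \<sigma> = basic_open M (monomial (mset_set \<sigma>))"
  by (simp add: nbhd_def basic_open_monomial)

lemma frac_section_closed:
  assumes \<sigma>: "\<sigma> \<in> \<Delta>" and m: "set_mset m \<subseteq> \<sigma>" "set_mset m' \<subseteq> \<sigma>"
  shows "frac_section \<sigma> m m' \<in> carrier (\<O> \<sigma>)"
proof -
  have c: "monomial m \<in> carrier M" "monomial m' \<in> carrier M"
    using m face_V[OF \<sigma>] by (simp_all add: monomial_closed)
  have op: "openin (spec_topology M) (nbhd \<sigma>)"
    unfolding nbhd_basic_open[OF \<sigma>]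
    by (rule openin_basic_open[OF monomial_closed]) (use face_V[OF \<sigma>] face_finite[OF \<sigma>] in simp)
  have notin: "monomial m' \<in> carrier M - p" if p: "p \<in> nbhd \<sigma>" for p
  proof -
    obtain \<tau> where \<tau>: "\<tau> \<in> \<Delta>" "\<sigma> \<subseteq> \<tau>" "p = prime_of \<tau>" using p by (rule nbhd_cases)
    then show ?thesis using monomial_notin_prime_of[OF \<tau>(1), of m'] m by auto
  qed
  have "frac_section \<sigma> m m' \<in> structure_sections M (nbhd \<sigma>)"
    unfolding structure_sections_def
  proof (intro CollectI conjI ballI)
    show "frac_section \<sigma> m m' \<in> (\<Pi>\<^sub>E p\<in>nbhd \<sigma>. carrier (stalk_at M p))"
      using c(1) notin by (auto simp: frac_section_def stalk_at_def localization_def)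
    fix p assume p: "p \<in> nbhd \<sigma>"
    show "\<exists>W a f. openin (spec_topology M) W \<and> p \<in> W \<and> W \<subseteq> nbhd \<sigma> \<and> a \<in> carrier M \<and> f \<in> carrier M \<and>
        (\<forall>q\<in>W. f \<notin> q \<and> frac_section \<sigma> m m' q = frac_at q a f)"
      by (rule exI[of _ "nbhd \<sigma>"], rule exI[of _ "monomial m"], rule exI[of _ "monomial m'"])
        (use op p c notin in \<open>auto simp: frac_section_def\<close>)
  qed
  then show ?thesis by (simp add: structure_sheaf_def)
qed

lemma frac_section_mult:
  assumes \<sigma>: "\<sigma> \<in> \<Delta>" and m: "set_mset m \<subseteq> \<sigma>" "set_mset m' \<subseteq> \<sigma>" "set_mset k \<subseteq> \<sigma>" "set_mset k' \<subseteq> \<sigma>"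
  shows "frac_section \<sigma> m m' \<otimes>\<^bsub>\<O> \<sigma>\<^esub> frac_section \<sigma> k k' = frac_section \<sigma> (m + k) (m' + k')"
proof -
  have V: "set_mset q \<subseteq> V" if "set_mset q \<subseteq> \<sigma>" for q using that face_V[OF \<sigma>] by auto
  have "frac_section \<sigma> m m' p \<otimes>\<^bsub>stalk_at M p\<^esub> frac_section \<sigma> k k' p =
      frac_at p (monomial (m + k)) (monomial (m' + k'))" if p: "p \<in> nbhd \<sigma>" for p
  proof -
    obtain \<tau> where \<tau>: "\<tau> \<in> \<Delta>" "\<sigma> \<subseteq> \<tau>" "p = prime_of \<tau>" using p by (rule nbhd_cases)
    have "monomial m' \<in> carrier M - p" "monomial k' \<in> carrier M - p"
      using monomial_notin_prime_of[OF \<tau>(1)] \<tau> m by blast+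
    then have "frac_at p (monomial m) (monomial m') \<otimes>\<^bsub>stalk_at M p\<^esub>
        frac_at p (monomial k) (monomial k') =
        frac_at p (monomial m \<otimes>\<^bsub>M\<^esub> monomial k) (monomial m' \<otimes>\<^bsub>M\<^esub> monomial k')"
      unfolding stalk_at_def using m V \<tau>(3)
      by (intro binoid_frac_mult[OF comm_monoid_M]) (simp_all add: monomial_closed submonoid_prime_of[OF \<tau>(1)])
    then show ?thesis using p m V by (simp add: frac_section_def monomial_mult)
  qed
  then show ?thesis by (simp add: structure_sheaf_def frac_section_def cong: restrict_cong)
qed

lemma one_structure_sheaf:
  "\<sigma> \<in> \<Delta> \<Longrightarrow> \<one>\<^bsub>\<O> \<sigma>\<^esub> = frac_section \<sigma> {#} {#}"
  by (simp add: structure_sheaf_def frac_section_def stalk_at_def localization_def one_M)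

lemma frac_section_unit:
  assumes \<sigma>: "\<sigma> \<in> \<Delta>" and m: "set_mset m \<subseteq> \<sigma>" "set_mset m' \<subseteq> \<sigma>"
  shows "frac_section \<sigma> m m' \<in> Units (\<O> \<sigma>)"
proof -
  have "frac_section \<sigma> m m' \<otimes>\<^bsub>\<O> \<sigma>\<^esub> frac_section \<sigma> m' m = \<one>\<^bsub>\<O> \<sigma>\<^esub>"
    "frac_section \<sigma> m' m \<otimes>\<^bsub>\<O> \<sigma>\<^esub> frac_section \<sigma> m m' = \<one>\<^bsub>\<O> \<sigma>\<^esub>"
    unfolding one_structure_sheaf[OF \<sigma>] using m
    by (simp_all add: frac_section_mult[OF \<sigma>] frac_section_eq_iff[OF \<sigma>])
  then show ?thesis
    using frac_section_closed[OF \<sigma> m] frac_section_closed[OF \<sigma> m(2,1)] unfolding Units_def by blast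
qed

text \<open>Over a basic open set every section is a single fraction \<open>a / t\<close>, where
  \<open>t\<close> is here a power of the product of the variables in \<open>\<sigma>\<close>.
  Invertibility puts a multiple of \<open>a\<close> outside the prime of \<open>\<sigma>\<close>,
  hence \<open>a\<close> itself, which is then a monomial supported in
  \<open>\<sigma>\<close>.\<close>

lemma unit_frac_section:
  assumes \<sigma>: "\<sigma> \<in> \<Delta>" and s: "s \<in> Units (\<O> \<sigma>)"
  shows "\<exists>m m'. set_mset m \<subseteq> \<sigma> \<and> set_mset m' \<subseteq> \<sigma> \<and> s = frac_section \<sigma> m m'"
proof -
  interpret M: comm_monoid M by (rule comm_monoid_M)
  define f where "f = monomial (mset_set \<sigma>)"
  have f: "f \<in> carrier M" unfolding f_def using face_V[OF \<sigma>] face_finite[OF \<sigma>] by (simp add: monomial_closed)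
  have nf: "nbhd \<sigma> = basic_open M f" unfolding f_def by (rule nbhd_basic_open[OF \<sigma>])
  interpret C: submonoid "face_monomials \<sigma>" M by (rule submonoid_face_monomials[OF \<sigma>])
  have "f \<in> face_monomials \<sigma>" using face_finite[OF \<sigma>] by (auto simp: f_def face_monomials_def)
  then have "f [^]\<^bsub>M\<^esub> (k :: nat) \<in> face_monomials \<sigma>" for k
    by (induction k) (simp_all add: C.m_closed)
  then have pow: "powers_of M f \<subseteq> face_monomials \<sigma>" by (auto simp: powers_of_def)
  have rep: "\<exists>a t. a \<in> carrier M \<and> t \<in> face_monomials \<sigma> \<and>
      s = (\<lambda>p\<in>nbhd \<sigma>. frac_at p a t)"
    if s: "s \<in> carrier (\<O> \<sigma>)" for s
  proof -
    obtain \<theta> where iso: "\<theta> \<in> iso (localization M (powers_of M f)) (structure_sheaf M (basic_open M f))"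
      and \<theta>: "\<forall>a\<in>carrier M. \<forall>t\<in>powers_of M f. \<theta> (binoid_frac M (powers_of M f) a t) =
         (\<lambda>p\<in>basic_open M f. frac_at p a t)"
      using structure_sheaf_basic_open[OF binoid_M f] by blast
    have "s \<in> \<theta> ` carrier (localization M (powers_of M f))"
      using s iso by (simp add: nf iso_def bij_betw_def)
    then obtain a t where "a \<in> carrier M" "t \<in> powers_of M f" "s = \<theta> (binoid_frac M (powers_of M f) a t)"
      by (auto simp: localization_def)
    then show ?thesis using \<theta> pow unfolding nf by blast
  qed
  obtain s' where s': "s \<in> carrier (\<O> \<sigma>)" "s' \<in> carrier (\<O> \<sigma>)"
    "s \<otimes>\<^bsub>\<O> \<sigma>\<^esub> s' = \<one>\<^bsub>\<O> \<sigma>\<^esub>"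
    using s by (auto simp: Units_def)
  obtain a t where a: "a \<in> carrier M" "t \<in> face_monomials \<sigma>" "s = (\<lambda>p\<in>nbhd \<sigma>. frac_at p a t)"
    using rep[OF s'(1)] by blast
  obtain a' t' where a': "a' \<in> carrier M" "t' \<in> face_monomials \<sigma>" "s' = (\<lambda>p\<in>nbhd \<sigma>. frac_at p a' t')"
    using rep[OF s'(2)] by blast
  let ?p = "prime_of \<sigma>"
  note cm = carrier_minus_prime_of[OF \<sigma>]
  have "binoid_frac M (face_monomials \<sigma>) (a \<otimes>\<^bsub>M\<^esub> a') (t \<otimes>\<^bsub>M\<^esub> t') = binoid_frac M (face_monomials \<sigma>) \<one>\<^bsub>M\<^esub> \<one>\<^bsub>M\<^esub>"
    using fun_cong[OF s'(3), of ?p] pt_in_nbhd[OF \<sigma>]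
      binoid_frac_mult[OF comm_monoid_M C.submonoid_axioms a(1) a'(1) a(2) a'(2)]
    by (simp add: structure_sheaf_def a(3) a'(3) stalk_at_def cm) (simp add: localization_def)
  then obtain u where u: "u \<in> face_monomials \<sigma>"
    "u \<otimes>\<^bsub>M\<^esub> ((a \<otimes>\<^bsub>M\<^esub> a') \<otimes>\<^bsub>M\<^esub> \<one>\<^bsub>M\<^esub>) = u \<otimes>\<^bsub>M\<^esub> (\<one>\<^bsub>M\<^esub> \<otimes>\<^bsub>M\<^esub> (t \<otimes>\<^bsub>M\<^esub> t'))"
    using binoid_frac_eq_iff[OF comm_monoid_M C.submonoid_axioms M.m_closed[OF a(1) a'(1)] M.one_closed
        C.m_closed[OF a(2) a'(2)] C.one_closed] by blast
  have uc: "u \<in> carrier M" "t \<in> carrier M" "t' \<in> carrier M" using u(1) a(2) a'(2) C.subset by auto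
  have "u \<otimes>\<^bsub>M\<^esub> (\<one>\<^bsub>M\<^esub> \<otimes>\<^bsub>M\<^esub> (t \<otimes>\<^bsub>M\<^esub> t')) \<in> face_monomials \<sigma>"
    using u(1) a(2) a'(2) by (simp add: C.m_closed uc)
  then have "a \<otimes>\<^bsub>M\<^esub> (u \<otimes>\<^bsub>M\<^esub> a') \<in> face_monomials \<sigma>"
    unfolding u(2)[symmetric] using a(1) a'(1) uc by (simp add: M.m_ac)
  then have "a \<notin> ?p"
    using prime_prime_of[OF \<sigma>] uc a'(1) unfolding prime_binoid_ideal_def prime_of_def
    by (metis DiffD2 M.m_closed)
  then have "a \<in> face_monomials \<sigma>" using a(1) by (simp add: prime_of_def)
  then obtain m where "set_mset m \<subseteq> \<sigma>" "a = monomial m" by (auto simp: face_monomials_def)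
  moreover obtain m' where "set_mset m' \<subseteq> \<sigma>" "t = monomial m'" using a(2) by (auto simp: face_monomials_def)
  ultimately show ?thesis using a(3) by (auto simp: frac_section_def)
qed

text \<open>\<open>nat\<close> truncates negative exponents to 0, so \<open>z\<close> and its
  negative yield the numerator and the denominator of a Laurent monomial.\<close>

definition nonneg_part :: "'v set \<Rightarrow> ('v \<Rightarrow> int) \<Rightarrow> 'v multiset" where
  "nonneg_part \<sigma> z = (\<Sum>i\<in>\<sigma>. replicate_mset (nat (z i)) i)"

lemma count_nonneg_part: "finite \<sigma> \<Longrightarrow> count (nonneg_part \<sigma> z) i = (if i \<in> \<sigma> then nat (z i) else 0)"
  unfolding nonneg_part_def by (induction \<sigma> rule: finite_induct) auto

lemma set_nonneg_part: "finite \<sigma> \<Longrightarrow> set_mset (nonneg_part \<sigma> z) \<subseteq> \<sigma>"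
  by (auto simp: count_nonneg_part simp flip: count_greater_zero_iff split: if_splits)

text \<open>The Laurent monomial with the exponents \<open>z\<close> on \<open>\<sigma>\<close>,
  written in lowest terms.\<close>

definition unit_section :: "'v set \<Rightarrow> ('v \<Rightarrow> int) \<Rightarrow>
    'v multiset option set set \<Rightarrow> ('v multiset option set \<times> 'v multiset option set) set" where
  "unit_section \<sigma> z = frac_section \<sigma> (nonneg_part \<sigma> z) (nonneg_part \<sigma> (\<lambda>i. - z i))"

text \<open>Cross multiplication turns equality of fractions into equality of exponent differences,
  in which the truncations cancel.\<close>

lemma frac_section_eq_unit_section:
  assumes \<sigma>: "\<sigma> \<in> \<Delta>" and m: "set_mset m \<subseteq> \<sigma>" "set_mset m' \<subseteq> \<sigma>"
  shows "frac_section \<sigma> m m' = unit_section \<sigma> z \<longleftrightarrow> (\<forall>i\<in>\<sigma>. z i = int (count m i) - int (count m' i))"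
proof -
  note fin = face_finite[OF \<sigma>]
  have *: "count m i = 0 \<and> count m' i = 0" if "i \<notin> \<sigma>" for i
    using m that by (auto simp: subset_iff not_in_iff)
  have "frac_section \<sigma> m m' = unit_section \<sigma> z \<longleftrightarrow>
      m + nonneg_part \<sigma> (\<lambda>i. - z i) = nonneg_part \<sigma> z + m'"
    unfolding unit_section_def by (rule frac_section_eq_iff[OF \<sigma> m set_nonneg_part[OF fin] set_nonneg_part[OF fin]])
  also have "\<dots> \<longleftrightarrow> (\<forall>i\<in>\<sigma>. count m i + nat (- z i) = nat (z i) + count m' i)"
    by (auto simp: multiset_eq_iff count_nonneg_part[OF fin] *)
  also have "\<dots> \<longleftrightarrow> (\<forall>i\<in>\<sigma>. z i = int (count m i) - int (count m' i))"
    by (rule ball_cong[OF refl]) linarith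
  finally show ?thesis .
qed

lemma unit_section_counts:
  assumes \<sigma>: "\<sigma> \<in> \<Delta>" and m: "set_mset m \<subseteq> \<sigma>" "set_mset m' \<subseteq> \<sigma>"
  shows "frac_section \<sigma> m m' = unit_section \<sigma> (\<lambda>i. int (count m i) - int (count m' i))"
  by (simp add: frac_section_eq_unit_section[OF assms])

text \<open>Laurent monomials identify the units over the smallest neighbourhood of
  \<open>\<sigma>\<close> with the integer vectors indexed by \<open>\<sigma>\<close>, compatibly
  with products and restrictions.\<close>

theorem cohomology_unit_sheaf:
  assumes "injective_resolution (punctured_spec_topology M) (unit_sheaf M) R"
  shows "derived_global_sections (punctured_spec_topology M) R j
    \<cong> sum_group V (\<lambda>i. reduced_cohomology (link \<Delta> i) (int j - 1))"
proof (rule derived_iso_link_cohomology[OF assms finite_V, where u = unit_section])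
  show "{i} \<in> \<Delta> \<longleftrightarrow> i \<in> V" for i using complex by (auto simp: simplicial_complex_def)
  fix \<sigma> assume \<sigma>: "\<sigma> \<in> \<Delta>"
  note fin = face_finite[OF \<sigma>]
  note pos = set_nonneg_part[OF fin]
  show "unit_section \<sigma> z \<in> carrier (stalk (unit_sheaf M) \<sigma>)" for z
    unfolding unit_section_def using frac_section_unit[OF \<sigma> pos pos] by (simp add: unit_sheaf_def units_of_simps)
  show "unit_section \<sigma> z = unit_section \<sigma> y \<longleftrightarrow> (\<forall>i\<in>\<sigma>. z i = y i)" for z y
    unfolding unit_section_def[of \<sigma> z] frac_section_eq_unit_section[OF \<sigma> pos pos]
    by (rule ball_cong[OF refl]) (simp add: count_nonneg_part[OF fin], linarith)
  show "unit_section \<sigma> (\<lambda>i. z i + y i) =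
      unit_section \<sigma> z \<otimes>\<^bsub>stalk (unit_sheaf M) \<sigma>\<^esub> unit_section \<sigma> y" for z y
  proof -
    have "unit_section \<sigma> z \<otimes>\<^bsub>\<O> \<sigma>\<^esub> unit_section \<sigma> y =
      frac_section \<sigma> (nonneg_part \<sigma> z + nonneg_part \<sigma> y) (nonneg_part \<sigma> (\<lambda>i. - z i) + nonneg_part \<sigma> (\<lambda>i. - y i))"
      unfolding unit_section_def by (rule frac_section_mult[OF \<sigma> pos pos pos pos])
    also have "\<dots> = unit_section \<sigma> (\<lambda>i. z i + y i)"
      using pos by (subst frac_section_eq_unit_section[OF \<sigma>]) (auto simp: count_nonneg_part[OF fin])
    finally show ?thesis by (simp add: unit_sheaf_def units_of_simps)
  qed
  show "\<exists>z. s = unit_section \<sigma> z" if "s \<in> carrier (stalk (unit_sheaf M) \<sigma>)" for s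
    using unit_frac_section[OF \<sigma>, of s] that unit_section_counts[OF \<sigma>]
    by (auto simp: unit_sheaf_def units_of_simps)
next
  fix \<sigma> \<tau> z assume \<tau>: "\<tau> \<in> \<Delta>" "\<sigma> \<subseteq> \<tau>"
  have fin: "finite \<sigma>" using face_finite[OF \<tau>(1)] \<tau>(2) by (rule rev_finite_subset)
  have sub: "set_mset (nonneg_part \<sigma> y) \<subseteq> \<tau>" for y using set_nonneg_part[OF fin] \<tau>(2) by blast
  \<comment> \<open>The same fraction is read over the smaller neighbourhood, where the variables in
    \<open>\<tau>\<close> outside \<open>\<sigma>\<close> have exponent 0.\<close>
  have "restrict (unit_section \<sigma> z) (nbhd \<tau>) = frac_section \<tau> (nonneg_part \<sigma> z) (nonneg_part \<sigma> (\<lambda>i. - z i))"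
    using nbhd_anti[OF \<tau>(2)] unfolding unit_section_def frac_section_def
    by (simp add: Int_absorb1)
  also have "\<dots> = unit_section \<tau> (\<lambda>i. if i \<in> \<sigma> then z i else 0)"
    by (subst frac_section_eq_unit_section[OF \<tau>(1) sub sub]) (simp add: count_nonneg_part[OF fin])
  finally show "restr (unit_sheaf M) (nbhd \<sigma>) (nbhd \<tau>) (unit_section \<sigma> z) = unit_section \<tau> (\<lambda>i. if i \<in> \<sigma> then z i else 0)"
    by (simp add: unit_sheaf_def)
qed

end

theorem theorem2p53:
  fixes n j :: nat
    and \<Delta> :: "nat set set"
    and R :: "(nat multiset option set set,
               nat multiset option set set \<Rightarrow> (nat multiset option set \<times> nat multiset option set) set,
               'b) sheaf_resolution"
  assumes "simplicial_complex {1..n} \<Delta>"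
    and "injective_resolution
           (punctured_spec_topology (simplicial_binoid {1..n} \<Delta>))
           (unit_sheaf (simplicial_binoid {1..n} \<Delta>)) R"
  shows "derived_global_sections (punctured_spec_topology (simplicial_binoid {1..n} \<Delta>)) R j
         \<cong> sum_group {1..n} (\<lambda>i. reduced_cohomology (link \<Delta> i) (int j - 1))"
proof -
  interpret simplicial_binoid_on "{1..n}" \<Delta>
    using assms(1) by unfold_locales simp
  show ?thesis using cohomology_unit_sheaf assms(2) unfolding M_def .
qed

end
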